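(* Let $(\Omega,\mathcal{F},\mathbb{P})$ be a probability space (the underlying abstract economic model) with a right-continuous filtration $(\mathcal{F}_t)_{t\ge 0}$, $\mathcal{F}=\lim_{t\to\infty}\mathcal{F}_t$, the $\mathbb{P}$-null sets of $\mathcal{F}$ being contained in $\mathcal{F}_0$ and hence in all $\mathcal{F}_t$. Let $\mathbb{S}$ be a compact metric space with Borel $\sigma$-algebra $\mathcal{S}=\mathcal{B}(\mathbb{S})$, and let the state process $X=(X_t)_{t\ge 0}$ be $\mathcal{F}_t$-adapted and measurable as a map $([0,\infty)\times\Omega,\ \mathcal{B}([0,\infty))\otimes\mathcal{F})\to(\mathbb{S},\mathcal{S})$. Let $Y=(Y_t)_{t\ge 0}$ be the process of observable variables related to $X$, of dimension not larger than that of $X$, and let $\mathcal{Y}_t=\sigma(Y_s,\ s\in[0,t])\vee\mathcal{N}$, where $\mathcal{N}$ is the collection of all $\mathbb{P}$-null sets, the filtration $(\mathcal{Y}_t)_{t\ge 0}$ being assumed right continuous; put $\mathcal{Y}=\vee_{t\in\mathbb{R}^+}\mathcal{Y}_t$. Let $\mathcal{P}(\mathbb{S})$ denote the space of all probability measures on $\mathbb{S}$, and $B(\mathbb{S})$ the space of bounded $\mathcal{S}$-measurable functions on $\mathbb{S}$. Then there is a $\mathcal{P}(\mathbb{S})$-valued conditional distribution process $\pi_t$ such that for any $\varphi\in B(\mathbb{S})$, $$\mathbb{P}\left[\int_{\mathbb{S}}\varphi(x)\,\pi_t(dx)={}^{o}\varphi(X_t)\quad\forall t\right]=1 .$$ This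 distribution process is an equilibrium process for the economy whose underlying states are in the probability space $(\Omega,\mathcal{F},\mathbb{P})$ and whose observable information is contained in $\mathcal{Y}$.
   Context: The conditional distribution process $\pi_t$ of $X_t$ given $\mathcal{Y}_t$ is the stochastic process $(\omega,t)\mapsto\pi_t(\omega)$ with $\pi_t(A)(\omega)=\mathbb{P}[X_t\in A\mid\mathcal{Y}_t](\omega)$ for $A\in\mathcal{S}$. It is called the filter, or the agents' perception, of $X$. The process ${}^{o}\varphi(X_t)$ is the $\mathcal{Y}_t$-adapted, measurable representation (optional projection) of $\varphi(X_t)$. In general, for a bounded measurable process $\xi$, the optional process ${}^{o}\xi$ is the projection of $\xi$ onto the observable information, characterized by the requirement that for every stopping time $T$ (with respect to $(\mathcal{Y}_t)$) $${}^{o}\xi_T\,\mathbb{I}_{\{T<\infty\}}=\mathbb{E}\big[\xi_T\,\mathbb{I}_{\{T<\infty\}}\mid\mathcal{Y}_T\big],$$ where $\mathbb{I}_{A}$ is the indicator of $A$ and $\mathcal{Y}_T$ is the $\sigma$-algebra of events observable up to time $T$. "Equilibrium process" is the economic term applied to the conditional distribution process $\pi_t$ whose existence is asserted; no separate formal definition of it is given. *)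

theory Defs
  imports "HOL-Probability.Probability"
begin

text \<open>
  Time runs through \<open>[0, \<infinity>)\<close>. Processes and filtrations are functions on \<^typ>\<open>real\<close> that are only
  looked at for \<open>t \<ge> 0\<close>; of a filtration only the \<open>\<sigma>\<close>-algebras \<open>sets (G t)\<close> matter.
\<close>

definition filtration_on :: "'w measure \<Rightarrow> (real \<Rightarrow> 'w measure) \<Rightarrow> bool" where
  "filtration_on M G \<longleftrightarrow>
     (\<forall>t\<ge>0. subalgebra M (G t)) \<and>
     (\<forall>s t. 0 \<le> s \<longrightarrow> s \<le> t \<longrightarrow> sets (G s) \<subseteq> sets (G t))"

definition right_continuous :: "(real \<Rightarrow> 'w measure) \<Rightarrow> bool" where
  "right_continuous G \<longleftrightarrow> (\<forall>t\<ge>0. sets (G t) = (\<Inter>s\<in>{t<..}. sets (G s)))"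

text \<open>
  No adaptedness or completeness is built in: \<open>null_sets M\<close> are the measurable sets of measure 0,
  and \<open>M\<close> may or may not be complete. The value space \<open>E\<close> of the observations is arbitrary.
\<close>

definition obs_filtration ::
  "'w measure \<Rightarrow> 'y measure \<Rightarrow> (real \<Rightarrow> 'w \<Rightarrow> 'y) \<Rightarrow> real \<Rightarrow> 'w measure" where
  "obs_filtration M E Y t =
     sigma (space M) ({Y s -` B \<inter> space M | s B. s \<in> {0..t} \<and> B \<in> sets E} \<union> null_sets M)"

text \<open>
  Stopping times take values in \<open>[0, \<infinity>]\<close>. Extending a filtration to the index type \<^typ>\<open>ennreal\<close>,
  with the terminal \<open>\<sigma>\<close>-algebra generated by all \<open>G t\<close> at \<open>\<infinity>\<close>, makes \<^const>\<open>stopping_time\<close> and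
  \<^const>\<open>filtration.pre_sigma\<close> mean the usual notions: the condition \<open>{T \<le> \<infinity>} \<in> G \<infinity>\<close> is void,
  and \<open>A\<close> is in the \<open>\<sigma>\<close>-algebra at \<open>T\<close> iff \<open>A \<in> G \<infinity>\<close> and \<open>A \<inter> {T \<le> t} \<in> G t\<close> for all finite \<open>t\<close>.
\<close>

definition ext_filtration :: "(real \<Rightarrow> 'w measure) \<Rightarrow> ennreal \<Rightarrow> 'w measure" where
  "ext_filtration G u =
     (if u = \<infinity> then sigma (space (G 0)) (\<Union>t\<in>{0..}. sets (G t)) else G (enn2real u))"

lemma filtration_ext_filtration:
  assumes "filtration_on M G"
  shows "filtration (space M) (ext_filtration G)"
proof
  have sp: "space (G t) = space M" if "t \<ge> 0" for t
    using assms that by (auto simp: filtration_on_def subalgebra_def)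
  have gen: "(\<Union>t\<in>{0..}. sets (G t)) \<subseteq> Pow (space M)"
    using sets.sets_into_space sp by fastforce
  show "space (ext_filtration G i) = space M" for i
    using gen by (auto simp: ext_filtration_def sp space_measure_of)
  show "sets (ext_filtration G i) \<subseteq> sets (ext_filtration G j)" if "i \<le> j" for i j
  proof (cases "j = \<infinity>")
    case True
    then show ?thesis
      using gen by (auto simp: ext_filtration_def sp intro!: sigma_sets.Basic bexI[of _ "enn2real i"])
  next
    case False
    then have "i \<noteq> \<infinity>" "enn2real i \<le> enn2real j"
      using that by (auto intro: enn2real_mono simp: less_top top_unique)
    then show ?thesis
      using assms False by (auto simp: ext_filtration_def filtration_on_def)
  qed
qed

definition cadlag_adapted :: "(real \<Rightarrow> 'w measure) \<Rightarrow> (real \<Rightarrow> 'w \<Rightarrow> real) \<Rightarrow> bool" where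
  "cadlag_adapted G Z \<longleftrightarrow>
     (\<forall>t\<ge>0. Z t \<in> borel_measurable (G t)) \<and>
     (\<forall>\<omega>\<in>space (G 0).
        (\<forall>t\<ge>0. ((\<lambda>s. Z s \<omega>) \<longlongrightarrow> Z t \<omega>) (at_right t)) \<and>
        (\<forall>t>0. \<exists>l. ((\<lambda>s. Z s \<omega>) \<longlongrightarrow> l) (at_left t)))"

definition optional_algebra :: "(real \<Rightarrow> 'w measure) \<Rightarrow> (real \<times> 'w) measure" where
  "optional_algebra G =
     sigma ({0..} \<times> space (G 0))
       {case_prod Z -` B \<inter> ({0..} \<times> space (G 0)) | Z B. cadlag_adapted G Z \<and> B \<in> sets borel}"

text \<open>
  Optionality of \<open>Z\<close> is part of the notion: the condition at stopping times determines a process up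
  to indistinguishability only within the optional processes. Where \<open>T = \<infinity>\<close> the indicator
  vanishes, so the value \<open>enn2real \<infinity> = 0\<close> plays no role.
\<close>

definition is_optional_projection ::
  "'w measure \<Rightarrow> (real \<Rightarrow> 'w measure) \<Rightarrow> (real \<Rightarrow> 'w \<Rightarrow> real) \<Rightarrow> (real \<Rightarrow> 'w \<Rightarrow> real) \<Rightarrow> bool" where
  "is_optional_projection M G \<xi> Z \<longleftrightarrow>
     case_prod Z \<in> borel_measurable (optional_algebra G) \<and>
     (\<forall>T. stopping_time (ext_filtration G) T \<longrightarrow>
        (AE \<omega> in M.
           Z (enn2real (T \<omega>)) \<omega> * indicator {\<omega>. T \<omega> < \<infinity>} \<omega> =
           real_cond_exp M (filtration.pre_sigma (space M) (ext_filtration G) T)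
             (\<lambda>\<omega>. \<xi> (enn2real (T \<omega>)) \<omega> * indicator {\<omega>. T \<omega> < \<infinity>} \<omega>) \<omega>))"

text \<open>
  \<^term>\<open>prob_algebra borel\<close> is the space of Borel probability measures with the \<open>\<sigma>\<close>-algebra
  generated by the evaluations at Borel sets, so measurability into it says that each \<open>\<pi> t \<omega>\<close> is
  a probability measure and that \<open>\<omega> \<mapsto> \<pi> t \<omega> A\<close> is \<open>G t\<close>-measurable for every Borel set \<open>A\<close>.
\<close>

definition conditional_distribution_process ::
  "'w measure \<Rightarrow> (real \<Rightarrow> 'w measure) \<Rightarrow> (real \<Rightarrow> 'w \<Rightarrow> 's::topological_space) \<Rightarrow>
   (real \<Rightarrow> 'w \<Rightarrow> 's measure) \<Rightarrow> bool" where
  "conditional_distribution_process M G X \<pi> \<longleftrightarrow>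
     (\<forall>t\<ge>0. \<pi> t \<in> G t \<rightarrow>\<^sub>M prob_algebra borel \<and>
        (\<forall>A\<in>sets borel. AE \<omega> in M.
           measure (\<pi> t \<omega>) A = real_cond_exp M (G t) (indicator {\<omega>. X t \<omega> \<in> A}) \<omega>))"

end

theory Submission
  imports Defs
begin

text \<open>
  Fix the filtration generated by the observations. It is right continuous and contains all
  measurable null sets. For one time \<open>t\<close> a regular conditional distribution of \<open>X t\<close> is easy to
  find, but it is only determined up to a null set that depends on \<open>t\<close>, and there are uncountably
  many times. The theorem holds because optional processes are rigid enough to be compared at all
  times at once, and because enough of them exist.

  Rigidity is the optional section theorem (\<open>optional_cross_section\<close>): an optional set that every
  stopping time avoids almost surely is, outside one null set, empty. Suppose an optional set \<open>A\<close>
  violates the conclusion. By Choquet's capacitability theorem it has a measurable section on an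
  event of positive probability (\<open>measurable_section\<close>). That section carries a finite measure on the
  optional sets, and this measure is inner regular with respect to optional sets that are closed
  under limits from the right, because \<open>{Z \<ge> c}\<close> is such a set for every cadlag process \<open>Z\<close>
  (\<open>optional_inner_regular\<close>). Hence \<open>A\<close> contains a right-closed optional set \<open>C\<close> of positive measure.
  The debut of \<open>C\<close> lies in \<open>C\<close>, and it agrees outside a null set with a stopping time, since
  projections of measurable sets lie between measurable sets of equal probability
  (\<open>right_closed_debut\<close>). This stopping time meets \<open>A\<close> with positive probability. A consequence is
  that an inequality between the expectations of two optional processes at all stopping times gives
  the inequality at all times simultaneously (\<open>optional_le\<close>).

  Existence starts from a single event \<open>F\<close>. Along the dyadic times the conditional probabilities of
  \<open>F\<close> form a martingale, which almost surely crosses each rational interval finitely often before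
  any given time. Therefore its right limits form a cadlag process, and approximating a stopping time
  by dyadic values from above identifies its stopped values (\<open>cadlag_cond_prob\<close>). This yields
  optional projections of rectangles, and a Dynkin argument extends them to all measurable subsets of
  time and space (\<open>projects_set_exists\<close>).

  To pass from sets to measures, the state space is made real: there are Borel maps \<open>h\<close> into
  \<open>[0, 1]\<close> and \<open>g\<close> back with \<open>g (h y) = y\<close> (\<open>compact_metric_borel_retract\<close>). The projections
  \<open>Z q\<close> of the sets \<open>{h X \<le> q}\<close>, for rational \<open>q\<close>, are monotone in \<open>q\<close> at all times outside one null
  set. So they define distribution functions, hence a kernel \<open>\<kappa>\<close> of probability measures on the line
  (\<open>optional_kernel\<close>), and the process \<open>\<pi>\<close> is the image of \<open>\<kappa>\<close> under \<open>g\<close>. On \<open>{T < \<infinity>}\<close> the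
  mixture of \<open>\<kappa>\<close> at a stopping time \<open>T\<close> and the law of \<open>h (X T)\<close> have the same distribution
  function. They therefore coincide, which says that the integral of \<open>\<phi>\<close> against \<open>\<pi>\<close> is an optional
  projection of \<open>\<phi> (X t)\<close> for every bounded Borel \<open>\<phi>\<close>. Any other optional projection
  agrees with it at all stopping times, hence at all times by the section theorem.
\<close>

section \<open>Capacities and measurable sections\<close>

text \<open>
  A set \<open>A\<close> qualifies if it can be exhausted by a game. A position is the list \<open>s\<close> of natural numbers
  chosen so far. Larger last choices give larger sets \<open>a s\<close>, and all choices together exhaust the
  set of the previous position; each \<open>a s\<close> is covered by a set \<open>L s\<close> of the class \<open>\<K>\<close>, and along
  every infinite play the covers shrink to a part of \<open>A\<close>. This replaces the Suslin operation: it is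
  the form in which a capacity can be followed through the choices, and it is stable under countable
  unions and intersections with hardly any coding. Covers start at the first choice because the
  whole space need not belong to \<open>\<K>\<close>.
\<close>

definition choquet_set :: "'a set set \<Rightarrow> 'a set \<Rightarrow> bool" where
  "choquet_set \<K> A \<longleftrightarrow> (\<exists>a L. a [] = A \<and>
     (\<forall>s k. a (s @ [k]) \<subseteq> a (s @ [Suc k])) \<and>
     (\<forall>s. a s \<subseteq> (\<Union>k. a (s @ [k]))) \<and>
     (\<forall>s. s \<noteq> [] \<longrightarrow> L s \<in> \<K> \<and> a s \<subseteq> L s) \<and>
     (\<forall>s k. s \<noteq> [] \<longrightarrow> L (s @ [k]) \<subseteq> L s) \<and>
     (\<forall>m. (\<Inter>n. L (map m [0..<Suc n])) \<subseteq> A))"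

lemma choquet_set_base: "K \<in> \<K> \<Longrightarrow> choquet_set \<K> K"
  unfolding choquet_set_def by (rule exI[of _ "\<lambda>_. K"], rule exI[of _ "\<lambda>_. K"]) auto

lemma map_upt_shift: "map m [i..<i + n] = map (\<lambda>j. m (i + j)) [0..<n]"
  by (rule nth_equalityI) auto

text \<open>
  All games are played with the same choices, the \<open>i\<close>-th game joining at move \<open>i\<close>. A position then
  involves only finitely many started games, so one choice can be large enough for all of them.
\<close>

lemma choquet_set_Inter:
  fixes A :: "nat \<Rightarrow> 'a set"
  assumes A: "\<And>i. choquet_set \<K> (A i)"
    and Int: "\<And>K K'. K \<in> \<K> \<Longrightarrow> K' \<in> \<K> \<Longrightarrow> K \<inter> K' \<in> \<K>"
  shows "choquet_set \<K> (\<Inter>i. A i)"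
proof -
  obtain a L where a0: "\<And>i. a i [] = A i"
    and a1: "\<And>i s k. a i (s @ [k]) \<subseteq> a i (s @ [Suc k])"
    and a2: "\<And>i s. a i s \<subseteq> (\<Union>k. a i (s @ [k]))"
    and a3: "\<And>i s. s \<noteq> [] \<Longrightarrow> L i s \<in> \<K> \<and> a i s \<subseteq> L i s"
    and a4: "\<And>i s k. s \<noteq> [] \<Longrightarrow> L i (s @ [k]) \<subseteq> L i s"
    and a5: "\<And>i m. (\<Inter>n. L i (map m [0..<Suc n])) \<subseteq> A i"
    using A unfolding choquet_set_def by metis
  have mono: "a i (s @ [k]) \<subseteq> a i (s @ [k'])" if "k \<le> k'" for i s k k'
    using lift_Suc_mono_le[of "\<lambda>k. a i (s @ [k])" k k', OF a1 that] .
  \<comment> \<open>Games that have not started yet contribute their full set \<open>A i\<close>, since \<open>drop i s\<close> is empty.\<close>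
  define b where "b s = (\<Inter>i. a i (drop i s))" for s
  define N where "N s = (\<Inter>i<length s. L i (drop i s))" for s
  have fin: "(\<Inter>i<Suc n. F i) \<in> \<K>" if "\<And>i. i < Suc n \<Longrightarrow> F i \<in> \<K>" for F :: "nat \<Rightarrow> 'a set" and n
    using that by (induction n) (auto simp: lessThan_Suc intro!: Int)
  show ?thesis unfolding choquet_set_def
  proof (rule exI[of _ b], rule exI[of _ N], intro conjI allI impI)
    show "b [] = (\<Inter>i. A i)" by (simp add: b_def a0)
    show "b (s @ [k]) \<subseteq> b (s @ [Suc k])" for s k
    proof -
      have "a i (drop i (s @ [k])) \<subseteq> a i (drop i (s @ [Suc k]))" for i
        using a1[of i "drop i s" k] by (cases "i - length s") (auto simp: drop_Cons')
      then show ?thesis by (auto simp: b_def)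
    qed
    show "b s \<subseteq> (\<Union>k. b (s @ [k]))" for s
    proof
      fix x assume x: "x \<in> b s"
      have "\<forall>i. \<exists>k. x \<in> a i (drop i s @ [k])"
        using x a2 unfolding b_def by blast
      then obtain k where k: "\<And>i. x \<in> a i (drop i s @ [k i])" by metis
      define k' where "k' = Max (k ` {..length s})"
      have "x \<in> a i (drop i (s @ [k']))" for i
      proof (cases "i \<le> length s")
        case True
        then have "k i \<le> k'" unfolding k'_def by (intro Max_ge) auto
        then show ?thesis using k[of i] mono[of "k i" k' i "drop i s"] True by auto
      next
        case False
        then have "drop i (s @ [k']) = drop i s" by simp
        then show ?thesis using x by (auto simp: b_def simp del: drop_append)
      qed
      then show "x \<in> (\<Union>k. b (s @ [k]))" unfolding b_def by blast
    qed
    show "N s \<in> \<K>" if "s \<noteq> []" for s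
    proof -
      obtain n where "length s = Suc n" using \<open>s \<noteq> []\<close> by (cases s) auto
      then show ?thesis unfolding N_def using fin[of n "\<lambda>i. L i (drop i s)"] a3 by simp
    qed
    show "b s \<subseteq> N s" for s
    proof -
      have "a i (drop i s) \<subseteq> L i (drop i s)" if "i < length s" for i
        using a3[of "drop i s" i] that by simp
      then show ?thesis unfolding b_def N_def by blast
    qed
    show "N (s @ [k]) \<subseteq> N s" for s k
    proof
      fix x assume "x \<in> N (s @ [k])"
      then have *: "\<And>i. i < Suc (length s) \<Longrightarrow> x \<in> L i (drop i (s @ [k]))" by (simp add: N_def)
      have "x \<in> L i (drop i s)" if "i < length s" for i
        using *[of i] a4[of "drop i s" i k] that by auto
      then show "x \<in> N s" by (simp add: N_def)
    qed
    show "(\<Inter>n. N (map m [0..<Suc n])) \<subseteq> (\<Inter>i. A i)" for m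
    proof
      fix x assume x: "x \<in> (\<Inter>n. N (map m [0..<Suc n]))"
      have "x \<in> A i" for i
      proof -
        have "x \<in> L i (map (\<lambda>j. m (i + j)) [0..<Suc n])" for n
        proof -
          have "x \<in> N (map m [0..<Suc (i + n)])" using x by blast
          then have "x \<in> L i (drop i (map m [0..<Suc (i + n)]))"
            unfolding N_def by (simp del: upt_Suc)
          also have "drop i (map m [0..<Suc (i + n)]) = map (\<lambda>j. m (i + j)) [0..<Suc n]"
            unfolding drop_map drop_upt using map_upt_shift[of m i "Suc n"] by simp
          finally show ?thesis .
        qed
        then show ?thesis using a5 by blast
      qed
      then show "x \<in> (\<Inter>i. A i)" by blast
    qed
  qed
qed

text \<open>
  The first choice \<open>k\<close> also selects the games \<open>0, \<dots>, k\<close>, which are played in parallel. In an infinite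
  play a point of all covers is covered infinitely often, hence always, by one of these finitely
  many games, because covers decrease.
\<close>

lemma choquet_set_Union:
  fixes A :: "nat \<Rightarrow> 'a set"
  assumes A: "\<And>i. choquet_set \<K> (A i)"
    and Un: "\<And>K K'. K \<in> \<K> \<Longrightarrow> K' \<in> \<K> \<Longrightarrow> K \<union> K' \<in> \<K>"
  shows "choquet_set \<K> (\<Union>i. A i)"
proof -
  obtain a L where a0: "\<And>i. a i [] = A i"
    and a1: "\<And>i s k. a i (s @ [k]) \<subseteq> a i (s @ [Suc k])"
    and a2: "\<And>i s. a i s \<subseteq> (\<Union>k. a i (s @ [k]))"
    and a3: "\<And>i s. s \<noteq> [] \<Longrightarrow> L i s \<in> \<K> \<and> a i s \<subseteq> L i s"
    and a4: "\<And>i s k. s \<noteq> [] \<Longrightarrow> L i (s @ [k]) \<subseteq> L i s"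
    and a5: "\<And>i m. (\<Inter>n. L i (map m [0..<Suc n])) \<subseteq> A i"
    using A unfolding choquet_set_def by metis
  have mono: "a i (s @ [k]) \<subseteq> a i (s @ [k'])" if "k \<le> k'" for i s k k'
    using lift_Suc_mono_le[of "\<lambda>k. a i (s @ [k])" k k', OF a1 that] .
  define b where "b s = (if s = [] then \<Union>i. A i else \<Union>i\<le>hd s. a i s)" for s
  define N where "N s = (\<Union>i\<le>hd s. L i s)" for s
  have fin: "(\<Union>i\<le>n. F i) \<in> \<K>" if "\<And>i. i \<le> n \<Longrightarrow> F i \<in> \<K>" for F :: "nat \<Rightarrow> 'a set" and n
    using that by (induction n) (auto simp: atMost_Suc intro!: Un)
  show ?thesis unfolding choquet_set_def
  proof (rule exI[of _ b], rule exI[of _ N], intro conjI allI impI)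
    show "b [] = (\<Union>i. A i)" by (simp add: b_def)
    show "b (s @ [k]) \<subseteq> b (s @ [Suc k])" for s k
      using a1[of _ s k] by (cases s) (fastforce simp: b_def)+
    show "b s \<subseteq> (\<Union>k. b (s @ [k]))" for s
    proof (cases "s = []")
      case True
      show ?thesis
      proof
        fix x assume "x \<in> b s"
        then obtain i where "x \<in> a i []" using True a0 by (auto simp: b_def)
        then obtain k where "x \<in> a i ([] @ [k])" using a2 by blast
        then have "x \<in> a i ([] @ [max i k])" using mono[of k "max i k" i "[]"] by auto
        then have "x \<in> b (s @ [max i k])" using True by (auto simp: b_def)
        then show "x \<in> (\<Union>k. b (s @ [k]))" by blast
      qed
    next
      case False
      then show ?thesis using a2[of _ s] by (fastforce simp: b_def)
    qed
    show "N s \<in> \<K>" if "s \<noteq> []" for s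
    proof -
      have "L i s \<in> \<K>" for i using a3[OF that] by blast
      then show ?thesis unfolding N_def by (rule fin)
    qed
    show "b s \<subseteq> N s" if "s \<noteq> []" for s
      unfolding N_def b_def using a3 that by fastforce
    show "N (s @ [k]) \<subseteq> N s" if "s \<noteq> []" for s k
      unfolding N_def using a4[OF that] that by fastforce
    show "(\<Inter>n. N (map m [0..<Suc n])) \<subseteq> (\<Union>i. A i)" for m
    proof
      fix x assume x: "x \<in> (\<Inter>n. N (map m [0..<Suc n]))"
      have hd: "hd (map m [0..<Suc n]) = m 0" for n
        by (simp add: hd_map upt_conv_Cons del: upt_Suc)
      have dec: "L i (map m [0..<Suc n']) \<subseteq> L i (map m [0..<Suc n])" if "n \<le> n'" for i n n'
        using that
      proof (induction rule: dec_induct)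
        case (step k)
        then show ?case using a4[of "map m [0..<Suc k]" i "m (Suc k)"] by auto
      qed auto
      have "\<exists>i\<le>m 0. \<forall>n. x \<in> L i (map m [0..<Suc n])"
      proof (rule ccontr)
        assume "\<not> ?thesis"
        then obtain n where n: "\<And>i. i \<le> m 0 \<Longrightarrow> x \<notin> L i (map m [0..<Suc (n i)])" by metis
        define n' where "n' = Max (n ` {..m 0})"
        obtain i where i: "i \<le> m 0" "x \<in> L i (map m [0..<Suc n'])"
        proof -
          have "x \<in> N (map m [0..<Suc n'])" using x by blast
          then show ?thesis using that unfolding N_def hd by blast
        qed
        have "n i \<le> n'" unfolding n'_def using i by (intro Max_ge) auto
        then show False using dec n[OF i(1)] i(2) by blast
      qed
      then show "x \<in> (\<Union>i. A i)" using a5 by blast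
    qed
  qed
qed

text \<open>
  Choquet's theorem. Continuity of \<open>I\<close> along increasing sets allows each choice to be made so large
  that \<open>I (a s)\<close> stays above \<open>\<alpha>\<close>; the covers along the resulting play are the required sets.
  Continuity of \<open>I\<close> along decreasing members of \<open>\<K>\<close> is left to the applications.
\<close>

lemma choquet_capacitability:
  fixes I :: "'a set \<Rightarrow> ennreal"
  assumes mono: "\<And>A B. A \<subseteq> B \<Longrightarrow> I A \<le> I B"
    and up: "\<And>A :: nat \<Rightarrow> 'a set. incseq A \<Longrightarrow> I (\<Union>n. A n) \<le> (SUP n. I (A n))"
    and A: "choquet_set \<K> A" and less: "\<alpha> < I A"
  obtains L :: "nat \<Rightarrow> 'a set" where "\<And>n. L n \<in> \<K>" "decseq L" "(\<Inter>n. L n) \<subseteq> A" "\<And>n. \<alpha> < I (L n)"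
proof -
  obtain a L where a0: "a [] = A"
    and a1: "\<And>s k. a (s @ [k]) \<subseteq> a (s @ [Suc k])"
    and a2: "\<And>s. a s \<subseteq> (\<Union>k. a (s @ [k]))"
    and a3: "\<And>s. s \<noteq> [] \<Longrightarrow> L s \<in> \<K> \<and> a s \<subseteq> L s"
    and a4: "\<And>s k. s \<noteq> [] \<Longrightarrow> L (s @ [k]) \<subseteq> L s"
    and a5: "\<And>m. (\<Inter>n. L (map m [0..<Suc n])) \<subseteq> A"
    using A unfolding choquet_set_def by metis
  have step: "\<exists>k. \<alpha> < I (a (s @ [k]))" if "\<alpha> < I (a s)" for s
  proof -
    have "\<alpha> < I (\<Union>k. a (s @ [k]))" using that mono[OF a2[of s]] by (rule less_le_trans)
    also have "\<dots> \<le> (SUP k. I (a (s @ [k])))"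
      using a1 by (intro up) (simp add: incseq_Suc_iff)
    finally show ?thesis by (simp add: less_SUP_iff)
  qed
  have "\<exists>S. \<forall>n. (length (S n) = n \<and> \<alpha> < I (a (S n))) \<and> (\<exists>k. S (Suc n) = S n @ [k])"
  proof (rule dependent_nat_choice)
    show "\<exists>s. length s = 0 \<and> \<alpha> < I (a s)" using a0 less by auto
    fix s n assume s: "length s = n \<and> \<alpha> < I (a s)"
    then obtain k where "\<alpha> < I (a (s @ [k]))" using step by blast
    then show "\<exists>s'. (length s' = Suc n \<and> \<alpha> < I (a s')) \<and> (\<exists>k. s' = s @ [k])"
      using s by (intro exI[of _ "s @ [k]"]) auto
  qed
  then obtain S where S: "\<And>n. length (S n) = n" "\<And>n. \<alpha> < I (a (S n))"
      "\<And>n. \<exists>k. S (Suc n) = S n @ [k]" by blast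
  define m where "m n = last (S (Suc n))" for n
  have SSuc: "S (Suc n) = S n @ [m n]" for n
    using S(3)[of n] by (auto simp: m_def)
  have Sm: "S n = map m [0..<n]" for n
  proof (induction n)
    case 0 then show ?case using S(1)[of 0] by simp
  next
    case (Suc n) then show ?case using SSuc[of n] by simp
  qed
  have ne: "S (Suc n) \<noteq> []" for n using S(1)[of "Suc n"] by auto
  show ?thesis
  proof (rule that[of "\<lambda>n. L (S (Suc n))"])
    show "L (S (Suc n)) \<in> \<K>" for n using a3[OF ne] by blast
    show "decseq (\<lambda>n. L (S (Suc n)))"
      unfolding decseq_Suc_iff using a4[OF ne] SSuc by metis
    show "(\<Inter>n. L (S (Suc n))) \<subseteq> A" using a5[of m] unfolding Sm .
    show "\<alpha> < I (L (S (Suc n)))" for n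
      using S(2)[of "Suc n"] mono a3[OF ne[of n]] less_le_trans by blast
  qed
qed

text \<open>
  Finite unions of rectangles with a compact time side. Compactness of the sections makes projection
  commute with decreasing intersections, so that outer probability of the projection is a capacity
  for this class.
\<close>

inductive_set compact_rects :: "'w measure \<Rightarrow> (real \<times> 'w) set set" for P :: "'w measure" where
  rect: "compact C \<Longrightarrow> F \<in> sets P \<Longrightarrow> C \<times> F \<in> compact_rects P"
| union: "K \<in> compact_rects P \<Longrightarrow> K' \<in> compact_rects P \<Longrightarrow> K \<union> K' \<in> compact_rects P"

lemma compact_rects_Int_rect:
  assumes "K \<in> compact_rects P" "closed D" "F \<in> sets P"
  shows "K \<inter> (D \<times> F) \<in> compact_rects P"
  using assms
proof (induction)
  case (rect C F')
  have "(C \<times> F') \<inter> (D \<times> F) = (C \<inter> D) \<times> (F' \<inter> F)" by auto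
  then show ?case using rect by (auto intro!: compact_rects.rect compact_Int_closed)
next
  case (union K K')
  then show ?case by (auto simp: Int_Un_distrib2 intro!: compact_rects.union)
qed

lemma compact_rects_Int:
  assumes "K' \<in> compact_rects P" "K \<in> compact_rects P"
  shows "K \<inter> K' \<in> compact_rects P"
  using assms
proof (induction)
  case (rect C F) then show ?case by (intro compact_rects_Int_rect compact_imp_closed)
next
  case (union K' K'') then show ?case by (auto simp: Int_Un_distrib intro!: compact_rects.union)
qed

lemma compact_rects_section:
  assumes "K \<in> compact_rects P" shows "compact {t. (t, \<omega>) \<in> K}"
  using assms
proof (induction)
  case (rect C F)
  then show ?case by (cases "\<omega> \<in> F") auto
next
  case (union K K')
  then show ?case by (auto simp: Collect_disj_eq compact_Un)
qed

lemma compact_rects_projection: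
  assumes "K \<in> compact_rects P" shows "snd ` K \<in> sets P"
  using assms
proof (induction)
  case (rect C F)
  then show ?case by (cases "C = {}") (auto simp: snd_image_times)
qed (auto simp: image_Un)

text \<open>
  The sets that qualify together with their complements form a \<open>\<sigma>\<close>-algebra, because the property
  survives countable unions and intersections; half-lines and their complements are countable
  unions of compact intervals.
\<close>

lemma choquet_set_borel_pair:
  fixes P :: "'w measure"
  assumes "A \<in> sets (borel \<Otimes>\<^sub>M P)"
  shows "choquet_set (compact_rects P) A"
proof -
  let ?G = "choquet_set (compact_rects P)"
  let ?\<Omega> = "space P"
  have Un2: "?G (B \<union> C)" if "?G B" "?G C" for B C
  proof -
    have "?G (\<Union>i::nat. if i = 0 then B else C)"
      by (rule choquet_set_Union) (use that in \<open>auto intro: compact_rects.union\<close>)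
    moreover have "(\<Union>i::nat. if i = 0 then B else C) = B \<union> C" by (auto split: if_splits)
    ultimately show ?thesis by simp
  qed
  have closed: "?G (D \<times> F)" if "closed D" "F \<in> sets P" for D :: "real set" and F
  proof -
    have "D \<times> F = (\<Union>i. (D \<inter> cball 0 (real i)) \<times> F)"
      using real_arch_simple by fastforce
    moreover have "?G ((D \<inter> cball 0 (real i)) \<times> F)" for i
      using that by (intro choquet_set_base compact_rects.rect closed_Int_compact) auto
    then have "?G (\<Union>i. (D \<inter> cball 0 (real i)) \<times> F)"
      by (rule choquet_set_Union) (rule compact_rects.union)
    ultimately show ?thesis by simp
  qed
  have opn: "?G ({x<..} \<times> F)" if "F \<in> sets P" for x :: real and F
  proof -
    have "\<exists>i. x + 1 / real (Suc i) \<le> y" if "x < y" for y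
    proof -
      obtain i where "inverse (real (Suc i)) < y - x" using reals_Archimedean[of "y - x"] \<open>x < y\<close> by auto
      then have "x + 1 / real (Suc i) \<le> y" by (simp add: inverse_eq_divide)
      then show ?thesis ..
    qed
    moreover have "x < y" if "x + 1 / real (Suc i) \<le> y" for y i
      using that by (smt (verit) divide_pos_pos of_nat_0_less_iff zero_less_Suc)
    ultimately have "{x<..} \<times> F = (\<Union>i. {x + 1 / real (Suc i)..} \<times> F)"
      by (auto simp del: of_nat_Suc)
    moreover have "?G (\<Union>i. {x + 1 / real (Suc i)..} \<times> F)"
      by (rule choquet_set_Union) (use that in \<open>auto intro: compact_rects.union closed\<close>)
    ultimately show ?thesis by simp
  qed
  have rects: "{a \<times> b | a b. a \<in> range (\<lambda>x::real. {..x}) \<and> b \<in> sets P} \<subseteq> Pow (UNIV \<times> ?\<Omega>)"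
    using sets.sets_into_space by blast
  have Iic: "sets (borel :: real measure) = sigma_sets UNIV (range (\<lambda>x::real. {..x}))"
    by (subst borel_eq_atMost) simp
  have "sets (borel \<Otimes>\<^sub>M P) = sets (sigma (UNIV \<times> ?\<Omega>) {a \<times> b | a b. a \<in> range (\<lambda>x::real. {..x}) \<and> b \<in> sets P})"
  proof -
    have "(\<Union>n. {..real n}) = UNIV" using real_arch_simple by auto
    moreover have "range (\<lambda>n. {..real n}) \<subseteq> range (\<lambda>x::real. {..x})" by auto
    ultimately show ?thesis
      using sets_pair_eq[of "range (\<lambda>x::real. {..x})" borel "range (\<lambda>n. {..real n})" "sets P" P "{?\<Omega>}"]
      by (simp add: Iic sets.space_closed sets.sigma_sets_eq)
  qed
  also have "\<dots> = sigma_sets (UNIV \<times> ?\<Omega>) {a \<times> b | a b. a \<in> range (\<lambda>x::real. {..x}) \<and> b \<in> sets P}"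
    using rects by (rule sets_measure_of)
  finally have "A \<in> sigma_sets (UNIV \<times> ?\<Omega>) {a \<times> b | a b. a \<in> range (\<lambda>x::real. {..x}) \<and> b \<in> sets P}"
    using assms by simp
  then have "?G A \<and> ?G (UNIV \<times> ?\<Omega> - A)"
  proof induction
    case (Basic a)
    then obtain x F where a: "a = {..x} \<times> F" "F \<in> sets P" by auto
    have "UNIV \<times> ?\<Omega> - a = ({x<..} \<times> ?\<Omega>) \<union> (UNIV \<times> (?\<Omega> - F))"
      using a sets.sets_into_space[of F P] by auto
    moreover have "?G (({x<..} \<times> ?\<Omega>) \<union> (UNIV \<times> (?\<Omega> - F)))"
      by (intro Un2 opn closed) (use a in auto)
    moreover have "?G a" unfolding a(1) by (rule closed) (use a in auto)
    ultimately show ?case by simp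
  next
    case Empty
    then show ?case using closed[of "{}" "{}"] closed[of UNIV ?\<Omega>] by simp
  next
    case (Compl a)
    moreover have "UNIV \<times> ?\<Omega> - (UNIV \<times> ?\<Omega> - a) = a"
      using sigma_sets_into_sp[OF rects Compl(1)] by blast
    ultimately show ?case by simp
  next
    case (Union a)
    have "UNIV \<times> ?\<Omega> - (\<Union>i. a i) = (\<Inter>i. UNIV \<times> ?\<Omega> - a i)" by auto
    moreover have "?G (\<Inter>i. UNIV \<times> ?\<Omega> - a i)"
      by (rule choquet_set_Inter) (use Union in \<open>auto intro: compact_rects_Int\<close>)
    moreover have "?G (\<Union>i. a i)"
      by (rule choquet_set_Union) (use Union in \<open>auto intro: compact_rects.union\<close>)
    ultimately show ?case by simp
  qed
  then show ?thesis ..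
qed

text \<open>
  The capacity is the outer measure of the projection. Capacitability provides a subset \<open>K\<close> of \<open>A\<close>
  that is a decreasing intersection of members of \<open>compact_rects P\<close>; its sections are compact, so the
  smallest time of each nonempty section is a measurable selection.
\<close>

theorem measurable_section:
  assumes "finite_measure P" and A: "A \<in> sets (borel \<Otimes>\<^sub>M P)"
    and less: "\<alpha> < outer_measure_of P (snd ` A)"
  obtains F R where "F \<in> sets P" "R \<in> borel_measurable P" "\<alpha> \<le> emeasure P F"
    "\<And>\<omega>. \<omega> \<in> F \<Longrightarrow> (R \<omega> :: real, \<omega>) \<in> A"
proof -
  interpret finite_measure P by fact
  define I where "I B = outer_measure_of P (snd ` B \<inter> space P)" for B :: "(real \<times> 'a) set"
  have subs: "snd ` A \<subseteq> space P" using sets.sets_into_space[OF A] by (auto simp: space_pair_measure)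
  have "\<exists>L. (\<forall>n. L n \<in> compact_rects P) \<and> decseq L \<and> (\<Inter>n. L n) \<subseteq> A \<and> (\<forall>n::nat. \<alpha> < I (L n))"
  proof (rule choquet_capacitability[of I "compact_rects P" A \<alpha>])
    show "I B \<le> I C" if "B \<subseteq> C" for B C
      unfolding I_def using that by (intro outer_measure_of_mono) auto
    show "I (\<Union>n. B n) \<le> (SUP n. I (B n))" if "incseq B" for B
    proof -
      have "I (\<Union>n. B n) = outer_measure_of P (\<Union>n. snd ` B n \<inter> space P)"
        unfolding I_def by (intro arg_cong[where f = "outer_measure_of P"]) auto
      also have "\<dots> = (SUP n. I (B n))"
        unfolding I_def using that
        by (intro SUP_outer_measure_of_incseq[symmetric]) (auto simp: incseq_def)
      finally show ?thesis by simp
    qed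
    show "choquet_set (compact_rects P) A" by (rule choquet_set_borel_pair[OF A])
    show "\<alpha> < I A" unfolding I_def using less subs by (simp add: Int_absorb2)
  qed blast
  then obtain L where L: "\<And>n. L n \<in> compact_rects P" "decseq L" "(\<Inter>n. L n) \<subseteq> A" "\<And>n. \<alpha> < I (L n)"
    by blast
  define K where "K = (\<Inter>n. L n)"
  have proj: "snd ` (K \<inter> (D \<times> space P)) \<in> sets P \<and>
      snd ` (K \<inter> (D \<times> space P)) = (\<Inter>n. snd ` (L n \<inter> (D \<times> space P)))" if "closed D" for D
  proof -
    have eq: "snd ` (K \<inter> (D \<times> space P)) = (\<Inter>n. snd ` (L n \<inter> (D \<times> space P)))"
    proof (intro equalityI subsetI)
      fix \<omega> assume \<omega>: "\<omega> \<in> (\<Inter>n. snd ` (L n \<inter> (D \<times> space P)))"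
      have "(\<Inter>n. {t. (t, \<omega>) \<in> L n \<inter> (D \<times> space P)}) \<noteq> {}"
      proof (rule compact_nest)
        show "compact {t. (t, \<omega>) \<in> L n \<inter> (D \<times> space P)}" for n
          using compact_rects_section[OF compact_rects_Int_rect[OF L(1) that]] by blast
        show "{t. (t, \<omega>) \<in> L n \<inter> (D \<times> space P)} \<noteq> {}" for n using \<omega> by fastforce
        show "{t. (t, \<omega>) \<in> L n \<inter> (D \<times> space P)} \<subseteq> {t. (t, \<omega>) \<in> L m \<inter> (D \<times> space P)}"
          if "m \<le> n" for m n using decseqD[OF L(2) that] by auto
      qed
      then show "\<omega> \<in> snd ` (K \<inter> (D \<times> space P))" by (force simp: K_def)
    qed (auto simp: K_def)
    moreover have "(\<Inter>n. snd ` (L n \<inter> (D \<times> space P))) \<in> sets P"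
      using compact_rects_projection[OF compact_rects_Int_rect[OF L(1) that]] by auto
    ultimately show ?thesis by simp
  qed
  have spL: "L n \<inter> (UNIV \<times> space P) = L n" for n
  proof -
    have "snd ` L n \<subseteq> space P" using compact_rects_projection[OF L(1)] sets.sets_into_space by blast
    then show ?thesis by auto
  qed
  then have spK: "K \<inter> (UNIV \<times> space P) = K" unfolding K_def by blast
  define F where "F = snd ` K"
  have F: "F \<in> sets P" "F = (\<Inter>n. snd ` L n)" using proj[of UNIV] by (auto simp: F_def spL spK)
  define R where "R \<omega> = (if \<omega> \<in> F then Inf {t. (t, \<omega>) \<in> K} else 0)" for \<omega>
  have cK: "compact {t. (t, \<omega>) \<in> K}" for \<omega>
  proof -
    have "{t. (t, \<omega>) \<in> K} = (\<Inter>n. {t. (t, \<omega>) \<in> L n})" by (auto simp: K_def)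
    moreover have "compact (\<Inter>n. {t. (t, \<omega>) \<in> L n})"
      by (rule compact_Inter) (use compact_rects_section[OF L(1)] in auto)
    ultimately show ?thesis by simp
  qed
  have RK: "(R \<omega>, \<omega>) \<in> K" and Rmin: "\<And>t. (t, \<omega>) \<in> K \<Longrightarrow> R \<omega> \<le> t" if "\<omega> \<in> F" for \<omega>
  proof -
    have ne: "{t. (t, \<omega>) \<in> K} \<noteq> {}" using that by (auto simp: F_def)
    obtain t where t: "(t, \<omega>) \<in> K" "\<And>s. (s, \<omega>) \<in> K \<Longrightarrow> t \<le> s"
      using compact_attains_inf[OF cK ne] by auto
    have "Inf {t. (t, \<omega>) \<in> K} = t" by (intro cInf_eq_minimum) (use t in auto)
    then show "(R \<omega>, \<omega>) \<in> K" "\<And>t. (t, \<omega>) \<in> K \<Longrightarrow> R \<omega> \<le> t" using t that by (auto simp: R_def)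
  qed
  show ?thesis
  proof (rule that[of F R])
    show "F \<in> sets P" by (rule F)
    show "R \<in> borel_measurable P"
    proof (rule borel_measurableI_le)
      fix x
      have "{\<omega> \<in> space P. R \<omega> \<le> x} = snd ` (K \<inter> ({..x} \<times> space P)) \<union> (if 0 \<le> x then space P - F else {})"
      proof -
        have "R \<omega> \<le> x \<longleftrightarrow> \<omega> \<in> snd ` (K \<inter> ({..x} \<times> space P))" if "\<omega> \<in> F" "\<omega> \<in> space P" for \<omega>
        proof
          assume "R \<omega> \<le> x"
          then have "(R \<omega>, \<omega>) \<in> K \<inter> ({..x} \<times> space P)" using RK that by auto
          then show "\<omega> \<in> snd ` (K \<inter> ({..x} \<times> space P))" by force
        next
          assume "\<omega> \<in> snd ` (K \<inter> ({..x} \<times> space P))"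
          then obtain t where "(t, \<omega>) \<in> K" "t \<le> x" by auto
          then show "R \<omega> \<le> x" using Rmin[OF that(1)] by fastforce
        qed
        note inF = this
        have notF: "\<omega> \<notin> snd ` (K \<inter> ({..x} \<times> space P))" "R \<omega> = 0" if "\<omega> \<notin> F" for \<omega>
          using that by (force simp: F_def R_def)+
        have "F \<subseteq> space P" using F(1) by (rule sets.sets_into_space)
        then have "\<omega> \<in> space P \<and> R \<omega> \<le> x \<longleftrightarrow> \<omega> \<in> snd ` (K \<inter> ({..x} \<times> space P)) \<or> 0 \<le> x \<and> \<omega> \<in> space P - F" for \<omega>
          using inF[of \<omega>] notF[of \<omega>] by (cases "\<omega> \<in> F") (simp_all add: subset_iff del: image_iff, blast)
        then have "\<omega> \<in> {\<omega> \<in> space P. R \<omega> \<le> x} \<longleftrightarrow>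
            \<omega> \<in> snd ` (K \<inter> ({..x} \<times> space P)) \<union> (if 0 \<le> x then space P - F else {})" for \<omega>
          by (simp del: image_iff)
        then show ?thesis by blast
      qed
      then show "{\<omega> \<in> space P. R \<omega> \<le> x} \<in> sets P" using proj[of "{..x}"] F by auto
    qed
    have decseq_image: "decseq (\<lambda>n. snd ` L n)" using L(2) unfolding decseq_def by blast
    have "emeasure P F = (INF n. emeasure P (snd ` L n))"
      unfolding F(2) using compact_rects_projection[OF L(1)] L(2)
      by (intro INF_emeasure_decseq[symmetric]) (auto intro!: decseq_image)
    moreover have "\<alpha> \<le> emeasure P (snd ` L n)" for n
    proof -
      have m: "snd ` L n \<in> sets P" by (rule compact_rects_projection[OF L(1)])
      then have "snd ` L n \<inter> space P = snd ` L n" using sets.sets_into_space by blast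
      then have "I (L n) = emeasure P (snd ` L n)" using m by (simp add: I_def)
      then show ?thesis using L(4)[of n] by simp
    qed
    ultimately show "\<alpha> \<le> emeasure P F" by (simp add: INF_greatest)
    show "(R \<omega>, \<omega>) \<in> A" if "\<omega> \<in> F" for \<omega> using RK[OF that] L(3) by (auto simp: K_def)
  qed
qed

text \<open>
  The projection of a measurable set need not be measurable, but sections of almost full outer
  measure fill it up from inside to the measure of a measurable hull.
\<close>

corollary projection_sandwich:
  assumes fin: "finite_measure P" and A: "A \<in> sets (borel \<Otimes>\<^sub>M P)"
  obtains F1 F2 where "F1 \<in> sets P" "F2 \<in> sets P" "F1 \<subseteq> snd ` (A :: (real \<times> 'w) set)" "snd ` A \<subseteq> F2"
    "emeasure P (F2 - F1) = 0"
proof -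
  interpret finite_measure P by fact
  have subs: "snd ` A \<subseteq> space P" using sets.sets_into_space[OF A] by (auto simp: space_pair_measure)
  obtain F2 where F2: "F2 \<in> sets P" "snd ` A \<subseteq> F2" "outer_measure_of P (snd ` A) = emeasure P F2"
    using outer_measure_of_attain[OF subs] by blast
  have ex: "\<exists>F\<in>sets P. F \<subseteq> snd ` A \<and> \<alpha> \<le> emeasure P F" if \<alpha>: "\<alpha> < emeasure P F2" for \<alpha>
  proof -
    obtain F R where "F \<in> sets P" "\<alpha> \<le> emeasure P F" "\<And>\<omega>. \<omega> \<in> F \<Longrightarrow> (R \<omega> :: real, \<omega>) \<in> A"
      using measurable_section[OF fin A] \<alpha> F2(3) by metis
    then show ?thesis by (metis imageI snd_conv subsetI)
  qed
  have "\<exists>F1\<in>sets P. F1 \<subseteq> snd ` A \<and> emeasure P F2 \<le> emeasure P F1"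
  proof (cases "emeasure P F2 = 0")
    case True then show ?thesis by (intro bexI[of _ "{}"]) auto
  next
    case False
    then obtain u :: "nat \<Rightarrow> ennreal" where u: "\<And>n. u n < emeasure P F2" "u \<longlonglongrightarrow> emeasure P F2"
      using approx_from_below_dense_linorder[of 0 "emeasure P F2"] by (auto simp: zero_less_iff_neq_zero)
    obtain f where f: "\<And>n. f n \<in> sets P" "\<And>n. f n \<subseteq> snd ` A" "\<And>n. u n \<le> emeasure P (f n)"
      using ex[OF u(1)] by metis
    have "u n \<le> emeasure P (\<Union>n. f n)" for n
      using f by (intro order_trans[OF f(3)] emeasure_mono) auto
    then have "emeasure P F2 \<le> emeasure P (\<Union>n. f n)"
      using u(2) by (intro LIMSEQ_le_const2[OF u(2)]) auto
    then show ?thesis using f by (intro bexI[of _ "\<Union>n. f n"]) auto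
  qed
  then obtain F1 where F1: "F1 \<in> sets P" "F1 \<subseteq> snd ` A" "emeasure P F2 \<le> emeasure P F1" by blast
  have "emeasure P (F2 - F1) = emeasure P F2 - emeasure P F1"
    using F1 F2 by (intro emeasure_Diff) auto
  also have "\<dots> = 0" using F1(3) by (simp add: diff_eq_0_iff_ennreal less_top[symmetric])
  finally show ?thesis using that F1 F2 by blast
qed

section \<open>Optional sets and their sections\<close>

text \<open>
  Since all measurable null sets are known at time \<open>0\<close>, processes and stopping times can be modified
  on them without losing adaptedness.
\<close>

locale usual_filtration = prob_space M for M :: "'w measure" +
  fixes G :: "real \<Rightarrow> 'w measure"
  assumes filt: "filtration_on M G"
    and right_cont: "right_continuous G"
    and null_G0: "null_sets M \<subseteq> sets (G 0)"
begin

lemma space_G: "0 \<le> t \<Longrightarrow> space (G t) = space M"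
  using filt by (auto simp: filtration_on_def subalgebra_def)

lemma subalg_G: "0 \<le> t \<Longrightarrow> subalgebra M (G t)"
  using filt by (auto simp: filtration_on_def)

lemma sets_G_M: "0 \<le> t \<Longrightarrow> A \<in> sets (G t) \<Longrightarrow> A \<in> sets M"
  using filt by (auto simp: filtration_on_def subalgebra_def)

lemma sets_G_mono: "0 \<le> s \<Longrightarrow> s \<le> t \<Longrightarrow> A \<in> sets (G s) \<Longrightarrow> A \<in> sets (G t)"
  using filt by (auto simp: filtration_on_def)

lemma space_in_G: "0 \<le> t \<Longrightarrow> space M \<in> sets (G t)"
  using space_G sets.top by metis

lemma null_G: "N \<in> null_sets M \<Longrightarrow> 0 \<le> t \<Longrightarrow> N \<in> sets (G t)"
  using null_G0 sets_G_mono[of 0 t] by auto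

lemma measurable_G_mono:
  assumes "0 \<le> s" "s \<le> t" "f \<in> measurable (G s) N"
  shows "f \<in> measurable (G t) N"
proof (rule measurable_from_subalg)
  show "subalgebra (G t) (G s)"
    using assms sets_G_mono[of s t] by (auto simp: subalgebra_def space_G)
qed fact

lemma measurable_G_M: "0 \<le> s \<Longrightarrow> f \<in> measurable (G s) N \<Longrightarrow> f \<in> measurable M N"
  using measurable_from_subalg[OF subalg_G] .

lemma in_G_rightI: "0 \<le> t \<Longrightarrow> (\<And>s. t < s \<Longrightarrow> A \<in> sets (G s)) \<Longrightarrow> A \<in> sets (G t)"
proof -
  assume "0 \<le> t" and A: "\<And>s. t < s \<Longrightarrow> A \<in> sets (G s)"
  then have eq: "sets (G t) = (\<Inter>s\<in>{t<..}. sets (G s))"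
    using right_cont unfolding right_continuous_def by blast
  show "A \<in> sets (G t)" unfolding eq using A by blast
qed

abbreviation stopping :: "('w \<Rightarrow> ennreal) \<Rightarrow> bool" where
  "stopping \<equiv> stopping_time (ext_filtration G)"

lemma stopping_iff:
  "stopping T \<longleftrightarrow> (\<forall>t\<ge>0. {\<omega> \<in> space M. T \<omega> \<le> ennreal t} \<in> sets (G t))"
proof
  assume T: "stopping T"
  show "\<forall>t\<ge>0. {\<omega> \<in> space M. T \<omega> \<le> ennreal t} \<in> sets (G t)"
  proof (intro allI impI)
    fix t :: real assume t: "0 \<le> t"
    have "Measurable.pred (ext_filtration G (ennreal t)) (\<lambda>x. T x \<le> ennreal t)"
      using T by (rule stopping_timeD)
    then show "{\<omega> \<in> space M. T \<omega> \<le> ennreal t} \<in> sets (G t)"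
      using t by (simp add: ext_filtration_def pred_def space_G)
  qed
next
  assume *: "\<forall>t\<ge>0. {\<omega> \<in> space M. T \<omega> \<le> ennreal t} \<in> sets (G t)"
  show "stopping T"
  proof
    fix u
    show "Measurable.pred (ext_filtration G u) (\<lambda>x. T x \<le> u)"
    proof (cases "u = \<infinity>")
      case False
      then have "u = ennreal (enn2real u)" by (simp add: less_top)
      moreover have "{\<omega> \<in> space M. T \<omega> \<le> ennreal (enn2real u)} \<in> sets (G (enn2real u))"
        by (rule *[rule_format]) auto
      ultimately have "{\<omega> \<in> space M. T \<omega> \<le> u} \<in> sets (G (enn2real u))" by metis
      then show ?thesis using False by (simp add: ext_filtration_def pred_def space_G)
    qed simp
  qed
qed

lemma stoppingD: "stopping T \<Longrightarrow> 0 \<le> t \<Longrightarrow> {\<omega> \<in> space M. T \<omega> \<le> ennreal t} \<in> sets (G t)"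
  by (simp add: stopping_iff)

text \<open>
  Right continuity turns the open condition \<open>T < t\<close> into the closed one.
\<close>

lemma stopping_lessI:
  assumes *: "\<And>t. 0 < t \<Longrightarrow> {\<omega> \<in> space M. T \<omega> < ennreal t} \<in> sets (G t)"
  shows "stopping T"
  unfolding stopping_iff
proof (intro allI impI, rule in_G_rightI)
  fix t s :: real assume t: "0 \<le> t" and s: "t < s"
  define u where "u n = t + (s - t) / real (Suc n)" for n
  have u: "t < u n" "u n \<le> s" for n
  proof -
    have "0 < (s - t) / real (Suc n)" using s by (intro divide_pos_pos) auto
    then show "t < u n" unfolding u_def by linarith
    have "(s - t) * (1 / real (Suc n)) \<le> (s - t) * 1"
      using s by (intro mult_left_mono) auto
    then show "u n \<le> s" unfolding u_def times_divide_eq_right mult_1_right by linarith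
  qed
  have lim: "u \<longlonglongrightarrow> t"
  proof -
    have "(\<lambda>n. t + (s - t) * inverse (real (Suc n))) \<longlonglongrightarrow> t + (s - t) * 0"
      by (intro tendsto_intros LIMSEQ_inverse_real_of_nat)
    then show ?thesis by (simp add: u_def[abs_def] divide_inverse)
  qed
  have "{\<omega> \<in> space M. T \<omega> \<le> ennreal t} = (\<Inter>n. {\<omega> \<in> space M. T \<omega> < ennreal (u n)})"
  proof (intro equalityI subsetI)
    fix \<omega> assume "\<omega> \<in> {\<omega> \<in> space M. T \<omega> \<le> ennreal t}"
    moreover have "ennreal t < ennreal (u n)" for n
      using u(1)[of n] t by (intro ennreal_lessI) auto
    ultimately show "\<omega> \<in> (\<Inter>n. {\<omega> \<in> space M. T \<omega> < ennreal (u n)})"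
      by (auto intro: le_less_trans)
  next
    fix \<omega> assume \<omega>: "\<omega> \<in> (\<Inter>n. {\<omega> \<in> space M. T \<omega> < ennreal (u n)})"
    have "T \<omega> \<le> ennreal t"
      using \<omega> by (intro LIMSEQ_le_const[OF tendsto_ennrealI[OF lim]]) (auto intro!: exI[of _ 0] less_imp_le)
    then show "\<omega> \<in> {\<omega> \<in> space M. T \<omega> \<le> ennreal t}" using \<omega> by auto
  qed
  moreover have "{\<omega> \<in> space M. T \<omega> < ennreal (u n)} \<in> sets (G s)" for n
    by (rule sets_G_mono[OF _ u(2) *]) (use u(1)[of n] t in linarith)+
  ultimately show "{\<omega> \<in> space M. T \<omega> \<le> ennreal t} \<in> sets (G s)" by auto
qed

text \<open>
  Postponing \<open>T\<close> to \<open>\<infinity>\<close> off an event known at \<open>T\<close> gives a stopping time again. By this device an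
  identity of expectations at all stopping times contains the conditional identity on each event of
  the \<open>\<sigma>\<close>-algebra at \<open>T\<close>.
\<close>

lemma stopping_restrict:
  assumes T: "stopping T" and A: "\<And>t. 0 \<le> t \<Longrightarrow> {\<omega> \<in> space M. \<omega> \<in> A \<and> T \<omega> \<le> ennreal t} \<in> sets (G t)"
  shows "stopping (\<lambda>\<omega>. if \<omega> \<in> A then T \<omega> else \<infinity>)"
  unfolding stopping_iff
proof (intro allI impI)
  fix t :: real assume t: "0 \<le> t"
  have "{\<omega> \<in> space M. (if \<omega> \<in> A then T \<omega> else \<infinity>) \<le> ennreal t} = {\<omega> \<in> space M. \<omega> \<in> A \<and> T \<omega> \<le> ennreal t}"
    by (auto split: if_splits simp: top_unique)
  then show "{\<omega> \<in> space M. (if \<omega> \<in> A then T \<omega> else \<infinity>) \<le> ennreal t} \<in> sets (G t)" using A[OF t] by simp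
qed

lemma stopping_measurable: "stopping T \<Longrightarrow> T \<in> borel_measurable M"
proof (rule borel_measurableI_le)
  fix u assume T: "stopping T"
  show "{\<omega> \<in> space M. T \<omega> \<le> u} \<in> sets M"
  proof (cases "u = \<infinity>")
    case False
    then have "u = ennreal (enn2real u)" by (simp add: less_top)
    moreover have "{\<omega> \<in> space M. T \<omega> \<le> ennreal (enn2real u)} \<in> sets M"
      by (rule sets_G_M[OF _ stoppingD[OF T]]) auto
    ultimately show ?thesis by metis
  qed simp
qed

lemma stopping_min_measurable:
  assumes T: "stopping T" and t: "0 \<le> t"
  shows "(\<lambda>\<omega>. enn2real (min (T \<omega>) (ennreal t))) \<in> borel_measurable (G t)"
proof (rule borel_measurableI_le)
  fix s
  have fin: "min (T \<omega>) (ennreal t) < top" for \<omega> by (simp add: min_less_iff_disj)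
  have eq: "enn2real (min (T \<omega>) (ennreal t)) \<le> s \<longleftrightarrow> t \<le> s \<or> T \<omega> \<le> ennreal s" if "0 \<le> s" for \<omega>
  proof -
    have "enn2real (min (T \<omega>) (ennreal t)) \<le> s \<longleftrightarrow> ennreal (enn2real (min (T \<omega>) (ennreal t))) \<le> ennreal s"
      using that by (subst ennreal_le_iff) auto
    also have "\<dots> \<longleftrightarrow> min (T \<omega>) (ennreal t) \<le> ennreal s" using fin[of \<omega>] by (subst ennreal_enn2real) auto
    also have "\<dots> \<longleftrightarrow> t \<le> s \<or> T \<omega> \<le> ennreal s" using that t by (auto simp: min_le_iff_disj ennreal_le_iff)
    finally show ?thesis .
  qed
  consider "s < 0" | "t \<le> s" | "0 \<le> s" "s < t" by linarith
  then show "{\<omega> \<in> space (G t). enn2real (min (T \<omega>) (ennreal t)) \<le> s} \<in> sets (G t)"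
  proof cases
    case 1
    then have "\<not> enn2real (min (T \<omega>) (ennreal t)) \<le> s" for \<omega>
      using enn2real_nonneg[of "min (T \<omega>) (ennreal t)"] by linarith
    then show ?thesis by simp
  next
    case 2
    then show ?thesis using eq[of ] t by auto
  next
    case 3
    then have "{\<omega> \<in> space (G t). enn2real (min (T \<omega>) (ennreal t)) \<le> s} = {\<omega> \<in> space M. T \<omega> \<le> ennreal s}"
      using eq t by (simp add: space_G)
    moreover have "{\<omega> \<in> space M. T \<omega> \<le> ennreal s} \<in> sets (G t)"
      using 3 by (intro sets_G_mono[OF _ _ stoppingD[OF T]]) auto
    ultimately show ?thesis by simp
  qed
qed

lemma space_optional: "space (optional_algebra G) = {0..} \<times> space M"
  unfolding optional_algebra_def by (subst space_measure_of) (auto simp: space_G)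

lemma cadlag_optional:
  assumes "cadlag_adapted G Z" shows "case_prod Z \<in> borel_measurable (optional_algebra G)"
proof (rule measurableI)
  fix B :: "real set" assume "B \<in> sets borel"
  then show "case_prod Z -` B \<inter> space (optional_algebra G) \<in> sets (optional_algebra G)"
    using assms unfolding space_optional unfolding optional_algebra_def
    by (subst sets_measure_of) (auto intro!: sigma_sets.Basic exI[of _ Z] exI[of _ B] simp: space_G)
qed simp

text \<open>
  The universal property of the optional \<open>\<sigma>\<close>-algebra, through which everything below is reduced to
  cadlag adapted processes.
\<close>

lemma measurable_optionalI:
  assumes sp: "f \<in> space N \<rightarrow> {0..} \<times> space M"
    and m: "\<And>Z. cadlag_adapted G Z \<Longrightarrow> (\<lambda>x. case_prod Z (f x)) \<in> borel_measurable N"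
  shows "f \<in> N \<rightarrow>\<^sub>M optional_algebra G"
  unfolding optional_algebra_def
proof (rule measurable_measure_of)
  show "f \<in> space N \<rightarrow> {0..} \<times> space (G 0)" using sp by (simp add: space_G)
  fix A assume "A \<in> {case_prod Z -` B \<inter> ({0..} \<times> space (G 0)) | Z B. cadlag_adapted G Z \<and> B \<in> sets borel}"
  then obtain Z B where Z: "cadlag_adapted G Z" "B \<in> sets borel"
    and A: "A = case_prod Z -` B \<inter> ({0..} \<times> space (G 0))" by blast
  have "f -` A \<inter> space N = (\<lambda>x. case_prod Z (f x)) -` B \<inter> space N"
    using sp by (auto simp: A space_G)
  then show "f -` A \<inter> space N \<in> sets N" using measurable_sets[OF m[OF Z(1)] Z(2)] by simp
qed auto

lemma cadlag_right_limit:
  assumes "cadlag_adapted G Z" "0 \<le> t" "\<omega> \<in> space M"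
  shows "((\<lambda>s. Z s \<omega>) \<longlongrightarrow> Z t \<omega>) (at_right t)"
  using assms by (auto simp: cadlag_adapted_def space_G)

lemma cadlag_measurable: "cadlag_adapted G Z \<Longrightarrow> 0 \<le> t \<Longrightarrow> Z t \<in> borel_measurable (G t)"
  by (auto simp: cadlag_adapted_def)

text \<open>
  The next grid point strictly to the right of \<open>s\<close>. Strictness matters: the limits along these points
  are right limits, at \<open>s\<close> itself and not only nearby.
\<close>

lemma (in -) floor_approx_right:
  fixes s :: real and d :: "nat \<Rightarrow> real"
  assumes s: "0 \<le> s" and d: "\<And>n. 0 < d n" "filterlim d at_top sequentially"
  shows "s < (real (nat \<lfloor>d n * s\<rfloor>) + 1) / d n"
    and "filterlim (\<lambda>n. (real (nat \<lfloor>d n * s\<rfloor>) + 1) / d n) (at_right s) sequentially"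
proof -
  let ?u = "\<lambda>n. (real (nat \<lfloor>d n * s\<rfloor>) + 1) / d n"
  have b: "s < ?u n \<and> ?u n \<le> s + inverse (d n)" for n
  proof -
    have p: "0 \<le> d n * s" using s d(1)[of n] by simp
    then have "real (nat \<lfloor>d n * s\<rfloor>) = of_int \<lfloor>d n * s\<rfloor>" by (simp add: of_nat_nat)
    then have "d n * s < real (nat \<lfloor>d n * s\<rfloor>) + 1"
      "real (nat \<lfloor>d n * s\<rfloor>) + 1 \<le> d n * s + 1" by linarith+
    moreover have "(s + inverse (d n)) * d n = d n * s + 1" using d(1)[of n] by (simp add: field_simps)
    ultimately show ?thesis using d(1)[of n]
      by (simp only: pos_less_divide_eq pos_divide_le_eq mult.commute[of s])
  qed
  then show "s < ?u n" by blast
  have "?u \<longlonglongrightarrow> s"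
  proof (rule tendsto_sandwich)
    show "(\<lambda>n. s) \<longlonglongrightarrow> s" by simp
    have "(\<lambda>n. s + inverse (d n)) \<longlonglongrightarrow> s + 0"
      by (intro tendsto_intros tendsto_inverse_0_at_top d(2))
    then show "(\<lambda>n. s + inverse (d n)) \<longlonglongrightarrow> s" by simp
  qed (use b less_imp_le in \<open>blast intro: always_eventually\<close>)+
  moreover have "\<forall>n. ?u n \<in> {s<..} \<and> ?u n \<noteq> s" using b by (metis greaterThan_iff less_irrefl)
  ultimately show "filterlim ?u (at_right s) sequentially"
    unfolding filterlim_at by (auto intro!: always_eventually)
qed

text \<open>
  Optional sets are progressive: a right-continuous path is the limit of its values at the next grid
  points, cut off at \<open>t\<close> so that nothing later than \<open>t\<close> is used. Clamping the time keeps all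
  \<open>\<sigma>\<close>-algebras on the whole line.
\<close>

lemma progressive:
  assumes t: "0 \<le> t"
  shows "(\<lambda>(s, \<omega>). (max 0 (min t s), \<omega>)) \<in> (borel \<Otimes>\<^sub>M G t) \<rightarrow>\<^sub>M optional_algebra G"
proof (rule measurable_optionalI)
  show "(\<lambda>(s, \<omega>). (max 0 (min t s), \<omega>)) \<in> space (borel \<Otimes>\<^sub>M G t) \<rightarrow> {0..} \<times> space M"
    using t by (auto simp: space_pair_measure space_G)
  fix Z assume Z: "cadlag_adapted G Z"
  define c where "c s = max 0 (min t s)" for s
  have d_top: "filterlim (\<lambda>n. real (Suc n)) at_top sequentially"
    by (rule filterlim_compose[OF filterlim_real_sequentially filterlim_Suc])
  have c: "0 \<le> c s" "c s \<le> t" for s using t by (auto simp: c_def)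
  have c_meas[measurable]: "c \<in> borel_measurable borel" by (simp add: c_def[abs_def])
  define u where "u n s = (real (nat \<lfloor>real (Suc n) * s\<rfloor>) + 1) / real (Suc n)" for n and s :: real
  define Zn where "Zn n = (\<lambda>(s, \<omega>). Z (min t (u n (c s))) \<omega>)" for n
  have m: "Zn n \<in> borel_measurable (borel \<Otimes>\<^sub>M G t)" for n
  proof -
    have "(\<lambda>x. (\<lambda>k x. Z (min t ((real k + 1) / real (Suc n))) (snd x)) (nat \<lfloor>real (Suc n) * c (fst x)\<rfloor>) x)
        \<in> borel_measurable (borel \<Otimes>\<^sub>M G t)"
    proof (rule measurable_compose_countable[where f = "\<lambda>k x. Z (min t ((real k + 1) / real (Suc n))) (snd x)"
          and g = "\<lambda>x. nat \<lfloor>real (Suc n) * c (fst x)\<rfloor>"])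
      fix k :: nat
      have "Z (min t ((real k + 1) / real (Suc n))) \<in> borel_measurable (G t)"
        using t by (intro measurable_G_mono[OF _ _ cadlag_measurable[OF Z]]) auto
      then show "(\<lambda>x. Z (min t ((real k + 1) / real (Suc n))) (snd x)) \<in> borel_measurable (borel \<Otimes>\<^sub>M G t)"
        by measurable
    qed measurable
    then show ?thesis by (simp add: Zn_def u_def split_beta')
  qed
  have lim: "(\<lambda>n. Zn n x) \<longlonglongrightarrow> case_prod Z (case x of (s, \<omega>) \<Rightarrow> (c s, \<omega>))"
    if "x \<in> space (borel \<Otimes>\<^sub>M G t)" for x
  proof -
    obtain s \<omega> where "x = (s, \<omega>)" by fastforce
    then have x: "x = (s, \<omega>)" "\<omega> \<in> space M" using that t by (auto simp: space_pair_measure space_G)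
    have u: "filterlim (\<lambda>n. u n (c s)) (at_right (c s)) sequentially"
      unfolding u_def by (rule floor_approx_right(2)[OF c(1) _ d_top]) simp
    show ?thesis
    proof (cases "c s < t")
      case True
      have "eventually (\<lambda>n. u n (c s) < t) sequentially"
      proof (rule eventually_compose_filterlim[OF _ u])
        show "\<forall>\<^sub>F x in at_right (c s). x < t" using True by (auto simp: eventually_at_right[OF True])
      qed
      then have "eventually (\<lambda>n. Z (u n (c s)) \<omega> = Zn n x) sequentially"
        by eventually_elim (simp add: Zn_def x min_def)
      moreover have "(\<lambda>n. Z (u n (c s)) \<omega>) \<longlonglongrightarrow> Z (c s) \<omega>"
        using filterlim_compose[OF cadlag_right_limit[OF Z c(1) x(2)] u] .
      ultimately show ?thesis using x by (auto intro: Lim_transform_eventually)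
    next
      case False
      then have cs: "c s = t" using c(2)[of s] by simp
      have "t < u n t" for n
        unfolding u_def by (rule floor_approx_right(1)[OF t _ d_top]) simp
      then have "Zn n x = Z t \<omega>" for n
        unfolding Zn_def x split cs using min.absorb1[OF less_imp_le] by metis
      then show ?thesis by (simp add: x cs)
    qed
  qed
  show "(\<lambda>x. case_prod Z (case x of (s, \<omega>) \<Rightarrow> (max 0 (min t s), \<omega>))) \<in> borel_measurable (borel \<Otimes>\<^sub>M G t)"
    using borel_measurable_LIMSEQ_real[OF lim m] by (simp add: c_def)
qed

lemma optional_slice:
  assumes A: "A \<in> sets (optional_algebra G)" and t: "0 \<le> t" and D: "D \<in> sets borel" "D \<subseteq> {0..t}"
  shows "A \<inter> (D \<times> space M) \<in> sets (borel \<Otimes>\<^sub>M G t)"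
proof -
  have "(\<lambda>(s, \<omega>). (max 0 (min t s), \<omega>)) -` A \<inter> space (borel \<Otimes>\<^sub>M G t) \<in> sets (borel \<Otimes>\<^sub>M G t)"
    using progressive[OF t] A by (rule measurable_sets)
  moreover have "D \<times> space M \<in> sets (borel \<Otimes>\<^sub>M G t)"
    using D space_in_G[OF t] by auto
  moreover have "A \<inter> (D \<times> space M) = ((\<lambda>(s, \<omega>). (max 0 (min t s), \<omega>)) -` A \<inter> space (borel \<Otimes>\<^sub>M G t)) \<inter> (D \<times> space M)"
  proof -
    have "max 0 (min t s) = s" if "s \<in> D" for s using that D by (auto simp: min_def)
    then show ?thesis using t by (auto simp: space_pair_measure space_G)
  qed
  ultimately show ?thesis by auto
qed

lemma pair_G_M: "0 \<le> t \<Longrightarrow> sets (borel \<Otimes>\<^sub>M G t) \<subseteq> sets ((borel :: real measure) \<Otimes>\<^sub>M M)"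
  unfolding sets_pair_measure space_G
  by (rule sigma_sets_subseteq) (use sets_G_M in blast)

lemma optional_joint:
  "(\<lambda>(s, \<omega>). (max 0 s, \<omega>)) \<in> (borel \<Otimes>\<^sub>M M) \<rightarrow>\<^sub>M optional_algebra G"
proof (rule measurableI)
  fix A assume A: "A \<in> sets (optional_algebra G)"
  let ?f = "\<lambda>(s, \<omega>). (max 0 s :: real, \<omega> :: 'w)"
  let ?h = "\<lambda>n (s, \<omega>). (max 0 (min (real n) s), \<omega> :: 'w)"
  have "?f -` A \<inter> space (borel \<Otimes>\<^sub>M M) = (\<Union>n. (?h n -` A \<inter> space (borel \<Otimes>\<^sub>M G (real n))) \<inter> ({..real n} \<times> space M))"
  proof -
    have "x \<in> ?f -` A \<inter> space (borel \<Otimes>\<^sub>M M) \<longleftrightarrow>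
        (\<exists>n. x \<in> (?h n -` A \<inter> space (borel \<Otimes>\<^sub>M G (real n))) \<inter> ({..real n} \<times> space M))" for x
    proof -
      obtain s \<omega> where x: "x = (s, \<omega>)" by fastforce
      have l: "x \<in> ?f -` A \<inter> space (borel \<Otimes>\<^sub>M M) \<longleftrightarrow> (max 0 s, \<omega>) \<in> A \<and> \<omega> \<in> space M"
        by (simp add: x space_pair_measure)
      have r: "x \<in> (?h n -` A \<inter> space (borel \<Otimes>\<^sub>M G (real n))) \<inter> ({..real n} \<times> space M) \<longleftrightarrow>
          (max 0 s, \<omega>) \<in> A \<and> \<omega> \<in> space M \<and> s \<le> real n" for n
        by (cases "s \<le> real n") (simp_all add: x space_pair_measure space_G min_absorb2)
      show ?thesis unfolding l r using real_arch_simple[of s] by blast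
    qed
    then show ?thesis by (intro set_eqI) (simp only: UN_iff bex_UNIV)
  qed
  moreover have "?h n -` A \<inter> space (borel \<Otimes>\<^sub>M G (real n)) \<in> sets (borel \<Otimes>\<^sub>M M)" for n
    using measurable_sets[OF progressive A, of "real n"] pair_G_M[of "real n"] by auto
  ultimately show "?f -` A \<inter> space (borel \<Otimes>\<^sub>M M) \<in> sets (borel \<Otimes>\<^sub>M M)" by auto
qed (auto simp: space_pair_measure space_optional)

lemma optional_section:
  assumes t: "0 \<le> t"
  shows "(\<lambda>\<omega>. (t, \<omega>)) \<in> G t \<rightarrow>\<^sub>M optional_algebra G"
  by (rule measurable_optionalI) (use t in \<open>auto simp: space_G cadlag_measurable\<close>)

lemma optional_at_stopping:
  assumes T: "stopping T"
  shows "(\<lambda>\<omega>. (enn2real (T \<omega>), \<omega>)) \<in> M \<rightarrow>\<^sub>M optional_algebra G"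
proof -
  note stopping_measurable[OF T, measurable]
  have "(\<lambda>\<omega>. (enn2real (T \<omega>), \<omega>)) \<in> M \<rightarrow>\<^sub>M borel \<Otimes>\<^sub>M M" by measurable
  from measurable_compose[OF this optional_joint] show ?thesis by (simp add: max_def)
qed

text \<open>
  On \<open>{T \<le> t}\<close> the stopped position only depends on \<open>T\<close> cut off at \<open>t\<close>, to which progressive
  measurability applies.
\<close>

lemma optional_at_stopping_adapted:
  assumes T: "stopping T" and A: "A \<in> sets (optional_algebra G)" and t: "0 \<le> t"
  shows "{\<omega> \<in> space M. (enn2real (T \<omega>), \<omega>) \<in> A \<and> T \<omega> \<le> ennreal t} \<in> sets (G t)"
proof -
  let ?c = "\<lambda>\<omega>. enn2real (min (T \<omega>) (ennreal t))"
  have "(\<lambda>\<omega>. (?c \<omega>, \<omega>)) \<in> G t \<rightarrow>\<^sub>M borel \<Otimes>\<^sub>M G t"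
    using stopping_min_measurable[OF T t] by measurable
  from measurable_compose[OF this progressive[OF t]]
  have m: "(\<lambda>\<omega>. (max 0 (min t (?c \<omega>)), \<omega>)) \<in> G t \<rightarrow>\<^sub>M optional_algebra G" by simp
  have "{\<omega> \<in> space M. (enn2real (T \<omega>), \<omega>) \<in> A \<and> T \<omega> \<le> ennreal t} =
    ((\<lambda>\<omega>. (max 0 (min t (?c \<omega>)), \<omega>)) -` A \<inter> space (G t)) \<inter> {\<omega> \<in> space M. T \<omega> \<le> ennreal t}"
  proof -
    have "max 0 (min t (?c \<omega>)) = enn2real (T \<omega>)" if "T \<omega> \<le> ennreal t" for \<omega>
    proof -
      have "enn2real (T \<omega>) \<le> t" using enn2real_mono[OF that] t by simp
      then show ?thesis using that by (simp add: min_absorb1 max_def min_def)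
    qed
    then show ?thesis using t by (auto simp: space_G)
  qed
  then show ?thesis using measurable_sets[OF m A] stoppingD[OF T t] by auto
qed

text \<open>
  Closedness of all sections for the topology of limits from the right. It is weak enough to hold
  for \<open>{Z \<in> c}\<close> with \<open>Z\<close> cadlag and \<open>c\<close> closed, and strong enough to contain the debut of the set.
\<close>

definition right_closed :: "(real \<times> 'w) set \<Rightarrow> bool" where
  "right_closed C \<longleftrightarrow> (\<forall>t\<ge>0. \<forall>\<omega>\<in>space M. frequently (\<lambda>s. (s, \<omega>) \<in> C) (at_right t) \<longrightarrow> (t, \<omega>) \<in> C)"

lemma right_closed_Un: "right_closed C \<Longrightarrow> right_closed D \<Longrightarrow> right_closed (C \<union> D)"
  by (auto simp: right_closed_def frequently_disj_iff)

lemma right_closed_UN: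
  "(\<And>i. i < n \<Longrightarrow> right_closed (C i)) \<Longrightarrow> right_closed (\<Union>i<n. C i)" for n :: nat
  by (induction n) (auto simp: lessThan_Suc intro!: right_closed_Un, simp add: right_closed_def)

lemma right_closed_INT: "(\<And>i. right_closed (C i)) \<Longrightarrow> right_closed (\<Inter>i. C i)"
  unfolding right_closed_def
proof (intro allI ballI impI)
  fix t \<omega> assume *: "\<And>i. \<forall>t\<ge>0. \<forall>\<omega>\<in>space M. (\<exists>\<^sub>F s in at_right t. (s, \<omega>) \<in> C i) \<longrightarrow> (t, \<omega>) \<in> C i"
    and "0 \<le> t" "\<omega> \<in> space M" and f: "\<exists>\<^sub>F s in at_right t. (s, \<omega>) \<in> (\<Inter>i. C i)"
  moreover have "\<exists>\<^sub>F s in at_right t. (s, \<omega>) \<in> C i" for i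
    using f by (rule frequently_elim1) blast
  ultimately show "(t, \<omega>) \<in> (\<Inter>i. C i)" by blast
qed

lemma right_closed_cadlag:
  assumes Z: "cadlag_adapted G Z" and c: "closed c"
  shows "right_closed ({0..} \<times> space M \<inter> case_prod Z -` c)"
  unfolding right_closed_def
proof (intro allI ballI impI)
  fix t \<omega> assume t: "0 \<le> t" "\<omega> \<in> space M"
    and f: "\<exists>\<^sub>F s in at_right t. (s, \<omega>) \<in> {0..} \<times> space M \<inter> case_prod Z -` c"
  have "Z t \<omega> \<in> c"
  proof (rule ccontr)
    assume "Z t \<omega> \<notin> c"
    then have "eventually (\<lambda>s. Z s \<omega> \<in> - c) (at_right t)"
      using c by (intro topological_tendstoD[OF cadlag_right_limit[OF Z t]]) auto
    then have "eventually (\<lambda>s. \<not> ((s, \<omega>) \<in> {0..} \<times> space M \<inter> case_prod Z -` c)) (at_right t)"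
      by eventually_elim auto
    then show False using f by (simp add: frequently_def)
  qed
  then show "(t, \<omega>) \<in> {0..} \<times> space M \<inter> case_prod Z -` c" using t by auto
qed

definition inner_regular :: "(real \<times> 'w) measure \<Rightarrow> (real \<times> 'w) set \<Rightarrow> bool" where
  "inner_regular \<mu> A \<longleftrightarrow> A \<in> sets \<mu> \<and>
     (\<forall>e>0. \<exists>C\<in>sets \<mu>. right_closed C \<and> C \<subseteq> A \<and> measure \<mu> (A - C) < e)"

lemma inner_regular_self: "A \<in> sets \<mu> \<Longrightarrow> right_closed A \<Longrightarrow> inner_regular \<mu> A"
  unfolding inner_regular_def by (auto intro!: bexI[of _ A])

text \<open>
  One common error budget \<open>e\<close> for countably many sets; both countable intersections and countable
  unions are approximated from these \<open>C i\<close>.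
\<close>

lemma inner_regular_approx:
  fixes A :: "nat \<Rightarrow> _"
  assumes "\<And>i. inner_regular \<mu> (A i)" "0 < e" "finite_measure \<mu>"
  shows "\<exists>C. (\<forall>i. C i \<in> sets \<mu> \<and> right_closed (C i) \<and> C i \<subseteq> A i) \<and>
    (\<Union>i. A i - C i) \<in> sets \<mu> \<and> measure \<mu> (\<Union>i. A i - C i) < e"
proof -
  interpret finite_measure \<mu> by fact
  have "\<forall>i. \<exists>C\<in>sets \<mu>. right_closed C \<and> C \<subseteq> A i \<and> measure \<mu> (A i - C) < e / 2 * (1/2) ^ Suc i"
  proof
    fix i
    have "0 < e / 2 * (1/2) ^ Suc i" using assms(2) by simp
    then show "\<exists>C\<in>sets \<mu>. right_closed C \<and> C \<subseteq> A i \<and> measure \<mu> (A i - C) < e / 2 * (1/2) ^ Suc i"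
      using assms(1)[of i] unfolding inner_regular_def by blast
  qed
  then obtain C where C: "\<And>i. C i \<in> sets \<mu>" "\<And>i. right_closed (C i)" "\<And>i. C i \<subseteq> A i"
    "\<And>i. measure \<mu> (A i - C i) < e / 2 * (1/2) ^ Suc i" by metis
  have AC: "A i - C i \<in> sets \<mu>" for i using assms(1)[of i] C(1)[of i] by (auto simp: inner_regular_def)
  have sums: "(\<lambda>i. e / 2 * (1/2) ^ Suc i) sums (e / 2 * 1)"
    by (intro sums_mult power_half_series)
  have summ: "summable (\<lambda>i. measure \<mu> (A i - C i))"
    by (rule summable_comparison_test'[OF sums_summable[OF sums]]) (use C(4) in \<open>auto intro: less_imp_le\<close>)
  have "measure \<mu> (\<Union>i. A i - C i) \<le> (\<Sum>i. measure \<mu> (A i - C i))"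
    using AC summ by (intro finite_measure_subadditive_countably) auto
  also have "\<dots> \<le> (\<Sum>i. e / 2 * (1/2) ^ Suc i)"
    using C(4) by (intro suminf_le summ sums_summable[OF sums]) (auto intro: less_imp_le)
  also have "\<dots> < e" using sums_unique[OF sums] \<open>0 < e\<close> by simp
  finally show ?thesis using C AC by (intro exI[of _ C]) blast
qed

lemma inner_regular_INT:
  fixes A :: "nat \<Rightarrow> _"
  assumes A: "\<And>i. inner_regular \<mu> (A i)" and fin: "finite_measure \<mu>"
  shows "inner_regular \<mu> (\<Inter>i. A i)"
  unfolding inner_regular_def
proof (intro conjI allI impI)
  interpret finite_measure \<mu> by fact
  show m: "(\<Inter>i. A i) \<in> sets \<mu>" using A by (auto simp: inner_regular_def)
  fix e :: real assume "0 < e"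
  obtain C where C: "\<And>i. C i \<in> sets \<mu>" "\<And>i. right_closed (C i)"
    "\<And>i. C i \<subseteq> A i" "(\<Union>i. A i - C i) \<in> sets \<mu>" "measure \<mu> (\<Union>i. A i - C i) < e"
    using inner_regular_approx[of \<mu> A e, OF A \<open>0 < e\<close> fin] by blast
  have "measure \<mu> ((\<Inter>i. A i) - (\<Inter>i. C i)) \<le> measure \<mu> (\<Union>i. A i - C i)"
    by (intro finite_measure_mono C(4)) blast
  then show "\<exists>C\<in>sets \<mu>. right_closed C \<and> C \<subseteq> (\<Inter>i. A i) \<and> measure \<mu> ((\<Inter>i. A i) - C) < e"
    using C(1,5) right_closed_INT[of C, OF C(2)] INF_mono'[of C A, OF C(3)]
    by (intro bexI[of _ "\<Inter>i. C i"] conjI) simp_all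
qed

lemma inner_regular_UN:
  fixes A :: "nat \<Rightarrow> _"
  assumes A: "\<And>i. inner_regular \<mu> (A i)" and fin: "finite_measure \<mu>"
  shows "inner_regular \<mu> (\<Union>i. A i)"
  unfolding inner_regular_def
proof (intro conjI allI impI)
  interpret finite_measure \<mu> by fact
  show m: "(\<Union>i. A i) \<in> sets \<mu>" using A by (auto simp: inner_regular_def)
  fix e :: real assume "0 < e"
  obtain C where C: "\<And>i. C i \<in> sets \<mu>" "\<And>i. right_closed (C i)"
    "\<And>i. C i \<subseteq> A i" "(\<Union>i. A i - C i) \<in> sets \<mu>" "measure \<mu> (\<Union>i. A i - C i) < e"
    using inner_regular_approx[of \<mu> A e, OF A \<open>0 < e\<close> fin] by blast
  let ?D = "\<lambda>n. (\<Union>i. A i) - (\<Union>i<n. C i)"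
  have "(\<lambda>n. measure \<mu> (?D n)) \<longlonglongrightarrow> measure \<mu> (\<Inter>n. ?D n)"
    using m C by (intro finite_Lim_measure_decseq) (auto simp: decseq_def)
  moreover have "measure \<mu> (\<Inter>n. ?D n) \<le> measure \<mu> (\<Union>i. A i - C i)"
    by (intro finite_measure_mono C(4)) blast
  ultimately have "eventually (\<lambda>n. measure \<mu> (?D n) < e) sequentially"
    by (rule order_tendstoD(2)[OF _ le_less_trans[OF _ C(5)]])
  then obtain n where "measure \<mu> (?D n) < e" by (auto simp: eventually_sequentially)
  then show "\<exists>C\<in>sets \<mu>. right_closed C \<and> C \<subseteq> (\<Union>i. A i) \<and> measure \<mu> ((\<Union>i. A i) - C) < e"
    using C(1,3) right_closed_UN[OF C(2)] by (intro bexI[of _ "\<Union>i<n. C i"] conjI) auto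
qed

text \<open>
  The sets that are inner regular together with their complements form a \<open>\<sigma>\<close>-algebra. It contains
  \<open>{Z \<ge> y}\<close> for cadlag \<open>Z\<close>, since this set is right closed and its complement is the union of the
  right-closed sets \<open>{Z \<le> y - 1/n}\<close>.
\<close>

lemma optional_inner_regular:
  assumes fin: "finite_measure \<mu>" and sets: "sets \<mu> = sets (optional_algebra G)"
    and A: "A \<in> sets (optional_algebra G)"
  shows "inner_regular \<mu> A"
proof -
  let ?O = "{0..} \<times> space M"
  have sp: "space \<mu> = ?O" using sets_eq_imp_space_eq[OF sets] by (simp add: space_optional)
  define \<S> where "\<S> = {A. A \<subseteq> ?O \<and> inner_regular \<mu> A \<and> inner_regular \<mu> (?O - A)}"
  have "{} \<in> sets \<mu>" "?O \<in> sets \<mu>" using sets.top[of \<mu>] sp by auto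
  then have e: "inner_regular \<mu> {}" "inner_regular \<mu> ?O"
    by (intro inner_regular_self; simp add: right_closed_def)+
  have sa: "sigma_algebra ?O \<S>"
    unfolding sigma_algebra_iff2
  proof (intro conjI ballI allI impI)
    show "\<S> \<subseteq> Pow ?O" "{} \<in> \<S>" using e by (auto simp: \<S>_def)
    show "?O - s \<in> \<S>" if "s \<in> \<S>" for s using that by (auto simp: \<S>_def double_diff)
    fix F :: "nat \<Rightarrow> _" assume F: "range F \<subseteq> \<S>"
    then have F': "inner_regular \<mu> (F i)" "inner_regular \<mu> (?O - F i)" "F i \<subseteq> ?O" for i
      by (auto simp: \<S>_def)
    have "?O - (\<Union>i. F i) = (\<Inter>i. ?O - F i)" by auto
    then show "(\<Union>i. F i) \<in> \<S>"
      using inner_regular_UN[OF F'(1) fin] inner_regular_INT[OF F'(2) fin] F'(3) by (auto simp: \<S>_def)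
  qed
  define N where "N = measure_of ?O \<S> (\<lambda>_. 0)"
  have sets_N: "sets N = \<S>" and sp_N: "space N = ?O"
    unfolding N_def using sigma_algebra.sets_measure_of_eq[OF sa] sigma_algebra.space_measure_of_eq[OF sa] by auto
  have "(\<lambda>x. x) \<in> N \<rightarrow>\<^sub>M optional_algebra G"
  proof (rule measurable_optionalI)
    fix Z assume Z: "cadlag_adapted G Z"
    have rc: "inner_regular \<mu> (?O \<inter> case_prod Z -` c)" if "closed c" for c
    proof (rule inner_regular_self[OF _ right_closed_cadlag[OF Z that]])
      show "?O \<inter> case_prod Z -` c \<in> sets \<mu>"
        using measurable_sets[OF cadlag_optional[OF Z] borel_closed[OF that]] sets
        by (simp add: space_optional Int_commute)
    qed
    show "(\<lambda>x. case_prod Z x) \<in> borel_measurable N"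
    proof (rule borel_measurableI_ge)
      fix y
      have 1: "inner_regular \<mu> {x \<in> space N. y \<le> case_prod Z x}"
        using rc[of "{y..}"] by (simp add: sp_N vimage_def Int_def conj_commute)
      have "?O - {x \<in> space N. y \<le> case_prod Z x} = (\<Union>n. ?O \<inter> case_prod Z -` {..y - 1 / real (Suc n)})"
      proof -
        have "z < y \<longleftrightarrow> (\<exists>n. z \<le> y - 1 / real (Suc n))" for z
        proof
          assume "z < y"
          then obtain n where "inverse (real (Suc n)) < y - z" using reals_Archimedean[of "y - z"] by auto
          then show "\<exists>n. z \<le> y - 1 / real (Suc n)" by (intro exI[of _ n]) (simp add: inverse_eq_divide)
        next
          assume "\<exists>n. z \<le> y - 1 / real (Suc n)"
          then obtain n where "z \<le> y - 1 / real (Suc n)" ..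
          moreover have "0 < 1 / real (Suc n)" by simp
          ultimately show "z < y" by linarith
        qed
        then have "\<not> y \<le> z \<longleftrightarrow> (\<exists>n. z \<le> y - 1 / real (Suc n))" for z by (metis not_le)
        then show ?thesis unfolding sp_N by blast
      qed
      moreover have "inner_regular \<mu> (\<Union>n. ?O \<inter> case_prod Z -` {..y - 1 / real (Suc n)})"
        by (intro inner_regular_UN[OF _ fin] rc) auto
      ultimately show "{x \<in> space N. y \<le> case_prod Z x} \<in> sets N"
        using 1 by (auto simp: sets_N \<S>_def sp_N)
    qed
  qed (auto simp: sp_N)
  from measurable_sets[OF this A] have "A \<inter> ?O \<in> \<S>" by (simp add: sets_N sp_N)
  moreover have "A \<subseteq> ?O" using sets.sets_into_space[OF A] by (simp add: space_optional)
  ultimately show ?thesis by (simp add: \<S>_def Int_absorb2)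
qed

text \<open>
  The debut of \<open>C\<close> is smaller than \<open>t\<close> iff \<open>\<omega>\<close> lies in the projection of the part of \<open>C\<close> before some
  rational \<open>r \<le> t\<close>. These projections are only sandwiched between events, so the debut is made a
  stopping time by replacing it with \<open>\<infinity>\<close> on the null set where some sandwich is not tight.
\<close>

theorem right_closed_debut:
  assumes C: "C \<in> sets (optional_algebra G)" and rc: "right_closed C"
  obtains T where "stopping T" "\<And>\<omega>. \<omega> \<in> space M \<Longrightarrow> T \<omega> < \<infinity> \<Longrightarrow> (enn2real (T \<omega>), \<omega>) \<in> C"
    "AE \<omega> in M. T \<omega> = \<infinity> \<longrightarrow> (\<forall>t. (t, \<omega>) \<notin> C)"
proof -
  have CO: "C \<subseteq> {0..} \<times> space M" using sets.sets_into_space[OF C] by (simp add: space_optional)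
  define B where "B r = snd ` (C \<inter> ({0..<r} \<times> space M))" for r
  have "\<exists>F1 F2. F1 \<in> sets (G r) \<and> F2 \<in> sets (G r) \<and> F1 \<subseteq> B r \<and> B r \<subseteq> F2 \<and> emeasure M (F2 - F1) = 0"
    if r: "0 \<le> r" for r
  proof -
    let ?P = "restr_to_subalg M (G r)"
    have s: "sets ?P = sets (G r)" by (rule sets_restr_to_subalg[OF subalg_G[OF r]])
    have "finite_measure ?P" by (rule finite_measure_restr_to_subalg[OF subalg_G[OF r]]) simp
    moreover have "C \<inter> ({0..<r} \<times> space M) \<in> sets (borel \<Otimes>\<^sub>M G r)"
      by (rule optional_slice[OF C r]) auto
    then have "C \<inter> ({0..<r} \<times> space M) \<in> sets (borel \<Otimes>\<^sub>M ?P)"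
      using sets_pair_measure_cong[OF refl s] by blast
    ultimately obtain F1 F2 where "F1 \<in> sets ?P" "F2 \<in> sets ?P" "F1 \<subseteq> B r" "B r \<subseteq> F2" "emeasure ?P (F2 - F1) = 0"
      unfolding B_def by (rule projection_sandwich)
    moreover from this have "emeasure ?P (F2 - F1) = emeasure M (F2 - F1)"
      by (intro emeasure_restr_to_subalg[OF subalg_G[OF r]]) (auto simp: s)
    ultimately show ?thesis using s by metis
  qed
  then obtain F1 F2 where F: "\<And>r. 0 \<le> r \<Longrightarrow> F1 r \<in> sets (G r)" "\<And>r. 0 \<le> r \<Longrightarrow> F2 r \<in> sets (G r)"
    "\<And>r. 0 \<le> r \<Longrightarrow> F1 r \<subseteq> B r" "\<And>r. 0 \<le> r \<Longrightarrow> B r \<subseteq> F2 r" "\<And>r. 0 \<le> r \<Longrightarrow> emeasure M (F2 r - F1 r) = 0"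
    by metis
  \<comment> \<open>Outside \<open>N\<close> the projection \<open>B r\<close> and the event \<open>F1 r\<close> coincide for all rational \<open>r \<ge> 0\<close>.\<close>
  define N where "N = (\<Union>r\<in>\<rat> \<inter> {0..}. F2 r - F1 r)"
  have N: "N \<in> null_sets M"
    unfolding N_def
  proof (rule null_sets_UN')
    show "countable (\<rat> \<inter> {0::real..})" using countable_rat by blast
    show "F2 r - F1 r \<in> null_sets M" if "r \<in> \<rat> \<inter> {0..}" for r
      using F[of r] that sets_G_M[of r] by (intro null_setsI) auto
  qed
  have eqF: "\<omega> \<in> F1 r \<longleftrightarrow> \<omega> \<in> B r" if "\<omega> \<notin> N" "r \<in> \<rat>" "0 \<le> r" for \<omega> r
    using that F(3,4)[of r] unfolding N_def by blast
  define S where "S \<omega> = {t. (t, \<omega>) \<in> C}" for \<omega>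
  have S0: "bdd_below (S \<omega>)" for \<omega> using CO by (intro bdd_belowI[of _ 0]) (auto simp: S_def)
  define T where "T \<omega> = (if \<omega> \<in> N \<or> S \<omega> = {} then \<infinity> else ennreal (Inf (S \<omega>)))" for \<omega>
  have Inf0: "0 \<le> Inf (S \<omega>)" if "S \<omega> \<noteq> {}" for \<omega>
    using that CO by (intro cInf_greatest) (auto simp: S_def)
  show ?thesis
  proof (rule that[of T])
    show "stopping T"
    proof (rule stopping_lessI)
      fix t :: real assume t: "0 < t"
      have "{\<omega> \<in> space M. T \<omega> < ennreal t} = (\<Union>r\<in>\<rat> \<inter> {0..t}. F1 r) - N"
      proof (intro equalityI subsetI)
        fix \<omega> assume "\<omega> \<in> {\<omega> \<in> space M. T \<omega> < ennreal t}"
        then have \<omega>: "\<omega> \<in> space M" "\<omega> \<notin> N" "S \<omega> \<noteq> {}" "ennreal (Inf (S \<omega>)) < ennreal t"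
          by (auto simp: T_def split: if_splits)
        then have "Inf (S \<omega>) < t" using Inf0 by (simp add: ennreal_less_iff)
        then obtain s where s: "(s, \<omega>) \<in> C" "s < t"
          using cInf_less_iff[OF \<omega>(3) S0] by (auto simp: S_def)
        obtain r where r: "r \<in> \<rat>" "s < r" "r < t" using Rats_dense_in_real[OF s(2)] by auto
        have "0 \<le> s" using s CO by auto
        then have "\<omega> \<in> B r" using s r \<omega> unfolding B_def by force
        then show "\<omega> \<in> (\<Union>r\<in>\<rat> \<inter> {0..t}. F1 r) - N"
          using eqF[OF \<omega>(2) r(1)] \<omega> r \<open>0 \<le> s\<close> by auto
      next
        fix \<omega> assume "\<omega> \<in> (\<Union>r\<in>\<rat> \<inter> {0..t}. F1 r) - N"
        then obtain r where r: "r \<in> \<rat>" "0 \<le> r" "r \<le> t" "\<omega> \<in> F1 r" "\<omega> \<notin> N" by auto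
        then have "\<omega> \<in> B r" using eqF by auto
        then obtain s where s: "(s, \<omega>) \<in> C" "s < r" "\<omega> \<in> space M" by (auto simp: B_def)
        then have "Inf (S \<omega>) < t" using cInf_lower[OF _ S0, of s \<omega>] r by (auto simp: S_def)
        then have "ennreal (Inf (S \<omega>)) < ennreal t" using t by (simp add: ennreal_lessI)
        then show "\<omega> \<in> {\<omega> \<in> space M. T \<omega> < ennreal t}" using r s by (auto simp: T_def S_def)
      qed
      moreover have "(\<Union>r\<in>\<rat> \<inter> {0..t}. F1 r) \<in> sets (G t)"
      proof (rule sets.countable_UN'')
        show "countable (\<rat> \<inter> {0..t})" using countable_rat by blast
        show "F1 r \<in> sets (G t)" if "r \<in> \<rat> \<inter> {0..t}" for r
          using that F(1)[of r] sets_G_mono[of r t] by auto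
      qed
      ultimately show "{\<omega> \<in> space M. T \<omega> < ennreal t} \<in> sets (G t)"
        using null_G[OF N, of t] t by auto
    qed
    show "(enn2real (T \<omega>), \<omega>) \<in> C" if \<omega>: "\<omega> \<in> space M" "T \<omega> < \<infinity>" for \<omega>
    proof -
      have ne: "S \<omega> \<noteq> {}" and T: "T \<omega> = ennreal (Inf (S \<omega>))" using \<omega> by (auto simp: T_def split: if_splits)
      let ?i = "Inf (S \<omega>)"
      have "(?i, \<omega>) \<in> C"
      proof (rule ccontr)
        assume no: "(?i, \<omega>) \<notin> C"
        have "\<exists>\<^sub>F s in at_right ?i. (s, \<omega>) \<in> C"
          unfolding frequently_def eventually_at_right_field
        proof (intro notI, elim exE conjE)
          fix b assume b: "?i < b" "\<forall>y>?i. y < b \<longrightarrow> (y, \<omega>) \<notin> C"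
          then obtain s where s: "s \<in> S \<omega>" "s < b" using cInf_less_iff[OF ne S0] by auto
          then have "?i \<le> s" using cInf_lower[OF _ S0] by auto
          then show False using b s no by (cases "?i = s") (auto simp: S_def)
        qed
        then show False using rc no Inf0[OF ne] \<omega> by (auto simp: right_closed_def)
      qed
      then show ?thesis using T Inf0[OF ne] by simp
    qed
    show "AE \<omega> in M. T \<omega> = \<infinity> \<longrightarrow> (\<forall>t. (t, \<omega>) \<notin> C)"
      using AE_not_in[OF N] by eventually_elim (auto simp: T_def S_def)
  qed
qed

text \<open>
  If the exceptional set were not null, \<open>A\<close> would have a measurable section on an event \<open>F\<close> of positive
  probability. The image \<open>\<mu>\<close> of the measure on \<open>F\<close> under the section charges some right-closed subset
  \<open>C\<close> of \<open>A\<close>, and the debut of \<open>C\<close> is a stopping time that meets \<open>A\<close> with positive probability.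
\<close>

theorem optional_cross_section:
  assumes A: "A \<in> sets (optional_algebra G)"
    and no: "\<And>T. stopping T \<Longrightarrow> AE \<omega> in M. T \<omega> < \<infinity> \<longrightarrow> (enn2real (T \<omega>), \<omega>) \<notin> A"
  shows "AE \<omega> in M. \<forall>t. (t, \<omega>) \<notin> A"
proof (rule ccontr)
  assume neg: "\<not> (AE \<omega> in M. \<forall>t. (t, \<omega>) \<notin> A)"
  have AO: "A \<subseteq> {0..} \<times> space M" using sets.sets_into_space[OF A] by (simp add: space_optional)
  have AM: "A \<in> sets (borel \<Otimes>\<^sub>M M)"
  proof -
    have "A = (\<lambda>(s, \<omega>). (max 0 s, \<omega>)) -` A \<inter> space (borel \<Otimes>\<^sub>M M) \<inter> ({0..} \<times> space M)"
      using AO by (auto simp: space_pair_measure max_def)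
    then show ?thesis using measurable_sets[OF optional_joint A]
      by (metis atLeast_borel pair_measureI sets.Int sets.top)
  qed
  have "snd ` A \<subseteq> space M" using AO by auto
  from outer_measure_of_attain[OF this] obtain E where E: "E \<in> sets M" "snd ` A \<subseteq> E"
    "outer_measure_of M (snd ` A) = emeasure M E" by blast
  have "emeasure M E \<noteq> 0"
  proof
    assume "emeasure M E = 0"
    then have "E \<in> null_sets M" using E by auto
    from AE_not_in[OF this] have "AE \<omega> in M. \<forall>t. (t, \<omega>) \<notin> A"
      by eventually_elim (use E(2) in force)
    then show False using neg by simp
  qed
  then obtain \<alpha> where \<alpha>: "0 < \<alpha>" "\<alpha> < outer_measure_of M (snd ` A)"
    using dense[of 0 "emeasure M E"] E(3) by (auto simp: zero_less_iff_neq_zero)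
  obtain F R where F: "F \<in> sets M" "R \<in> borel_measurable M" "\<alpha> \<le> emeasure M F"
    "\<And>\<omega>. \<omega> \<in> F \<Longrightarrow> (R \<omega>, \<omega>) \<in> A"
    using measurable_section[OF finite_measure_axioms AM \<alpha>(2)] by metis
  define f where "f \<omega> = (max 0 (R \<omega>), \<omega>)" for \<omega>
  have f: "f \<in> M \<rightarrow>\<^sub>M optional_algebra G"
  proof -
    have "(\<lambda>\<omega>. (R \<omega>, \<omega>)) \<in> M \<rightarrow>\<^sub>M borel \<Otimes>\<^sub>M M" using F(2) by measurable
    from measurable_compose[OF this optional_joint] show ?thesis by (simp add: f_def[abs_def])
  qed
  have fA: "f \<omega> \<in> A" if "\<omega> \<in> F" for \<omega>
    using F(4)[OF that] AO by (auto simp: f_def max_def)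
  \<comment> \<open>\<open>\<mu>\<close> is the image of the probability on \<open>F\<close> under the section; clamping the time keeps the map inside the domain of the optional sets also off \<open>F\<close>.\<close>
  define D where "D = density M (indicator F)"
  have emD: "emeasure D B = emeasure M (F \<inter> B)" if "B \<in> sets M" for B
    unfolding D_def using that F(1) by (simp add: emeasure_density indicator_inter_arith[symmetric])
  have D[simp]: "sets D = sets M" "space D = space M" by (auto simp: D_def)
  have fD: "f \<in> D \<rightarrow>\<^sub>M optional_algebra G" using f by (simp cong: measurable_cong_sets)
  define \<mu> where "\<mu> = distr D (optional_algebra G) f"
  have em: "emeasure \<mu> B = emeasure M (F \<inter> (f -` B \<inter> space M))" if "B \<in> sets (optional_algebra G)" for B
    unfolding \<mu>_def using that measurable_sets[OF f that] by (simp add: emeasure_distr[OF fD] emD)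
  have sets\<mu>: "sets \<mu> = sets (optional_algebra G)" by (simp add: \<mu>_def)
  interpret \<mu>: finite_measure \<mu>
  proof
    have "emeasure \<mu> (space \<mu>) \<le> emeasure M (space M)"
      using em[of "space \<mu>"] sets.top[of \<mu>] emeasure_space by (simp add: sets\<mu>)
    then show "emeasure \<mu> (space \<mu>) \<noteq> \<infinity>" by (auto simp: emeasure_space_1 top_unique)
  qed
  have "F \<inter> (f -` A \<inter> space M) = F" using fA sets.sets_into_space[OF F(1)] by auto
  then have "emeasure \<mu> A \<noteq> 0" using em[OF A] F(3) \<alpha>(1) by auto
  then have "0 < measure \<mu> A" by (simp add: \<mu>.emeasure_eq_measure zero_less_measure_iff)
  then obtain C where C: "C \<in> sets \<mu>" "right_closed C" "C \<subseteq> A" "measure \<mu> (A - C) < measure \<mu> A"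
    using optional_inner_regular[OF \<mu>.finite_measure_axioms sets\<mu> A] unfolding inner_regular_def by blast
  have "measure \<mu> (A - C) = measure \<mu> A - measure \<mu> C"
    using A C sets\<mu> by (intro \<mu>.finite_measure_Diff) auto
  then have C0: "measure \<mu> C > 0" using C(4) by simp
  have CO: "C \<in> sets (optional_algebra G)" using C(1) sets\<mu> by simp
  obtain T where T: "stopping T" "\<And>\<omega>. \<omega> \<in> space M \<Longrightarrow> T \<omega> < \<infinity> \<Longrightarrow> (enn2real (T \<omega>), \<omega>) \<in> C"
    "AE \<omega> in M. T \<omega> = \<infinity> \<longrightarrow> (\<forall>t. (t, \<omega>) \<notin> C)"
    by (rule right_closed_debut[OF CO C(2)], rule that) blast+
  have "AE \<omega> in M. \<omega> \<notin> F \<inter> (f -` C \<inter> space M)"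
    using T(3) no[OF T(1)] AE_space
  proof eventually_elim
    case (elim \<omega>)
    then have "T \<omega> = \<infinity>" using T(2)[of \<omega>] C(3) by (cases "T \<omega> = \<infinity>") (auto simp: less_top[symmetric])
    then show ?case using elim(1) by (auto simp: f_def)
  qed
  then have "emeasure M (F \<inter> (f -` C \<inter> space M)) = 0"
    using F(1) measurable_sets[OF f CO] by (intro AE_iff_measurable[THEN iffD1, rotated 2]) auto
  then have "measure \<mu> C = 0" using em[OF CO] by (simp add: measure_def)
  then show False using C0 by simp
qed

end

section \<open>Upcrossings and right-continuous martingales\<close>

text \<open>
  A trader buys when the price \<open>y\<close> is below \<open>a\<close> and sells when it exceeds \<open>b\<close>; \<open>holding\<close> says whether
  the asset is held after observing \<open>y i\<close>. Its value depends on \<open>y 0, \<dots>, y i\<close> only.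
\<close>

primrec holding :: "real \<Rightarrow> real \<Rightarrow> (nat \<Rightarrow> real) \<Rightarrow> nat \<Rightarrow> bool" where
  "holding a b y 0 \<longleftrightarrow> y 0 < a"
| "holding a b y (Suc i) \<longleftrightarrow> (if holding a b y i then y (Suc i) \<le> b else y (Suc i) < a)"

text \<open>
  The number of completed sales.
\<close>

primrec crossings :: "real \<Rightarrow> real \<Rightarrow> (nat \<Rightarrow> real) \<Rightarrow> nat \<Rightarrow> nat" where
  "crossings a b y 0 = 0"
| "crossings a b y (Suc i) = crossings a b y i + (if holding a b y i \<and> \<not> holding a b y (Suc i) then 1 else 0)"

text \<open>
  Doob's upcrossing inequality along a path: each completed sale earns at least \<open>b - a\<close>, and an
  open position is worth at least \<open>y n - a\<close>.
\<close>

lemma crossings_gain: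
  assumes "a < b"
  shows "(b - a) * real (crossings a b y n) \<le>
    (\<Sum>i<n. of_bool (holding a b y i) * (y (Suc i) - y i)) + (if holding a b y n then a - y n else 0)"
proof (induction n)
  case (Suc n)
  then show ?case using assms by (auto simp: algebra_simps split: if_splits)
qed simp

lemma crossings_mono: "i \<le> j \<Longrightarrow> crossings a b y i \<le> crossings a b y j"
  by (rule lift_Suc_mono_le[of "crossings a b y"]) auto

lemma holding_below: "y i < a \<Longrightarrow> a < b \<Longrightarrow> holding a b y i"
  by (cases i) auto

lemma not_holding_above: "b < y i \<Longrightarrow> a < b \<Longrightarrow> \<not> holding a b y i"
  by (cases i) auto

lemma crossings_step:
  assumes "i < j" "holding a b y i" "\<not> holding a b y j"
  shows "Suc (crossings a b y i) \<le> crossings a b y j"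
  using assms
proof (induction rule: strict_inc_induct)
  case (base i)
  then show ?case by auto
next
  case (step i)
  show ?case
  proof (cases "holding a b y (Suc i)")
    case True
    then have "Suc (crossings a b y (Suc i)) \<le> crossings a b y j" using step by blast
    then show ?thesis by auto
  next
    case False
    then have "crossings a b y (Suc i) = Suc (crossings a b y i)" using step by simp
    then show ?thesis using crossings_mono[of "Suc i" j a b y] step(1) by simp
  qed
qed

lemma dyadics_level:
  assumes "q \<in> (dyadics :: real set)" shows "\<exists>n0. \<forall>n\<ge>n0. \<exists>j::nat. q = real j / 2 ^ n"
proof -
  obtain i n0 where q: "q = real i / 2 ^ n0" using assms by (auto simp: dyadics_def)
  have "\<exists>j::nat. q = real j / 2 ^ n" if le: "n0 \<le> n" for n
  proof -
    obtain d where n: "n = n0 + d" using le_Suc_ex[OF le] by blast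
    have "q = real (i * 2 ^ d) / 2 ^ n" unfolding q n by (simp add: power_add)
    then show ?thesis ..
  qed
  then show ?thesis by blast
qed

text \<open>
  The first dyadic number of level \<open>n\<close> strictly above \<open>t\<close>.
\<close>

definition dyadic_above :: "nat \<Rightarrow> real \<Rightarrow> real" where
  "dyadic_above n t = (real (nat \<lfloor>2 ^ n * t\<rfloor>) + 1) / 2 ^ n"

lemma pow2_at_top: "filterlim (\<lambda>n. 2 ^ n :: real) at_top sequentially"
  by (rule filterlim_at_top_mono[OF filterlim_real_sequentially])
    (auto intro!: always_eventually less_imp_le of_nat_less_two_power)

lemma dyadic_above_greater: "0 \<le> t \<Longrightarrow> t < dyadic_above n t"
  unfolding dyadic_above_def by (rule floor_approx_right(1)[OF _ _ pow2_at_top]) auto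

lemma dyadic_above_lim: "0 \<le> t \<Longrightarrow> filterlim (\<lambda>n. dyadic_above n t) (at_right t) sequentially"
  unfolding dyadic_above_def by (rule floor_approx_right(2)[OF _ _ pow2_at_top]) auto

lemma dyadic_above_in: "dyadic_above n t \<in> dyadics"
proof -
  have "dyadic_above n t = real (Suc (nat \<lfloor>2 ^ n * t\<rfloor>)) / 2 ^ n"
    by (simp add: dyadic_above_def add.commute)
  then show ?thesis unfolding dyadics_def UN_iff bex_UNIV singleton_iff by blast
qed

lemma dyadic_above_less:
  assumes "0 \<le> t" "t < s" shows "eventually (\<lambda>n. dyadic_above n t < s) sequentially"
proof (rule eventually_compose_filterlim[OF _ dyadic_above_lim[OF assms(1)]])
  show "eventually (\<lambda>x. x < s) (at_right t)"
    using assms by (auto simp: eventually_at_right[OF assms(2)])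
qed

text \<open>
  Upcrossings counted over all dyadic times of an open interval, without fixing a level. In this
  form a limit that fails to exist at one end of the interval produces arbitrarily many of them.
\<close>

primrec upcrosses :: "(real \<Rightarrow> real) \<Rightarrow> real \<Rightarrow> real \<Rightarrow> nat \<Rightarrow> real \<Rightarrow> real \<Rightarrow> bool" where
  "upcrosses f a b 0 u v \<longleftrightarrow> True"
| "upcrosses f a b (Suc k) u v \<longleftrightarrow> (\<exists>p\<in>dyadics. \<exists>q\<in>dyadics.
     u < p \<and> p < q \<and> q < v \<and> f p < a \<and> b < f q \<and> upcrosses f a b k q v)"

lemma upcrosses_mono: "upcrosses f a b k u v \<Longrightarrow> u' \<le> u \<Longrightarrow> upcrosses f a b k u' v"
  by (cases k) (fastforce intro: le_less_trans)+

text \<open>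
  The finitely many dyadic times involved belong to every sufficiently fine grid, so the trader on
  that grid completes at least \<open>k\<close> sales.
\<close>

lemma upcrosses_crossings:
  assumes ab: "a < b"
  shows "upcrosses f a b k u v \<Longrightarrow> u \<le> v \<Longrightarrow> \<exists>n0. \<forall>n\<ge>n0. \<forall>i N. real i / 2 ^ n \<le> u \<longrightarrow> v \<le> real N / 2 ^ n \<longrightarrow>
    crossings a b (\<lambda>i. f (real i / 2 ^ n)) i + k \<le> crossings a b (\<lambda>i. f (real i / 2 ^ n)) N"
proof (induction k arbitrary: u)
  case 0
  have "i \<le> N" if "real i / 2 ^ n \<le> u" "v \<le> real N / 2 ^ n" for i N n
  proof -
    have "real i / 2 ^ n \<le> real N / 2 ^ n" using that 0 by linarith
    then show ?thesis by (simp add: divide_le_cancel)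
  qed
  then show ?case by (intro exI[of _ 0] allI impI) (simp add: crossings_mono)
next
  case (Suc k)
  then obtain p q where pq: "p \<in> dyadics" "q \<in> dyadics" "u < p" "p < q" "q < v" "f p < a" "b < f q"
    "upcrosses f a b k q v" by auto
  obtain n1 where n1: "\<And>n. n1 \<le> n \<Longrightarrow> \<exists>j::nat. p = real j / 2 ^ n" using dyadics_level[OF pq(1)] by blast
  obtain n2 where n2: "\<And>n. n2 \<le> n \<Longrightarrow> \<exists>j::nat. q = real j / 2 ^ n" using dyadics_level[OF pq(2)] by blast
  obtain n3 where n3: "\<And>n i N. n3 \<le> n \<Longrightarrow> real i / 2 ^ n \<le> q \<Longrightarrow> v \<le> real N / 2 ^ n \<Longrightarrow>
     crossings a b (\<lambda>i. f (real i / 2 ^ n)) i + k \<le> crossings a b (\<lambda>i. f (real i / 2 ^ n)) N"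
    using Suc.IH[OF pq(8)] pq(5) by (auto simp: less_imp_le)
  show ?case
  proof (intro exI[of _ "max n1 (max n2 n3)"] allI impI)
    fix n i N assume n: "max n1 (max n2 n3) \<le> n" and i: "real i / 2 ^ n \<le> u" and N: "v \<le> real N / 2 ^ n"
    let ?y = "\<lambda>i. f (real i / 2 ^ n)"
    obtain j l :: nat where j: "p = real j / 2 ^ n" and l: "q = real l / 2 ^ n"
      using n1 n2 n by (meson max.bounded_iff)
    have "real i / 2 ^ n < real j / 2 ^ n" "real j / 2 ^ n < real l / 2 ^ n" using i pq j l by linarith+
    then have "i < j" "j < l" by (simp_all add: divide_less_cancel)
    moreover have "holding a b ?y j" "\<not> holding a b ?y l"
      using pq j l ab holding_below[of ?y j a b] not_holding_above[of b ?y l a] by simp_all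
    ultimately have "Suc (crossings a b ?y i) \<le> crossings a b ?y l"
      using crossings_step[of j l a b ?y] crossings_mono[of i j a b ?y] by linarith
    moreover have "crossings a b ?y l + k \<le> crossings a b ?y N"
      using n3[of n l N] n N l by simp
    ultimately show "crossings a b ?y i + Suc k \<le> crossings a b ?y N" by linarith
  qed
qed

definition nonoscillating :: "(real \<Rightarrow> real) \<Rightarrow> bool" where
  "nonoscillating f \<longleftrightarrow> (\<forall>a\<in>\<rat>. \<forall>b\<in>\<rat>. a < b \<longrightarrow> (\<forall>v. \<exists>k. \<not> upcrosses f a b k 0 v))"

text \<open>
  The limit is the largest eventual lower bound.
\<close>

lemma bounded_limit_exists:
  fixes f :: "'a \<Rightarrow> real"
  assumes f: "\<And>x. 0 \<le> f x" "\<And>x. f x \<le> 1"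
    and no: "\<And>a b. a \<in> \<rat> \<Longrightarrow> b \<in> \<rat> \<Longrightarrow> a < b \<Longrightarrow> (\<exists>\<^sub>F x in F. f x < a) \<Longrightarrow> (\<exists>\<^sub>F x in F. b < f x) \<Longrightarrow> False"
  shows "\<exists>l. (f \<longlongrightarrow> l) F"
proof (cases "F = bot")
  case False
  define A where "A = {y. \<forall>\<^sub>F x in F. y \<le> f x}"
  have A0: "0 \<in> A" using f by (simp add: A_def)
  have "y \<le> 1" if "y \<in> A" for y
  proof -
    have "\<forall>\<^sub>F x in F. y \<le> 1" using that unfolding A_def mem_Collect_eq
      by eventually_elim (use f in \<open>blast intro: order_trans\<close>)
    then show ?thesis using False by simp
  qed
  then have bdd: "bdd_above A" by (rule bdd_aboveI)
  have "(f \<longlongrightarrow> Sup A) F"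
  proof (rule order_tendstoI)
    fix y assume "y < Sup A"
    then obtain z where z: "z \<in> A" "y < z" using less_cSup_iff[of A y] A0 bdd by auto
    then show "\<forall>\<^sub>F x in F. y < f x" unfolding A_def mem_Collect_eq
      by (auto elim: eventually_mono)
  next
    fix y assume "Sup A < y"
    then obtain b where b: "b \<in> \<rat>" "Sup A < b" "b < y" using Rats_dense_in_real by blast
    then obtain a where a: "a \<in> \<rat>" "Sup A < a" "a < b" using Rats_dense_in_real by blast
    have "a \<notin> A" using cSup_upper[OF _ bdd] a by force
    then have "\<exists>\<^sub>F x in F. f x < a" by (simp add: A_def frequently_def not_less)
    then have "\<not> (\<exists>\<^sub>F x in F. b < f x)" using no a b by blast
    then have "\<forall>\<^sub>F x in F. f x \<le> b" by (simp add: frequently_def not_less)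
    then show "\<forall>\<^sub>F x in F. f x < y" using b by (auto elim: eventually_mono)
  qed
  then show ?thesis ..
qed (auto intro: exI[of _ 0])

lemma frequently_right_dyadic:
  fixes t :: real
  assumes "\<exists>\<^sub>F q in at t within dyadics \<inter> {t<..}. P q" "t < s"
  obtains q where "q \<in> dyadics" "t < q" "q < s" "P q"
proof -
  have "\<forall>\<^sub>F q in at t within dyadics \<inter> {t<..}. q \<in> dyadics \<and> t < q \<and> q < s"
    unfolding eventually_at using assms(2) by (intro exI[of _ "s - t"]) (auto simp: dist_real_def)
  with assms(1) have "\<exists>\<^sub>F q in at t within dyadics \<inter> {t<..}. P q \<and> (q \<in> dyadics \<and> t < q \<and> q < s)"
    using frequently_eventually_conj by (fastforce simp: conj_commute)
  then show ?thesis using that by (auto dest: frequently_ex)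
qed

lemma frequently_left_dyadic:
  fixes t :: real
  assumes "\<exists>\<^sub>F q in at t within dyadics \<inter> {..<t}. P q" "s < t"
  obtains q where "q \<in> dyadics" "s < q" "q < t" "P q"
proof -
  have "\<forall>\<^sub>F q in at t within dyadics \<inter> {..<t}. q \<in> dyadics \<and> s < q \<and> q < t"
    unfolding eventually_at using assms(2) by (intro exI[of _ "t - s"]) (auto simp: dist_real_def)
  with assms(1) have "\<exists>\<^sub>F q in at t within dyadics \<inter> {..<t}. P q \<and> (q \<in> dyadics \<and> s < q \<and> q < t)"
    using frequently_eventually_conj by (fastforce simp: conj_commute)
  then show ?thesis using that by (auto dest: frequently_ex)
qed

lemma nonoscillating_right_limit:
  assumes no: "nonoscillating f" and f: "\<And>x. 0 \<le> f x" "\<And>x. f x \<le> 1" and t: "0 \<le> t"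
  shows "\<exists>l. (f \<longlongrightarrow> l) (at t within dyadics \<inter> {t<..})"
proof (rule bounded_limit_exists[OF f])
  fix a b :: real assume ab: "a \<in> \<rat>" "b \<in> \<rat>" "a < b"
  let ?F = "at t within dyadics \<inter> {t<..}"
  assume A: "\<exists>\<^sub>F x in ?F. f x < a" and B: "\<exists>\<^sub>F x in ?F. b < f x"
  have "\<exists>u. t < u \<and> u < t + 1 \<and> upcrosses f a b k u (t + 1)" for k
  proof (induction k)
    case 0 then show ?case by (auto intro: exI[of _ "t + 1/2"])
  next
    case (Suc k)
    then obtain u where u: "t < u" "u < t + 1" "upcrosses f a b k u (t + 1)" by blast
    obtain q where q: "q \<in> dyadics" "t < q" "q < u" "b < f q" by (rule frequently_right_dyadic[OF B u(1)])
    obtain p where p: "p \<in> dyadics" "t < p" "p < q" "f p < a" by (rule frequently_right_dyadic[OF A q(2)])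
    obtain u' where u': "t < u'" "u' < p" using dense[OF p(2)] by blast
    have "upcrosses f a b k q (t + 1)" using upcrosses_mono[OF u(3)] q by simp
    then have "upcrosses f a b (Suc k) u' (t + 1)" using p q u u' by fastforce
    then show ?case using u' p q u by (intro exI[of _ u']) auto
  qed
  then have "upcrosses f a b k 0 (t + 1)" for k using upcrosses_mono t by (meson less_imp_le order_trans)
  then show False using no ab unfolding nonoscillating_def by blast
qed

lemma nonoscillating_left_limit:
  assumes no: "nonoscillating f" and f: "\<And>x. 0 \<le> f x" "\<And>x. f x \<le> 1" and t: "0 < t"
  shows "\<exists>l. (f \<longlongrightarrow> l) (at t within dyadics \<inter> {..<t})"
proof (rule bounded_limit_exists[OF f])
  fix a b :: real assume ab: "a \<in> \<rat>" "b \<in> \<rat>" "a < b"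
  let ?F = "at t within dyadics \<inter> {..<t}"
  assume A: "\<exists>\<^sub>F x in ?F. f x < a" and B: "\<exists>\<^sub>F x in ?F. b < f x"
  have "\<forall>u<t. upcrosses f a b k u t" for k
  proof (induction k)
    case (Suc k)
    show ?case
    proof (intro allI impI)
      fix u assume u: "u < t"
      obtain p where p: "p \<in> dyadics" "u < p" "p < t" "f p < a" by (rule frequently_left_dyadic[OF A u])
      obtain q where q: "q \<in> dyadics" "p < q" "q < t" "b < f q" by (rule frequently_left_dyadic[OF B p(3)])
      show "upcrosses f a b (Suc k) u t" using p q Suc by fastforce
    qed
  qed simp
  then have "upcrosses f a b k 0 t" for k using t by blast
  then show False using no ab unfolding nonoscillating_def by blast
qed

text \<open>
  Strict right limits along the dyadics; at a dyadic time this may differ from the value of \<open>f\<close>.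
\<close>

definition right_lim :: "(real \<Rightarrow> real) \<Rightarrow> real \<Rightarrow> real" where
  "right_lim f t = (SOME l. (f \<longlongrightarrow> l) (at t within dyadics \<inter> {t<..}))"

context
  fixes f :: "real \<Rightarrow> real"
  assumes no: "nonoscillating f" and f: "\<And>x. 0 \<le> f x" "\<And>x. f x \<le> 1"
begin

lemma right_lim_tendsto: "0 \<le> t \<Longrightarrow> (f \<longlongrightarrow> right_lim f t) (at t within dyadics \<inter> {t<..})"
  unfolding right_lim_def by (rule someI_ex) (rule nonoscillating_right_limit[OF no f])

lemma right_lim_seq:
  assumes t: "0 \<le> t" shows "(\<lambda>n. f (dyadic_above n t)) \<longlonglongrightarrow> right_lim f t"
proof (rule filterlim_compose[OF right_lim_tendsto[OF t]])
  show "filterlim (\<lambda>n. dyadic_above n t) (at t within dyadics \<inter> {t<..}) sequentially"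
    using dyadic_above_lim[OF t] dyadic_above_greater[OF t] dyadic_above_in
    by (auto simp: filterlim_at intro!: always_eventually dest: less_imp_neq)
qed

lemma right_lim_bounds: "0 \<le> t \<Longrightarrow> 0 \<le> right_lim f t \<and> right_lim f t \<le> 1"
  using LIMSEQ_le_const[OF right_lim_seq] LIMSEQ_le_const2[OF right_lim_seq] f by blast

text \<open>
  An estimate at the dyadic times of an open interval passes to the right limits, including the one
  at the left end point.
\<close>

lemma right_lim_close:
  assumes *: "\<And>q. q \<in> dyadics \<Longrightarrow> x < q \<Longrightarrow> q < y \<Longrightarrow> \<bar>f q - l\<bar> \<le> e"
    and s: "0 \<le> s" "x \<le> s" "s < y"
  shows "\<bar>right_lim f s - l\<bar> \<le> e"
proof (rule LIMSEQ_le_const2)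
  show "(\<lambda>n. \<bar>f (dyadic_above n s) - l\<bar>) \<longlonglongrightarrow> \<bar>right_lim f s - l\<bar>"
    by (intro tendsto_intros right_lim_seq s)
  have "eventually (\<lambda>n. \<bar>f (dyadic_above n s) - l\<bar> \<le> e) sequentially"
    using dyadic_above_less[OF s(1,3)]
    by eventually_elim (use * dyadic_above_in dyadic_above_greater[OF s(1)] s(2) in \<open>meson le_less_trans\<close>)
  then show "\<exists>N. \<forall>n\<ge>N. \<bar>f (dyadic_above n s) - l\<bar> \<le> e" by (simp add: eventually_sequentially)
qed

lemma right_lim_right:
  assumes t: "0 \<le> t" shows "((\<lambda>s. right_lim f s) \<longlongrightarrow> right_lim f t) (at_right t)"
proof (rule tendstoI)
  fix e :: real assume e: "0 < e"
  have "\<forall>\<^sub>F q in at t within dyadics \<inter> {t<..}. dist (f q) (right_lim f t) < e / 2"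
    using e by (intro tendstoD[OF right_lim_tendsto[OF t]]) auto
  then obtain d where d: "0 < d" "\<And>q. q \<in> dyadics \<Longrightarrow> t < q \<Longrightarrow> q < t + d \<Longrightarrow> \<bar>f q - right_lim f t\<bar> < e / 2"
    unfolding eventually_at by (fastforce simp: dist_real_def)
  have "dist (right_lim f s) (right_lim f t) < e" if "t < s" "s < t + d" for s
    using right_lim_close[of t "t + d" "right_lim f t" "e / 2" s] d(2) that t e
    by (force simp: dist_real_def)
  then show "\<forall>\<^sub>F s in at_right t. dist (right_lim f s) (right_lim f t) < e"
    using d(1) by (auto simp: eventually_at_right_field intro!: exI[of _ "t + d"])
qed

lemma right_lim_left:
  assumes t: "0 < t" shows "\<exists>l. ((\<lambda>s. right_lim f s) \<longlongrightarrow> l) (at_left t)"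
proof -
  obtain l where l: "(f \<longlongrightarrow> l) (at t within dyadics \<inter> {..<t})"
    using nonoscillating_left_limit[OF no f t] by blast
  have "((\<lambda>s. right_lim f s) \<longlongrightarrow> l) (at_left t)"
  proof (rule tendstoI)
    fix e :: real assume e: "0 < e"
    have "\<forall>\<^sub>F q in at t within dyadics \<inter> {..<t}. dist (f q) l < e / 2"
      using e by (intro tendstoD[OF l]) auto
    then obtain d where d: "0 < d" "\<And>q. q \<in> dyadics \<Longrightarrow> t - d < q \<Longrightarrow> q < t \<Longrightarrow> \<bar>f q - l\<bar> < e / 2"
      unfolding eventually_at by (fastforce simp: dist_real_def)
    have "dist (right_lim f s) l < e" if "max 0 (t - d) < s" "s < t" for s
      using right_lim_close[of "t - d" t l "e / 2" s] d(2) that e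
      by (force simp: dist_real_def)
    then show "\<forall>\<^sub>F s in at_left t. dist (right_lim f s) l < e"
      using d(1) t by (auto simp: eventually_at_left_field intro!: exI[of _ "max 0 (t - d)"])
  qed
  then show ?thesis ..
qed

end

context usual_filtration
begin

text \<open>
  Right continuity of the filtration: what is known immediately after \<open>t\<close> is known at \<open>t\<close>.
\<close>

lemma measurable_G_rightI:
  fixes g :: "'w \<Rightarrow> real"
  assumes t: "0 \<le> t" and m: "\<And>s. t < s \<Longrightarrow> g \<in> borel_measurable (G s)"
  shows "g \<in> borel_measurable (G t)"
proof (rule borel_measurableI_le)
  fix x
  show "{\<omega> \<in> space (G t). g \<omega> \<le> x} \<in> sets (G t)"
  proof (rule in_G_rightI[OF t])
    fix s assume s: "t < s"
    have "{\<omega> \<in> space (G s). g \<omega> \<le> x} \<in> sets (G s)" using m[OF s] by measurable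
    then show "{\<omega> \<in> space (G t). g \<omega> \<le> x} \<in> sets (G s)" using s t by (simp add: space_G)
  qed
qed

text \<open>
  Truncation gives a version of the conditional probability that lies in \<open>[0, 1]\<close> everywhere.
\<close>

lemma cond_prob_version:
  assumes F: "F \<in> sets M" and q: "0 \<le> q"
  shows "\<exists>m. m \<in> borel_measurable (G q) \<and> (\<forall>\<omega>. 0 \<le> m \<omega> \<and> m \<omega> \<le> 1) \<and>
    (\<forall>A\<in>sets (G q). (\<integral>\<omega>. indicator A \<omega> * m \<omega> \<partial>M) = measure M (A \<inter> F))"
proof -
  interpret G: finite_measure_subalgebra M "G q"
    by unfold_locales (rule subalg_G[OF q])
  let ?c = "real_cond_exp M (G q) (indicator F)"
  have int: "integrable M (indicator F :: 'w \<Rightarrow> real)"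
    using F by (intro integrable_real_indicator) (auto simp: emeasure_eq_measure)
  have b: "AE \<omega> in M. 0 \<le> ?c \<omega>" "AE \<omega> in M. ?c \<omega> \<le> 1"
    using int by (intro G.real_cond_exp_ge_c G.real_cond_exp_le_c; auto simp: indicator_def)+
  define m where "m \<omega> = max 0 (min 1 (?c \<omega>))" for \<omega>
  have m_meas: "m \<in> borel_measurable (G q)" unfolding m_def[abs_def] by measurable
  have m_M: "m \<in> borel_measurable M" by (rule measurable_G_M[OF q m_meas])
  have "(\<integral>\<omega>. indicator A \<omega> * m \<omega> \<partial>M) = measure M (A \<inter> F)" if A: "A \<in> sets (G q)" for A
  proof -
    have AM: "A \<in> sets M" by (rule sets_G_M[OF q A])
    have "(\<integral>\<omega>. indicator A \<omega> * m \<omega> \<partial>M) = (\<integral>\<omega>. indicator A \<omega> * ?c \<omega> \<partial>M)"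
    proof (rule integral_cong_AE)
      show "(\<lambda>\<omega>. indicator A \<omega> * m \<omega>) \<in> borel_measurable M" using AM m_M by measurable
      show "(\<lambda>\<omega>. indicator A \<omega> * ?c \<omega>) \<in> borel_measurable M" using AM by measurable
      show "AE \<omega> in M. indicator A \<omega> * m \<omega> = indicator A \<omega> * ?c \<omega>"
        using b by eventually_elim (simp add: m_def)
    qed
    also have "\<dots> = (\<integral>\<omega>. indicator A \<omega> * indicator F \<omega> \<partial>M)"
      using G.real_cond_exp_intA[OF int A] by (simp add: set_lebesgue_integral_def)
    also have "\<dots> = (\<integral>\<omega>. indicator (A \<inter> F) \<omega> \<partial>M)"
      by (simp add: indicator_inter_arith)
    also have "\<dots> = measure M (A \<inter> F)" using AM F by simp
    finally show ?thesis .
  qed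
  then show ?thesis using m_meas by (intro exI[of _ m]) (auto simp: m_def)
qed

end

locale cond_prob_family = usual_filtration +
  fixes F :: "'a set" and m :: "real \<Rightarrow> 'a \<Rightarrow> real"
  assumes F: "F \<in> sets M"
    and m_meas: "0 \<le> q \<Longrightarrow> m q \<in> borel_measurable (G q)"
    and m_nonneg: "0 \<le> m q \<omega>" and m_le_1: "m q \<omega> \<le> 1"
    and m_cond: "0 \<le> q \<Longrightarrow> A \<in> sets (G q) \<Longrightarrow> (\<integral>\<omega>. indicator A \<omega> * m q \<omega> \<partial>M) = measure M (A \<inter> F)"
begin

abbreviation grid :: "nat \<Rightarrow> 'a \<Rightarrow> nat \<Rightarrow> real" where
  "grid n \<omega> \<equiv> \<lambda>i. m (real i / 2 ^ n) \<omega>"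

lemma m_measurable_M: "0 \<le> q \<Longrightarrow> m q \<in> borel_measurable M"
  by (rule measurable_G_M[OF _ m_meas])

lemma grid_meas: "i \<le> j \<Longrightarrow> (\<lambda>\<omega>. grid n \<omega> i) \<in> borel_measurable (G (real j / 2 ^ n))"
  by (rule measurable_G_mono[OF _ _ m_meas]) (auto simp: divide_right_mono)

lemma holding_meas: "i \<le> j \<Longrightarrow> Measurable.pred (G (real j / 2 ^ n)) (\<lambda>\<omega>. holding a b (grid n \<omega>) i)"
proof (induction i)
  case 0
  note grid_meas[OF 0, of n, measurable]
  show ?case unfolding holding.simps by measurable
next
  case (Suc i)
  note grid_meas[OF Suc.prems, of n, measurable]
  have [measurable]: "Measurable.pred (G (real j / 2 ^ n)) (\<lambda>\<omega>. holding a b (grid n \<omega>) i)"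
    using Suc by simp
  show ?case unfolding holding.simps by measurable
qed

lemma holding_measM[measurable]: "Measurable.pred M (\<lambda>\<omega>. holding a b (grid n \<omega>) i)"
  by (rule measurable_G_M[OF _ holding_meas[OF order_refl]]) simp

lemma crossings_meas[measurable]: "(\<lambda>\<omega>. crossings a b (grid n \<omega>) i) \<in> measurable M (count_space UNIV)"
proof (induction i)
  case (Suc i)
  note Suc.IH[measurable]
  show ?case unfolding crossings.simps
    by (intro measurable_compose_countable[where g = "\<lambda>\<omega>. crossings a b (grid n \<omega>) i" and
        f = "\<lambda>k \<omega>. k + (if holding a b (grid n \<omega>) i \<and> \<not> holding a b (grid n \<omega>) (Suc i) then 1 else 0)"]) measurable
qed simp

lemma m_integrable: "0 \<le> q \<Longrightarrow> A \<in> sets M \<Longrightarrow> integrable M (\<lambda>\<omega>. indicator A \<omega> * m q \<omega>)"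
  using m_measurable_M[of q] m_nonneg m_le_1
  by (intro integrable_const_bound[where B = 1]) (auto simp: indicator_def)

text \<open>
  The gains from trading have expectation \<open>0\<close>, because the decision to hold is known before the
  next price, and an open position loses at most \<open>\<bar>a\<bar>\<close> since prices are nonnegative.
\<close>

lemma crossings_expectation:
  assumes ab: "a < b"
  shows "(b - a) * (\<integral>\<omega>. real (crossings a b (grid n \<omega>) N) \<partial>M) \<le> \<bar>a\<bar>"
proof -
  let ?H = "\<lambda>i. {\<omega> \<in> space M. holding a b (grid n \<omega>) i}"
  let ?q = "\<lambda>i::nat. real i / 2 ^ n"
  have H: "?H i \<in> sets (G (?q i))" for i
  proof -
    have "Measurable.pred (G (?q i)) (\<lambda>\<omega>. holding a b (grid n \<omega>) i)"
      by (rule holding_meas) simp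
    then show ?thesis by (simp add: pred_def space_G)
  qed
  have HM: "?H i \<in> sets M" for i by measurable
  have le: "?q i \<le> ?q (Suc i)" for i by (intro divide_right_mono) auto
  have H': "?H i \<in> sets (G (?q (Suc i)))" for i
    by (rule sets_G_mono[OF _ le H]) simp
  have int: "integrable M (\<lambda>\<omega>. indicator (?H i) \<omega> * (grid n \<omega> (Suc i) - grid n \<omega> i))" for i
    unfolding right_diff_distrib by (intro Bochner_Integration.integrable_diff m_integrable HM) auto
  have zero: "(\<integral>\<omega>. indicator (?H i) \<omega> * (grid n \<omega> (Suc i) - grid n \<omega> i) \<partial>M) = 0" for i
  proof -
    have "(\<integral>\<omega>. indicator (?H i) \<omega> * (grid n \<omega> (Suc i) - grid n \<omega> i) \<partial>M) =
      (\<integral>\<omega>. indicator (?H i) \<omega> * grid n \<omega> (Suc i) \<partial>M) - (\<integral>\<omega>. indicator (?H i) \<omega> * grid n \<omega> i \<partial>M)"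
      unfolding right_diff_distrib by (intro Bochner_Integration.integral_diff m_integrable HM) auto
    also have "\<dots> = measure M (?H i \<inter> F) - measure M (?H i \<inter> F)"
      using m_cond[OF _ H'] m_cond[OF _ H] by simp
    finally show ?thesis by simp
  qed
  have bnd: "(b - a) * real (crossings a b (grid n \<omega>) N) \<le>
     (\<Sum>i<N. indicator (?H i) \<omega> * (grid n \<omega> (Suc i) - grid n \<omega> i)) + \<bar>a\<bar>" if "\<omega> \<in> space M" for \<omega>
  proof -
    have "(if holding a b (grid n \<omega>) N then a - grid n \<omega> N else 0) \<le> \<bar>a\<bar>"
      using m_nonneg[of "real N / 2 ^ n" \<omega>] by auto
    moreover have "(of_bool (holding a b (grid n \<omega>) i) :: real) = indicator (?H i) \<omega>" for i
      using that by (auto simp: indicator_def)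
    ultimately show ?thesis using crossings_gain[OF ab, of "grid n \<omega>" N] by simp
  qed
  have "(\<integral>\<omega>. (b - a) * real (crossings a b (grid n \<omega>) N) \<partial>M) \<le>
     (\<integral>\<omega>. (\<Sum>i<N. indicator (?H i) \<omega> * (grid n \<omega> (Suc i) - grid n \<omega> i)) + \<bar>a\<bar> \<partial>M)"
  proof (rule integral_mono')
    show "integrable M (\<lambda>\<omega>. (\<Sum>i<N. indicator (?H i) \<omega> * (grid n \<omega> (Suc i) - grid n \<omega> i)) + \<bar>a\<bar>)"
      using int by (intro Bochner_Integration.integrable_add Bochner_Integration.integrable_sum integrable_const)
    show "0 \<le> (\<Sum>i<N. indicator (?H i) \<omega> * (grid n \<omega> (Suc i) - grid n \<omega> i)) + \<bar>a\<bar>" if "\<omega> \<in> space M" for \<omega>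
      using bnd[OF that] ab by (intro order_trans[OF _ bnd[OF that]]) auto
  qed (use bnd in auto)
  also have "\<dots> = (\<integral>\<omega>. (\<Sum>i<N. indicator (?H i) \<omega> * (grid n \<omega> (Suc i) - grid n \<omega> i)) \<partial>M) + (\<integral>\<omega>. \<bar>a\<bar> \<partial>M)"
    using int by (intro Bochner_Integration.integral_add Bochner_Integration.integrable_sum integrable_const)
  also have "(\<integral>\<omega>. (\<Sum>i<N. indicator (?H i) \<omega> * (grid n \<omega> (Suc i) - grid n \<omega> i)) \<partial>M) = 0"
    using int zero by (subst Bochner_Integration.integral_sum) auto
  also have "0 + (\<integral>\<omega>. \<bar>a\<bar> \<partial>M) = \<bar>a\<bar>" by (simp add: prob_space)
  finally show ?thesis by simp
qed

lemma crossings_le: "crossings a b y N \<le> N"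
  by (induction N) auto

lemma crossings_prob:
  assumes ab: "a < b"
  shows "real k * (b - a) * measure M {\<omega> \<in> space M. k \<le> crossings a b (grid n \<omega>) N} \<le> \<bar>a\<bar>"
proof -
  let ?E = "{\<omega> \<in> space M. k \<le> crossings a b (grid n \<omega>) N}"
  have E: "?E \<in> sets M" by measurable
  have "real k * measure M ?E = (\<integral>\<omega>. real k * indicator ?E \<omega> \<partial>M)" using E by simp
  also have "\<dots> \<le> (\<integral>\<omega>. real (crossings a b (grid n \<omega>) N) \<partial>M)"
  proof (rule integral_mono)
    show "integrable M (\<lambda>\<omega>. real k * indicator ?E \<omega>)"
      using E by (intro integrable_mult_right integrable_real_indicator) (auto simp: emeasure_eq_measure)
    show "integrable M (\<lambda>\<omega>. real (crossings a b (grid n \<omega>) N))"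
      by (rule integrable_const_bound[where B = "real N"]) (auto simp: crossings_le)
  qed (auto simp: indicator_def)
  finally have "(b - a) * (real k * measure M ?E) \<le> (b - a) * (\<integral>\<omega>. real (crossings a b (grid n \<omega>) N) \<partial>M)"
    using ab by (intro mult_left_mono) auto
  then show ?thesis using crossings_expectation[OF ab, of n N] by (simp add: mult.assoc mult.left_commute)
qed

text \<open>
  The bound from Markov's inequality is independent of the grid. Requiring the \<open>k\<close> crossings on all
  sufficiently fine grids therefore leaves an event of probability of order \<open>1/k\<close>. The grid of level
  \<open>n\<close> is followed up to time \<open>n\<close>, so that every bounded interval is eventually covered.
\<close>

lemma oscillating_null:
  assumes ab: "a < b"
  shows "{\<omega> \<in> space M. \<forall>k. \<exists>n0. \<forall>n\<ge>n0. k \<le> crossings a b (grid n \<omega>) (n * 2 ^ n)} \<in> null_sets M" (is "?B \<in> _")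
proof -
  let ?E = "\<lambda>k n. {\<omega> \<in> space M. k \<le> crossings a b (grid n \<omega>) (n * 2 ^ n)}"
  have E: "?E k n \<in> sets M" for k n by measurable
  have B: "?B \<in> sets M" by measurable
  have "real k * (b - a) * measure M ?B \<le> \<bar>a\<bar>" for k
  proof -
    let ?L = "\<lambda>n0. (\<Inter>n\<in>{n0..}. ?E k n)"
    have L: "?L n0 \<in> sets M" for n0 using E by (intro sets.countable_INT') auto
    have "(\<lambda>n0. measure M (?L n0)) \<longlonglongrightarrow> measure M (\<Union>n0. ?L n0)"
      using L by (intro finite_Lim_measure_incseq) (auto simp: incseq_def)
    then have "(\<lambda>n0. real k * (b - a) * measure M (?L n0)) \<longlonglongrightarrow> real k * (b - a) * measure M (\<Union>n0. ?L n0)"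
      by (intro tendsto_intros)
    moreover have "real k * (b - a) * measure M (?L n0) \<le> \<bar>a\<bar>" for n0
    proof -
      have "measure M (?L n0) \<le> measure M (?E k n0)" by (rule finite_measure_mono[OF _ E]) auto
      then have "real k * (b - a) * measure M (?L n0) \<le> real k * (b - a) * measure M (?E k n0)"
        using ab by (intro mult_left_mono) auto
      then show ?thesis using crossings_prob[OF ab, of k n0 "n0 * 2 ^ n0"] by linarith
    qed
    ultimately have "real k * (b - a) * measure M (\<Union>n0. ?L n0) \<le> \<bar>a\<bar>"
      by (intro LIMSEQ_le_const2) auto
    moreover have "measure M ?B \<le> measure M (\<Union>n0. ?L n0)"
    proof (rule finite_measure_mono)
      show "(\<Union>n0. ?L n0) \<in> sets M" using L by (intro sets.countable_UN) auto
      show "?B \<subseteq> (\<Union>n0. ?L n0)" by fastforce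
    qed
    then have "real k * (b - a) * measure M ?B \<le> real k * (b - a) * measure M (\<Union>n0. ?L n0)"
      using ab by (intro mult_left_mono) auto
    ultimately show ?thesis by linarith
  qed
  then have *: "real k * ((b - a) * measure M ?B) \<le> \<bar>a\<bar>" for k by (simp add: mult.assoc)
  have "(b - a) * measure M ?B \<le> 0"
  proof (rule ccontr)
    assume "\<not> ?thesis"
    then obtain k where "\<bar>a\<bar> < real k * ((b - a) * measure M ?B)"
      using reals_Archimedean3[of "(b - a) * measure M ?B"] by auto
    then show False using *[of k] by simp
  qed
  then have "measure M ?B = 0" using ab measure_nonneg[of M ?B] by (smt (verit) mult_pos_pos)
  then show ?thesis using B by (intro null_setsI) (auto simp: emeasure_eq_measure)
qed

definition oscillating :: "'a set" where
  "oscillating = (\<Union>a\<in>\<rat>. \<Union>b\<in>\<rat> \<inter> {a<..}. {\<omega> \<in> space M. \<forall>k. \<exists>n0. \<forall>n\<ge>n0. k \<le> crossings a b (grid n \<omega>) (n * 2 ^ n)})"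

lemma oscillating_set_null: "oscillating \<in> null_sets M"
  unfolding oscillating_def
proof (intro null_sets_UN')
  show "countable (\<rat> :: real set)" by (rule countable_rat)
  show "countable (\<rat> \<inter> {a<..})" for a :: real using countable_rat by (rule countable_subset[rotated]) auto
qed (auto intro: oscillating_null)

lemma nonoscillating_off_null:
  assumes \<omega>: "\<omega> \<in> space M" "\<omega> \<notin> oscillating"
  shows "nonoscillating (\<lambda>q. m q \<omega>)"
  unfolding nonoscillating_def
proof (intro ballI impI allI)
  fix a b v :: real assume ab: "a \<in> \<rat>" "b \<in> \<rat>" "a < b"
  then have "\<not> (\<forall>k. \<exists>n0. \<forall>n\<ge>n0. k \<le> crossings a b (grid n \<omega>) (n * 2 ^ n))"
    using \<omega> unfolding oscillating_def by blast
  then obtain k where k: "\<And>n0. \<exists>n\<ge>n0. \<not> k \<le> crossings a b (grid n \<omega>) (n * 2 ^ n)" by blast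
  \<comment> \<open>The comparison with grids starts at time \<open>0\<close> and needs an end point that is not negative.\<close>
  define v' where "v' = max 0 v"
  have "\<not> upcrosses (\<lambda>q. m q \<omega>) a b k 0 v'"
  proof
    assume "upcrosses (\<lambda>q. m q \<omega>) a b k 0 v'"
    from upcrosses_crossings[OF ab(3) this] obtain n0 where n0: "\<And>n i N. n0 \<le> n \<Longrightarrow> real i / 2 ^ n \<le> 0 \<Longrightarrow>
      v' \<le> real N / 2 ^ n \<Longrightarrow> crossings a b (grid n \<omega>) i + k \<le> crossings a b (grid n \<omega>) N"
      by (auto simp: v'_def)
    obtain n1 :: nat where n1: "v' \<le> real n1" using real_arch_simple by blast
    obtain n where n: "max n0 n1 \<le> n" "\<not> k \<le> crossings a b (grid n \<omega>) (n * 2 ^ n)" using k by blast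
    have "v' \<le> real n" using n1 n by simp
    then have "v' \<le> real (n * 2 ^ n) / 2 ^ n" by simp
    then show False using n0[of n 0 "n * 2 ^ n"] n by simp
  qed
  moreover have "upcrosses f a b k u v \<Longrightarrow> upcrosses f a b k u v'" for f k u
  proof (induction k arbitrary: u)
    case (Suc k)
    then show ?case unfolding v'_def upcrosses.simps by (meson less_max_iff_disj)
  qed simp
  ultimately show "\<exists>k. \<not> upcrosses (\<lambda>q. m q \<omega>) a b k 0 v" by blast
qed

text \<open>
  The value \<open>0\<close> on the exceptional null set keeps every path cadlag, as the definition of the optional
  sets demands, and not only almost every path.
\<close>

definition cadlag_version :: "real \<Rightarrow> 'a \<Rightarrow> real" where
  "cadlag_version t \<omega> = (if \<omega> \<in> space M - oscillating \<and> 0 \<le> t then right_lim (\<lambda>q. m q \<omega>) t else 0)"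

lemma cadlag_version_bounds: "0 \<le> cadlag_version t \<omega>" "cadlag_version t \<omega> \<le> 1"
  using right_lim_bounds[OF nonoscillating_off_null m_nonneg m_le_1] by (auto simp: cadlag_version_def)

lemma cadlag_version_lim: "\<omega> \<in> space M - oscillating \<Longrightarrow> 0 \<le> t \<Longrightarrow> (\<lambda>n. m (dyadic_above n t) \<omega>) \<longlonglongrightarrow> cadlag_version t \<omega>"
  using right_lim_seq[OF nonoscillating_off_null m_nonneg m_le_1] by (auto simp: cadlag_version_def)

lemma cadlag_version_cadlag: "cadlag_adapted G cadlag_version"
  unfolding cadlag_adapted_def
proof (intro conjI allI impI ballI)
  fix t :: real assume t: "0 \<le> t"
  show "cadlag_version t \<in> borel_measurable (G t)"
  proof (rule measurable_G_rightI[OF t])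
    fix s assume s: "t < s"
    then obtain n0 where n0: "\<And>n. n0 \<le> n \<Longrightarrow> dyadic_above n t < s"
      using dyadic_above_less[OF t s] by (auto simp: eventually_sequentially)
    let ?f = "\<lambda>n \<omega>. indicator (space M - oscillating) \<omega> * m (dyadic_above (n0 + n) t) \<omega>"
    show "cadlag_version t \<in> borel_measurable (G s)"
    proof (rule borel_measurable_LIMSEQ_real)
      fix n
      have "m (dyadic_above (n0 + n) t) \<in> borel_measurable (G s)"
        using dyadic_above_greater[OF t, of "n0 + n"] n0[of "n0 + n"] t
        by (intro measurable_G_mono[OF _ _ m_meas]) auto
      moreover have "space M - oscillating \<in> sets (G s)"
        using space_in_G[of s] null_G[OF oscillating_set_null, of s] s t by (intro sets.Diff) auto
      ultimately show "?f n \<in> borel_measurable (G s)" by measurable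
    next
      fix \<omega> assume "\<omega> \<in> space (G s)"
      then have \<omega>: "\<omega> \<in> space M" using s t by (simp add: space_G)
      show "(\<lambda>n. ?f n \<omega>) \<longlonglongrightarrow> cadlag_version t \<omega>"
      proof (cases "\<omega> \<in> oscillating")
        case False
        then have "(\<lambda>n. m (dyadic_above (n + n0) t) \<omega>) \<longlonglongrightarrow> cadlag_version t \<omega>"
          using cadlag_version_lim[of \<omega> t] \<omega> t by (intro LIMSEQ_ignore_initial_segment) auto
        then show ?thesis using False \<omega> by (simp add: add.commute)
      qed (simp add: cadlag_version_def)
    qed
  qed
next
  fix \<omega> and t :: real assume \<omega>: "\<omega> \<in> space (G 0)" and t: "0 \<le> t"
  show "((\<lambda>s. cadlag_version s \<omega>) \<longlongrightarrow> cadlag_version t \<omega>) (at_right t)"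
  proof (cases "\<omega> \<in> oscillating")
    case False
    then have \<omega>': "\<omega> \<in> space M" "\<omega> \<notin> oscillating" using \<omega> by (auto simp: space_G)
    have "((\<lambda>s. right_lim (\<lambda>q. m q \<omega>) s) \<longlongrightarrow> cadlag_version t \<omega>) (at_right t)"
      using right_lim_right[OF nonoscillating_off_null[OF \<omega>'] m_nonneg m_le_1 t] \<omega>' t by (simp add: cadlag_version_def)
    moreover have "\<forall>\<^sub>F s in at_right t. right_lim (\<lambda>q. m q \<omega>) s = cadlag_version s \<omega>"
      using \<omega>' t by (auto simp: cadlag_version_def eventually_at_right_field intro!: exI[of _ "t + 1"])
    ultimately show ?thesis by (rule Lim_transform_eventually)
  qed (simp add: cadlag_version_def)
next
  fix \<omega> and t :: real assume \<omega>: "\<omega> \<in> space (G 0)" and t: "0 < t"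
  show "\<exists>l. ((\<lambda>s. cadlag_version s \<omega>) \<longlongrightarrow> l) (at_left t)"
  proof (cases "\<omega> \<in> oscillating")
    case False
    then have \<omega>': "\<omega> \<in> space M" "\<omega> \<notin> oscillating" using \<omega> by (auto simp: space_G)
    obtain l where "((\<lambda>s. right_lim (\<lambda>q. m q \<omega>) s) \<longlongrightarrow> l) (at_left t)"
      using right_lim_left[OF nonoscillating_off_null[OF \<omega>'] m_nonneg m_le_1 t] by blast
    moreover have "\<forall>\<^sub>F s in at_left t. right_lim (\<lambda>q. m q \<omega>) s = cadlag_version s \<omega>"
      using \<omega>' t by (auto simp: cadlag_version_def eventually_at_left_field intro!: exI[of _ 0])
    ultimately show ?thesis by (blast intro: Lim_transform_eventually)
  qed (auto simp: cadlag_version_def)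
qed

text \<open>
  The event that \<open>T\<close> lies in the grid cell with right end \<open>(k + 1) / 2 ^ n\<close> is known at that end,
  where \<open>m\<close> is the conditional probability of \<open>F\<close>; the cells are summed up.
\<close>

lemma dyadic_above_expectation:
  assumes T: "stopping T"
  shows "(\<integral>\<^sup>+\<omega>. ennreal (m (dyadic_above n (enn2real (T \<omega>))) \<omega>) * indicator {\<omega>\<in>space M. T \<omega> < \<infinity>} \<omega> \<partial>M) =
    emeasure M (F \<inter> {\<omega> \<in> space M. T \<omega> < \<infinity>})"
proof -
  note stopping_measurable[OF T, measurable]
  let ?u = "\<lambda>k::nat. (real k + 1) / 2 ^ n"
  define S where "S k = {\<omega> \<in> space M. T \<omega> < \<infinity> \<and> nat \<lfloor>2 ^ n * enn2real (T \<omega>)\<rfloor> = k}" for k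
  have u0: "0 \<le> ?u k" for k by simp
  have SG: "S k \<in> sets (G (?u k))" for k
  proof -
    let ?c = "\<lambda>\<omega>. enn2real (min (T \<omega>) (ennreal (?u k)))"
    have eq: "T \<omega> < \<infinity> \<and> nat \<lfloor>2 ^ n * enn2real (T \<omega>)\<rfloor> = k \<longleftrightarrow> nat \<lfloor>2 ^ n * ?c \<omega>\<rfloor> = k" for \<omega>
    proof (cases "T \<omega> < ennreal (?u k)")
      case True
      then have "T \<omega> < \<infinity>" by (rule less_trans) simp
      then show ?thesis using True by (simp add: min_def less_imp_le)
    next
      case False
      then have ge: "ennreal (?u k) \<le> T \<omega>" by simp
      then have c: "?c \<omega> = ?u k" by (simp add: min_absorb2)
      have "2 ^ n * ?u k = real (Suc k)" by simp
      then have "nat \<lfloor>2 ^ n * ?c \<omega>\<rfloor> = Suc k" unfolding c by (metis floor_of_nat nat_int)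
      moreover have "nat \<lfloor>2 ^ n * enn2real (T \<omega>)\<rfloor> \<noteq> k" if "T \<omega> < \<infinity>"
      proof -
        have "?u k \<le> enn2real (T \<omega>)" using enn2real_mono[OF ge] that by simp
        then have "2 ^ n * ?u k \<le> 2 ^ n * enn2real (T \<omega>)" by (intro mult_left_mono) auto
        then have "real (Suc k) \<le> 2 ^ n * enn2real (T \<omega>)" by simp
        then show ?thesis by linarith
      qed
      ultimately show ?thesis by auto
    qed
    have "S k = {\<omega> \<in> space (G (?u k)). nat \<lfloor>2 ^ n * ?c \<omega>\<rfloor> = k}"
      using eq by (simp add: S_def space_G)
    also have "\<dots> \<in> sets (G (?u k))"
      using stopping_min_measurable[OF T u0, of k] by measurable
    finally show ?thesis .
  qed
  have SM: "S k \<in> sets M" for k by (rule sets_G_M[OF u0 SG])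
  have disj: "disjoint_family S" by (auto simp: disjoint_family_on_def S_def)
  have UN: "(\<Union>k. S k) = {\<omega> \<in> space M. T \<omega> < \<infinity>}" by (auto simp: S_def)
  have pw: "ennreal (m (dyadic_above n (enn2real (T \<omega>))) \<omega>) * indicator {\<omega>\<in>space M. T \<omega> < \<infinity>} \<omega> =
     (\<Sum>k. ennreal (m (?u k) \<omega>) * indicator (S k) \<omega>)" for \<omega>
  proof (cases "\<omega> \<in> (\<Union>k. S k)")
    case True
    then obtain k where k: "\<omega> \<in> S k" by blast
    have "(\<Sum>k. ennreal (m (?u k) \<omega>) * indicator (S k) \<omega>) = ennreal (m (?u k) \<omega>)"
      by (rule suminf_cmult_indicator[OF disj k])
    moreover have "dyadic_above n (enn2real (T \<omega>)) = ?u k"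
      using k by (simp add: S_def dyadic_above_def)
    ultimately show ?thesis using True unfolding UN by simp
  next
    case False
    then show ?thesis unfolding UN[symmetric] by simp
  qed
  have "(\<integral>\<^sup>+\<omega>. ennreal (m (dyadic_above n (enn2real (T \<omega>))) \<omega>) * indicator {\<omega>\<in>space M. T \<omega> < \<infinity>} \<omega> \<partial>M) =
     (\<Sum>k. \<integral>\<^sup>+\<omega>. ennreal (m (?u k) \<omega>) * indicator (S k) \<omega> \<partial>M)"
    unfolding pw
  proof (rule nn_integral_suminf)
    fix k
    note m_measurable_M[OF u0[of k], measurable] SM[of k, measurable]
    show "(\<lambda>\<omega>. ennreal (m (?u k) \<omega>) * indicator (S k) \<omega>) \<in> borel_measurable M" by measurable
  qed
  also have "\<dots> = (\<Sum>k. emeasure M (F \<inter> S k))"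
  proof (intro suminf_cong)
    fix k
    have "(\<integral>\<^sup>+\<omega>. ennreal (m (?u k) \<omega>) * indicator (S k) \<omega> \<partial>M) = (\<integral>\<^sup>+\<omega>. ennreal (indicator (S k) \<omega> * m (?u k) \<omega>) \<partial>M)"
      by (intro nn_integral_cong) (auto simp: indicator_def)
    also have "\<dots> = ennreal (\<integral>\<omega>. indicator (S k) \<omega> * m (?u k) \<omega> \<partial>M)"
      using m_nonneg by (intro nn_integral_eq_integral m_integrable u0 SM) auto
    also have "\<dots> = emeasure M (F \<inter> S k)"
      using m_cond[OF u0 SG] by (simp add: emeasure_eq_measure Int_commute)
    finally show "(\<integral>\<^sup>+\<omega>. ennreal (m (?u k) \<omega>) * indicator (S k) \<omega> \<partial>M) = emeasure M (F \<inter> S k)" .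
  qed
  also have "\<dots> = emeasure M (\<Union>k. F \<inter> S k)"
    using F SM disj by (intro suminf_emeasure) (auto simp: disjoint_family_on_def)
  also have "(\<Union>k. F \<inter> S k) = F \<inter> {\<omega> \<in> space M. T \<omega> < \<infinity>}" using UN by blast
  finally show ?thesis .
qed

text \<open>
  Along the dyadic approximations from above the expectation does not change, and they converge to
  the cadlag version because it is a right limit.
\<close>

lemma cadlag_version_expectation:
  assumes T: "stopping T"
  shows "(\<integral>\<omega>. cadlag_version (enn2real (T \<omega>)) \<omega> * indicator {\<omega>. T \<omega> < \<infinity>} \<omega> \<partial>M) = measure M (F \<inter> {\<omega> \<in> space M. T \<omega> < \<infinity>})"
proof -
  note stopping_measurable[OF T, measurable]
  let ?I = "indicator {\<omega>\<in>space M. T \<omega> < \<infinity>} :: 'a \<Rightarrow> real"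
  let ?g = "\<lambda>n \<omega>. m (dyadic_above n (enn2real (T \<omega>))) \<omega>"
  let ?f = "\<lambda>n \<omega>. ?g n \<omega> * ?I \<omega>"
  have I: "{\<omega>\<in>space M. T \<omega> < \<infinity>} \<in> sets M" by measurable
  have g_meas: "?g n \<in> borel_measurable M" for n
  proof -
    have "(\<lambda>\<omega>. (\<lambda>k \<omega>. m ((real k + 1) / 2 ^ n) \<omega>) (nat \<lfloor>2 ^ n * enn2real (T \<omega>)\<rfloor>) \<omega>) \<in> borel_measurable M"
      by (rule measurable_compose_countable[where f = "\<lambda>k \<omega>. m ((real k + 1) / 2 ^ n) \<omega>"])
        (auto intro!: m_measurable_M)
    then show ?thesis by (simp add: dyadic_above_def)
  qed
  have f_meas: "?f n \<in> borel_measurable M" for n using g_meas[of n] I by measurable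
  have cadlag_version_meas: "(\<lambda>\<omega>. cadlag_version (enn2real (T \<omega>)) \<omega>) \<in> borel_measurable M"
    using measurable_compose[OF optional_at_stopping[OF T] cadlag_optional[OF cadlag_version_cadlag]] by simp
  have f_bnd: "\<bar>?f n \<omega>\<bar> \<le> 1" "0 \<le> ?f n \<omega>" for n \<omega> using m_nonneg m_le_1 by (auto simp: indicator_def)
  have "(\<lambda>n. \<integral>\<omega>. ?f n \<omega> \<partial>M) \<longlonglongrightarrow> (\<integral>\<omega>. cadlag_version (enn2real (T \<omega>)) \<omega> * ?I \<omega> \<partial>M)"
  proof (rule integral_dominated_convergence[where w = "\<lambda>_. 1"])
    show "(\<lambda>\<omega>. cadlag_version (enn2real (T \<omega>)) \<omega> * ?I \<omega>) \<in> borel_measurable M" using cadlag_version_meas I by measurable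
    show "AE \<omega> in M. (\<lambda>n. ?f n \<omega>) \<longlonglongrightarrow> cadlag_version (enn2real (T \<omega>)) \<omega> * ?I \<omega>"
      using AE_not_in[OF oscillating_set_null] AE_space
      by eventually_elim (intro tendsto_intros cadlag_version_lim, auto)
  qed (use f_meas f_bnd in auto)
  moreover have "(\<integral>\<omega>. ?f n \<omega> \<partial>M) = measure M (F \<inter> {\<omega> \<in> space M. T \<omega> < \<infinity>})" for n
  proof -
    have "(\<integral>\<omega>. ?f n \<omega> \<partial>M) = enn2real (\<integral>\<^sup>+\<omega>. ennreal (?f n \<omega>) \<partial>M)"
      using f_meas f_bnd by (intro integral_eq_nn_integral) auto
    also have "(\<integral>\<^sup>+\<omega>. ennreal (?f n \<omega>) \<partial>M) = emeasure M (F \<inter> {\<omega> \<in> space M. T \<omega> < \<infinity>})"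
      unfolding dyadic_above_expectation[OF T, of n, symmetric]
      by (intro nn_integral_cong) (auto simp: indicator_def)
    finally show ?thesis by (simp add: measure_def)
  qed
  ultimately have "(\<integral>\<omega>. cadlag_version (enn2real (T \<omega>)) \<omega> * ?I \<omega> \<partial>M) = measure M (F \<inter> {\<omega> \<in> space M. T \<omega> < \<infinity>})"
    by (simp add: LIMSEQ_const_iff)
  moreover have "(\<integral>\<omega>. cadlag_version (enn2real (T \<omega>)) \<omega> * ?I \<omega> \<partial>M) = (\<integral>\<omega>. cadlag_version (enn2real (T \<omega>)) \<omega> * indicator {\<omega>. T \<omega> < \<infinity>} \<omega> \<partial>M)"
    by (intro Bochner_Integration.integral_cong) (auto simp: indicator_def)
  ultimately show ?thesis by simp
qed

end

context usual_filtration
begin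

theorem cadlag_cond_prob:
  assumes F: "F \<in> sets M"
  shows "\<exists>N. cadlag_adapted G N \<and> (\<forall>t \<omega>. 0 \<le> N t \<omega> \<and> N t \<omega> \<le> 1) \<and>
    (\<forall>T. stopping T \<longrightarrow> (\<integral>\<omega>. N (enn2real (T \<omega>)) \<omega> * indicator {\<omega>. T \<omega> < \<infinity>} \<omega> \<partial>M) =
      measure M (F \<inter> {\<omega> \<in> space M. T \<omega> < \<infinity>}))"
proof -
  have "\<forall>q. \<exists>m. (\<forall>\<omega>. 0 \<le> m \<omega> \<and> m \<omega> \<le> 1) \<and> (0 \<le> q \<longrightarrow> m \<in> borel_measurable (G q) \<and>
    (\<forall>A\<in>sets (G q). (\<integral>\<omega>. indicator A \<omega> * m \<omega> \<partial>M) = measure M (A \<inter> F)))"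
  proof
    fix q :: real
    show "\<exists>m. (\<forall>\<omega>. 0 \<le> m \<omega> \<and> m \<omega> \<le> 1) \<and> (0 \<le> q \<longrightarrow> m \<in> borel_measurable (G q) \<and>
      (\<forall>A\<in>sets (G q). (\<integral>\<omega>. indicator A \<omega> * m \<omega> \<partial>M) = measure M (A \<inter> F)))"
    proof (cases "0 \<le> q")
      case True
      then show ?thesis using cond_prob_version[OF F True] by blast
    next
      case False
      then show ?thesis by (intro exI[of _ "\<lambda>_. 0"]) auto
    qed
  qed
  then obtain m where m: "\<And>q \<omega>. 0 \<le> m q \<omega> \<and> m q \<omega> \<le> 1"
    "\<And>q. 0 \<le> q \<Longrightarrow> m q \<in> borel_measurable (G q) \<and>
    (\<forall>A\<in>sets (G q). (\<integral>\<omega>. indicator A \<omega> * m q \<omega> \<partial>M) = measure M (A \<inter> F))" by metis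
  interpret cond_prob_family M G F m
    by unfold_locales (use m F in auto)
  show ?thesis using cadlag_version_cadlag cadlag_version_bounds cadlag_version_expectation by (intro exI[of _ cadlag_version]) blast
qed

end

section \<open>Optional projections of measurable sets\<close>

context usual_filtration
begin

abbreviation optional_process :: "(real \<Rightarrow> 'w \<Rightarrow> real) \<Rightarrow> bool" where
  "optional_process Z \<equiv> case_prod Z \<in> borel_measurable (optional_algebra G)"

text \<open>
  The value at \<open>T\<close> on \<open>{T < \<infinity>}\<close>, and \<open>0\<close> elsewhere; where \<open>T = \<infinity>\<close> the time argument
  \<open>enn2real \<infinity> = 0\<close> is masked by the indicator.
\<close>

abbreviation stopped :: "(real \<Rightarrow> 'w \<Rightarrow> real) \<Rightarrow> ('w \<Rightarrow> ennreal) \<Rightarrow> 'w \<Rightarrow> real" where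
  "stopped Z T \<equiv> \<lambda>\<omega>. Z (enn2real (T \<omega>)) \<omega> * indicator {\<omega>. T \<omega> < \<infinity>} \<omega>"

lemma finite_set_measurable: "stopping T \<Longrightarrow> {\<omega> \<in> space M. T \<omega> < \<infinity>} \<in> sets M"
proof -
  assume T: "stopping T"
  note stopping_measurable[OF T, measurable]
  show ?thesis by measurable
qed

lemma stopped_measurable:
  assumes Z: "optional_process Z" and T: "stopping T"
  shows "stopped Z T \<in> borel_measurable M"
proof -
  note stopping_measurable[OF T, measurable]
  have [measurable]: "(\<lambda>\<omega>. Z (enn2real (T \<omega>)) \<omega>) \<in> borel_measurable M"
    using measurable_compose[OF optional_at_stopping[OF T] Z] by simp
  have "(\<lambda>\<omega>. Z (enn2real (T \<omega>)) \<omega> * (if T \<omega> < \<infinity> then 1 else 0)) \<in> borel_measurable M" by measurable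
  then show ?thesis by (simp add: indicator_def[abs_def])
qed

lemma stopped_integrable:
  assumes Z: "optional_process Z" and T: "stopping T" and b: "\<And>t \<omega>. \<bar>Z t \<omega>\<bar> \<le> b"
  shows "integrable M (stopped Z T)"
proof (rule integrable_const_bound[where B = b])
  have "0 \<le> b" using order_trans[OF abs_ge_zero b] .
  then show "AE \<omega> in M. norm (stopped Z T \<omega>) \<le> b"
    using b by (auto simp: indicator_def)
qed (rule stopped_measurable[OF Z T])

lemma optional_const: "A \<in> sets (G 0) \<Longrightarrow> optional_process (\<lambda>t. indicator A)"
proof (rule cadlag_optional)
  assume A: "A \<in> sets (G 0)"
  show "cadlag_adapted G (\<lambda>t. indicator A)"
    unfolding cadlag_adapted_def
  proof (intro conjI allI impI ballI)
    fix t :: real assume t: "0 \<le> t"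
    have "A \<in> sets (G t)" by (rule sets_G_mono[OF _ t A]) simp
    then show "(indicator A :: 'w \<Rightarrow> real) \<in> borel_measurable (G t)" by measurable
  qed (auto intro: exI)
qed

lemma optional_time:
  fixes c :: "real \<Rightarrow> real"
  assumes c: "c \<in> borel_measurable borel"
  shows "optional_process (\<lambda>t \<omega>. c t)"
proof -
  have "optional_process (\<lambda>t \<omega>. t)"
    by (rule cadlag_optional) (auto simp: cadlag_adapted_def intro: exI tendsto_ident_at)
  from measurable_compose[OF this c] show ?thesis by (simp add: split_beta')
qed

text \<open>
  Postponing a stopping time to \<open>\<infinity>\<close> where it does not meet \<open>{Z' < Z}\<close> gives a stopping time at
  which \<open>Z - Z'\<close> is nonnegative; its expectation is at most \<open>0\<close>, so \<open>{Z' < Z}\<close> is met with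
  probability \<open>0\<close> only.
\<close>

theorem optional_le:
  assumes Z: "optional_process Z" and Z': "optional_process Z'"
    and int: "\<And>T. stopping T \<Longrightarrow> integrable M (stopped Z T)" "\<And>T. stopping T \<Longrightarrow> integrable M (stopped Z' T)"
    and le: "\<And>T. stopping T \<Longrightarrow> (\<integral>\<omega>. stopped Z T \<omega> \<partial>M) \<le> (\<integral>\<omega>. stopped Z' T \<omega> \<partial>M)"
  shows "AE \<omega> in M. \<forall>t\<ge>0. Z t \<omega> \<le> Z' t \<omega>"
proof -
  define A where "A = {x \<in> space (optional_algebra G). case_prod Z' x < case_prod Z x}"
  have A: "A \<in> sets (optional_algebra G)" unfolding A_def using Z Z' by measurable
  have "AE \<omega> in M. \<forall>t. (t, \<omega>) \<notin> A"
  proof (rule optional_cross_section[OF A])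
    fix T assume T: "stopping T"
    \<comment> \<open>\<open>T\<close> is kept only where it meets \<open>A\<close>.\<close>
    define T' where "T' \<omega> = (if \<omega> \<in> {\<omega>. (enn2real (T \<omega>), \<omega>) \<in> A} then T \<omega> else \<infinity>)" for \<omega>
    have T': "stopping T'" unfolding T'_def
      by (rule stopping_restrict[OF T]) (use optional_at_stopping_adapted[OF T A] in simp)
    let ?d = "\<lambda>\<omega>. stopped Z T' \<omega> - stopped Z' T' \<omega>"
    have d: "integrable M ?d" by (intro Bochner_Integration.integrable_diff int T')
    have nn: "0 \<le> ?d \<omega>" for \<omega>
      by (auto simp: T'_def A_def indicator_def)
    have "(\<integral>\<omega>. ?d \<omega> \<partial>M) \<le> 0"
      using le[OF T'] Bochner_Integration.integral_diff[OF int(1)[OF T'] int(2)[OF T']] by simp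
    moreover have "0 \<le> (\<integral>\<omega>. ?d \<omega> \<partial>M)" by (intro Bochner_Integration.integral_nonneg nn)
    ultimately have "AE \<omega> in M. ?d \<omega> = 0"
      using integral_nonneg_eq_0_iff_AE[OF d] nn by simp
    then show "AE \<omega> in M. T \<omega> < \<infinity> \<longrightarrow> (enn2real (T \<omega>), \<omega>) \<notin> A"
    proof eventually_elim
      case (elim \<omega>)
      show ?case
      proof (intro impI notI)
        assume fin: "T \<omega> < \<infinity>" and inA: "(enn2real (T \<omega>), \<omega>) \<in> A"
        then have "T' \<omega> = T \<omega>" by (simp add: T'_def)
        then show False using elim fin inA by (simp add: A_def)
      qed
    qed
  qed
  then show ?thesis using AE_space
  proof eventually_elim
    case (elim \<omega>)
    show ?case
    proof (intro allI impI)
      fix t :: real assume "0 \<le> t"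
      then have "(t, \<omega>) \<in> space (optional_algebra G)" using elim by (simp add: space_optional)
      then show "Z t \<omega> \<le> Z' t \<omega>" using elim(1) by (fastforce simp: A_def)
    qed
  qed
qed

text \<open>
  The optional projection of the indicator of \<open>B\<close>, expressed without conditional expectations: it
  suffices to compare expectations at all stopping times, see \<open>stopping_restrict\<close>.
\<close>

definition projects_set :: "(real \<times> 'w) set \<Rightarrow> (real \<Rightarrow> 'w \<Rightarrow> real) \<Rightarrow> bool" where
  "projects_set B Z \<longleftrightarrow> optional_process Z \<and> (\<forall>t \<omega>. 0 \<le> Z t \<omega> \<and> Z t \<omega> \<le> 1) \<and>
     (\<forall>T. stopping T \<longrightarrow> (\<integral>\<omega>. stopped Z T \<omega> \<partial>M) =
        measure M {\<omega> \<in> space M. T \<omega> < \<infinity> \<and> (enn2real (T \<omega>), \<omega>) \<in> B})"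

lemma stopped_event_measurable:
  assumes T: "stopping T" and B: "B \<in> sets (borel \<Otimes>\<^sub>M M)"
  shows "{\<omega> \<in> space M. T \<omega> < \<infinity> \<and> (enn2real (T \<omega>), \<omega>) \<in> B} \<in> sets M"
proof -
  note stopping_measurable[OF T, measurable] B[measurable]
  show ?thesis by measurable
qed

lemma projects_set_empty: "projects_set {} (\<lambda>_ _. 0)"
  by (simp add: projects_set_def)

lemma projects_set_UNIV: "projects_set (UNIV \<times> space M) (\<lambda>_ _. 1)"
  unfolding projects_set_def
proof (intro conjI allI impI)
  show "optional_process (\<lambda>_ _. 1)" by (rule optional_time) simp
  fix T assume T: "stopping T"
  have "(\<integral>\<omega>. stopped (\<lambda>_ _. 1) T \<omega> \<partial>M) = (\<integral>\<omega>. indicator {\<omega> \<in> space M. T \<omega> < \<infinity>} \<omega> \<partial>M)"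
    by (intro Bochner_Integration.integral_cong refl) (simp add: indicator_def)
  also have "\<dots> = measure M {\<omega> \<in> space M. T \<omega> < \<infinity>}" using finite_set_measurable[OF T] by simp
  also have "{\<omega> \<in> space M. T \<omega> < \<infinity>} = {\<omega> \<in> space M. T \<omega> < \<infinity> \<and> (enn2real (T \<omega>), \<omega>) \<in> UNIV \<times> space M}" by auto
  finally show "(\<integral>\<omega>. stopped (\<lambda>_ _. 1) T \<omega> \<partial>M) =
    measure M {\<omega> \<in> space M. T \<omega> < \<infinity> \<and> (enn2real (T \<omega>), \<omega>) \<in> UNIV \<times> space M}" .
qed auto

text \<open>
  A deterministic time set \<open>C\<close> only postpones the stopping time: on a rectangle, the cadlag version for
  \<open>F\<close> is evaluated at \<open>T\<close> if \<open>T \<in> C\<close> and at \<open>\<infinity>\<close> otherwise.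
\<close>

lemma projects_set_rect:
  assumes C: "C \<in> sets borel" and F: "F \<in> sets M"
  shows "\<exists>Z. projects_set (C \<times> F) Z"
proof -
  obtain N where N: "cadlag_adapted G N" "\<And>t \<omega>. 0 \<le> N t \<omega>" "\<And>t \<omega>. N t \<omega> \<le> 1"
    "\<And>T. stopping T \<Longrightarrow> (\<integral>\<omega>. stopped N T \<omega> \<partial>M) = measure M (F \<inter> {\<omega> \<in> space M. T \<omega> < \<infinity>})"
    using cadlag_cond_prob[OF F] by blast
  have C_meas: "(indicator C :: real \<Rightarrow> real) \<in> borel_measurable borel" using C by measurable
  define Z where "Z t \<omega> = indicator C t * N t \<omega>" for t \<omega>
  have "optional_process Z"
    using borel_measurable_times[OF optional_time[OF C_meas] cadlag_optional[OF N(1)]]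
    by (simp add: Z_def[abs_def] split_beta')
  moreover have "0 \<le> Z t \<omega> \<and> Z t \<omega> \<le> 1" for t \<omega> using N(2,3) by (simp add: Z_def indicator_def)
  moreover have "(\<integral>\<omega>. stopped Z T \<omega> \<partial>M) = measure M {\<omega> \<in> space M. T \<omega> < \<infinity> \<and> (enn2real (T \<omega>), \<omega>) \<in> C \<times> F}"
    if T: "stopping T" for T
  proof -
    define S where "S = {x \<in> space (optional_algebra G). fst x \<in> C}"
    have "S = case_prod (\<lambda>t \<omega>. indicator C t :: real) -` {1} \<inter> space (optional_algebra G)"
      by (auto simp: S_def indicator_def)
    then have S: "S \<in> sets (optional_algebra G)"
      using measurable_sets[OF optional_time[OF C_meas], of "{1}"] by simp
    define T' where "T' \<omega> = (if \<omega> \<in> {\<omega>. (enn2real (T \<omega>), \<omega>) \<in> S} then T \<omega> else \<infinity>)" for \<omega>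
    have T': "stopping T'" unfolding T'_def
      by (rule stopping_restrict[OF T]) (use optional_at_stopping_adapted[OF T S] in simp)
    have inS: "(enn2real (T \<omega>), \<omega>) \<in> S \<longleftrightarrow> enn2real (T \<omega>) \<in> C" if "\<omega> \<in> space M" for \<omega>
      using that by (simp add: S_def space_optional)
    have "(\<integral>\<omega>. stopped Z T \<omega> \<partial>M) = (\<integral>\<omega>. stopped N T' \<omega> \<partial>M)"
      by (intro Bochner_Integration.integral_cong refl) (simp add: Z_def T'_def inS indicator_def)
    also have "\<dots> = measure M (F \<inter> {\<omega> \<in> space M. T' \<omega> < \<infinity>})" by (rule N(4)[OF T'])
    also have "F \<inter> {\<omega> \<in> space M. T' \<omega> < \<infinity>} = {\<omega> \<in> space M. T \<omega> < \<infinity> \<and> (enn2real (T \<omega>), \<omega>) \<in> C \<times> F}"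
      by (auto simp: T'_def inS split: if_splits)
    finally show ?thesis .
  qed
  ultimately show ?thesis unfolding projects_set_def by blast
qed

text \<open>
  A Dynkin argument from rectangles. For a disjoint union the projections are summed up; the sum
  may leave \<open>[0, 1]\<close>, but only on an evanescent set by \<open>optional_le\<close>, and is therefore truncated.
\<close>

theorem projects_set_exists:
  assumes B: "B \<in> sets (borel \<Otimes>\<^sub>M M)"
  shows "\<exists>Z. projects_set B Z"
proof -
  let ?R = "{a \<times> b | a b. a \<in> sets (borel :: real measure) \<and> b \<in> sets M}"
  let ?O = "space (borel :: real measure) \<times> space M"
  have B': "B \<in> sigma_sets ?O ?R" using B unfolding sets_pair_measure .
  have ss: "sigma_sets ?O ?R = sets (borel \<Otimes>\<^sub>M M)" by (simp add: sets_pair_measure)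
  have "Int_stable ?R" by (rule Int_stable_pair_measure_generator)
  moreover have "?R \<subseteq> Pow ?O" by (rule pair_measure_closed)
  ultimately show ?thesis using B'
  proof (induction rule: sigma_sets_induct_disjoint)
    case (basic A)
    then show ?case using projects_set_rect by blast
  next
    case empty
    show ?case using projects_set_empty by blast
  next
    case (compl A)
    then obtain Z where Z: "optional_process Z" "\<And>t \<omega>. 0 \<le> Z t \<omega> \<and> Z t \<omega> \<le> 1"
      "\<And>T. stopping T \<Longrightarrow> (\<integral>\<omega>. stopped Z T \<omega> \<partial>M) = measure M {\<omega> \<in> space M. T \<omega> < \<infinity> \<and> (enn2real (T \<omega>), \<omega>) \<in> A}"
      by (auto simp: projects_set_def)
    have "projects_set (?O - A) (\<lambda>t \<omega>. 1 - Z t \<omega>)"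
      unfolding projects_set_def
    proof (intro conjI allI impI)
      show "optional_process (\<lambda>t \<omega>. 1 - Z t \<omega>)"
        using borel_measurable_diff[OF borel_measurable_const Z(1), of 1] by (simp add: split_beta')
      fix T assume T: "stopping T"
      let ?A = "{\<omega> \<in> space M. T \<omega> < \<infinity> \<and> (enn2real (T \<omega>), \<omega>) \<in> A}"
      let ?I = "{\<omega> \<in> space M. T \<omega> < \<infinity>}"
      have A: "?A \<in> sets M" using compl(1) unfolding ss by (rule stopped_event_measurable[OF T])
      have I: "?I \<in> sets M" by (rule finite_set_measurable[OF T])
      have iZ: "integrable M (stopped Z T)"
        using Z(2) by (intro stopped_integrable[OF Z(1) T, where b = 1]) simp
      have iI: "integrable M (indicator ?I :: 'w \<Rightarrow> real)"
        using I by (intro integrable_real_indicator) (auto simp: emeasure_eq_measure)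
      have "(\<integral>\<omega>. stopped (\<lambda>t \<omega>. 1 - Z t \<omega>) T \<omega> \<partial>M) = (\<integral>\<omega>. indicator ?I \<omega> - stopped Z T \<omega> \<partial>M)"
        by (intro Bochner_Integration.integral_cong refl) (simp add: indicator_def)
      also have "\<dots> = measure M ?I - (\<integral>\<omega>. stopped Z T \<omega> \<partial>M)"
        using I by (subst Bochner_Integration.integral_diff[OF iI iZ]) simp
      also have "\<dots> = measure M (?I - ?A)"
        unfolding Z(3)[OF T] by (intro finite_measure_Diff[symmetric] A I) auto
      also have "?I - ?A = {\<omega> \<in> space M. T \<omega> < \<infinity> \<and> (enn2real (T \<omega>), \<omega>) \<in> ?O - A}" by auto
      finally show "(\<integral>\<omega>. stopped (\<lambda>t \<omega>. 1 - Z t \<omega>) T \<omega> \<partial>M) =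
        measure M {\<omega> \<in> space M. T \<omega> < \<infinity> \<and> (enn2real (T \<omega>), \<omega>) \<in> ?O - A}" .
    qed (use Z(2) in auto)
    then show ?case by blast
  next
    case (union A)
    then obtain Z where "\<And>i. projects_set (A i) (Z i)" by metis
    then have Z: "\<And>i. optional_process (Z i)" "\<And>i t \<omega>. 0 \<le> Z i t \<omega> \<and> Z i t \<omega> \<le> 1"
      "\<And>i T. stopping T \<Longrightarrow> (\<integral>\<omega>. stopped (Z i) T \<omega> \<partial>M) = measure M {\<omega> \<in> space M. T \<omega> < \<infinity> \<and> (enn2real (T \<omega>), \<omega>) \<in> A i}"
      by (auto simp: projects_set_def)
    define W where "W t \<omega> = (\<Sum>i. ennreal (Z i t \<omega>))" for t \<omega>
    define V where "V t \<omega> = enn2real (W t \<omega>)" for t \<omega>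
    have W_opt: "case_prod W \<in> borel_measurable (optional_algebra G)"
    proof -
      have "(\<lambda>x. \<Sum>i. ennreal (case_prod (Z i) x)) \<in> borel_measurable (optional_algebra G)"
        by (intro borel_measurable_suminf_order measurable_compose[OF Z(1) measurable_ennreal])
      then show ?thesis by (simp add: W_def[abs_def] split_beta')
    qed
    have V_opt: "optional_process V"
      using measurable_compose[OF W_opt borel_measurable_enn2real[OF measurable_ident]]
      by (simp add: V_def[abs_def] split_beta')
    have VE: "integrable M (stopped V T) \<and>
       (\<integral>\<omega>. stopped V T \<omega> \<partial>M) = measure M {\<omega> \<in> space M. T \<omega> < \<infinity> \<and> (enn2real (T \<omega>), \<omega>) \<in> (\<Union>i. A i)}"
      if T: "stopping T" for T
    proof -
      let ?I = "indicator {\<omega>. T \<omega> < \<infinity>} :: 'w \<Rightarrow> ennreal"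
      let ?A = "\<lambda>i. {\<omega> \<in> space M. T \<omega> < \<infinity> \<and> (enn2real (T \<omega>), \<omega>) \<in> A i}"
      let ?U = "{\<omega> \<in> space M. T \<omega> < \<infinity> \<and> (enn2real (T \<omega>), \<omega>) \<in> (\<Union>i. A i)}"
      have A: "?A i \<in> sets M" for i
        by (rule stopped_event_measurable[OF T]) (use union(2) ss in blast)
      have int: "integrable M (stopped (Z i) T)" for i
        using Z(2) by (intro stopped_integrable[OF Z(1) T, where b = 1]) auto
      have "(\<integral>\<^sup>+\<omega>. W (enn2real (T \<omega>)) \<omega> * ?I \<omega> \<partial>M) = (\<integral>\<^sup>+\<omega>. (\<Sum>i. ennreal (stopped (Z i) T \<omega>)) \<partial>M)"
        by (intro nn_integral_cong) (simp add: W_def indicator_def)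
      also have "\<dots> = (\<Sum>i. \<integral>\<^sup>+\<omega>. ennreal (stopped (Z i) T \<omega>) \<partial>M)"
        by (intro nn_integral_suminf measurable_compose[OF stopped_measurable[OF Z(1) T] measurable_ennreal])
      also have "\<dots> = (\<Sum>i. emeasure M (?A i))"
      proof (intro suminf_cong)
        fix i
        have "(\<integral>\<^sup>+\<omega>. ennreal (stopped (Z i) T \<omega>) \<partial>M) = ennreal (\<integral>\<omega>. stopped (Z i) T \<omega> \<partial>M)"
          using Z(2) by (intro nn_integral_eq_integral int) (auto simp: indicator_def)
        then show "(\<integral>\<^sup>+\<omega>. ennreal (stopped (Z i) T \<omega>) \<partial>M) = emeasure M (?A i)"
          using Z(3)[OF T] by (simp add: emeasure_eq_measure)
      qed
      also have "\<dots> = emeasure M (\<Union>i. ?A i)"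
      proof (rule suminf_emeasure)
        show "range ?A \<subseteq> sets M" using A by blast
        show "disjoint_family ?A" using union(1) unfolding disjoint_family_on_def by blast
      qed
      also have "(\<Union>i. ?A i) = ?U" by blast
      finally have nnW: "(\<integral>\<^sup>+\<omega>. W (enn2real (T \<omega>)) \<omega> * ?I \<omega> \<partial>M) = emeasure M ?U" .
      have Wm: "(\<lambda>\<omega>. W (enn2real (T \<omega>)) \<omega> * ?I \<omega>) \<in> borel_measurable M"
      proof -
        note stopping_measurable[OF T, measurable]
        have [measurable]: "(\<lambda>\<omega>. W (enn2real (T \<omega>)) \<omega>) \<in> borel_measurable M"
          using measurable_compose[OF optional_at_stopping[OF T] W_opt] by simp
        have "(\<lambda>\<omega>. W (enn2real (T \<omega>)) \<omega> * (if T \<omega> < \<infinity> then 1 else 0)) \<in> borel_measurable M" by measurable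
        then show ?thesis by (simp add: indicator_def[abs_def])
      qed
      have "AE \<omega> in M. W (enn2real (T \<omega>)) \<omega> * ?I \<omega> \<noteq> \<infinity>"
        by (rule nn_integral_noteq_infinite[OF Wm]) (unfold nnW, simp)
      then have "AE \<omega> in M. ennreal (stopped V T \<omega>) = W (enn2real (T \<omega>)) \<omega> * ?I \<omega>"
        by eventually_elim (auto simp: V_def indicator_def less_top)
      then have nnV: "(\<integral>\<^sup>+\<omega>. ennreal (stopped V T \<omega>) \<partial>M) = emeasure M ?U"
        unfolding nnW[symmetric] by (rule nn_integral_cong_AE)
      have Vm: "stopped V T \<in> borel_measurable M" by (rule stopped_measurable[OF V_opt T])
      have V0: "0 \<le> stopped V T \<omega>" for \<omega> by (simp add: V_def)
      have "integrable M (stopped V T)"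
      proof (rule integrableI_nonneg[OF Vm])
        show "(\<integral>\<^sup>+\<omega>. ennreal (stopped V T \<omega>) \<partial>M) < \<infinity>"
          unfolding nnV by (simp add: emeasure_eq_measure)
      qed (use V0 in simp)
      moreover have "(\<integral>\<omega>. stopped V T \<omega> \<partial>M) = measure M ?U"
      proof -
        have "(\<integral>\<omega>. stopped V T \<omega> \<partial>M) = enn2real (\<integral>\<^sup>+\<omega>. ennreal (stopped V T \<omega>) \<partial>M)"
          using V0 by (intro integral_eq_nn_integral[OF Vm]) simp
        then show ?thesis unfolding nnV measure_def .
      qed
      ultimately show ?thesis by blast
    qed
    have one: "optional_process (\<lambda>_ _. 1)" by (rule optional_time) simp
    have le: "AE \<omega> in M. \<forall>t\<ge>0. V t \<omega> \<le> 1"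
    proof (rule optional_le[OF V_opt one])
      fix T assume T: "stopping T"
      show "integrable M (stopped V T)" using VE[OF T] by blast
      show "integrable M (stopped (\<lambda>_ _. 1) T)" by (rule stopped_integrable[OF one T, where b = 1]) simp
      let ?\<Omega> = "{\<omega> \<in> space M. T \<omega> < \<infinity> \<and> (enn2real (T \<omega>), \<omega>) \<in> UNIV \<times> space M}"
      have \<Omega>: "?\<Omega> \<in> sets M" by (intro stopped_event_measurable[OF T] pair_measureI) auto
      have E1: "(\<integral>\<omega>. stopped (\<lambda>_ _. 1) T \<omega> \<partial>M) = measure M ?\<Omega>"
        using projects_set_UNIV T unfolding projects_set_def by blast
      show "(\<integral>\<omega>. stopped V T \<omega> \<partial>M) \<le> (\<integral>\<omega>. stopped (\<lambda>_ _. 1) T \<omega> \<partial>M)"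
        unfolding conjunct2[OF VE[OF T]] E1 by (rule finite_measure_mono[OF _ \<Omega>]) blast
    qed
    let ?V = "\<lambda>t \<omega>. min 1 (V t \<omega>)"
    have "projects_set (\<Union>i. A i) ?V"
      unfolding projects_set_def
    proof (intro conjI allI impI)
      show opt: "optional_process ?V"
        using borel_measurable_min[OF borel_measurable_const V_opt, of 1] by (simp add: split_beta' min.commute)
      fix T assume T: "stopping T"
      have "(\<integral>\<omega>. stopped ?V T \<omega> \<partial>M) = (\<integral>\<omega>. stopped V T \<omega> \<partial>M)"
      proof (rule integral_cong_AE[OF stopped_measurable[OF opt T] stopped_measurable[OF V_opt T]])
        show "AE \<omega> in M. stopped ?V T \<omega> = stopped V T \<omega>" using le by eventually_elim simp
      qed
      then show "(\<integral>\<omega>. stopped ?V T \<omega> \<partial>M) = measure M {\<omega> \<in> space M. T \<omega> < \<infinity> \<and> (enn2real (T \<omega>), \<omega>) \<in> (\<Union>i. A i)}"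
        using VE[OF T] by simp
    qed (auto simp: V_def)
    then show ?case by blast
  qed
qed

end

section \<open>A regular version for real-valued processes\<close>

text \<open>
  Infima over rationals strictly to the right turn a monotone function on the rationals into a
  distribution function; its values are the limits along rationals that tend to the argument from
  the right.
\<close>

lemma rational_cdf:
  fixes z :: "real \<Rightarrow> real"
  assumes mono: "\<And>q r. q \<in> \<rat> \<Longrightarrow> r \<in> \<rat> \<Longrightarrow> q \<le> r \<Longrightarrow> z q \<le> z r"
    and zero: "\<And>q. q \<in> \<rat> \<Longrightarrow> q < 0 \<Longrightarrow> z q = 0"
    and one: "\<And>q. q \<in> \<rat> \<Longrightarrow> 1 \<le> q \<Longrightarrow> z q = 1"
  defines "H \<equiv> \<lambda>x. INF q\<in>\<rat> \<inter> {x<..}. z q"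
  shows rational_cdf_mono: "\<And>x y. x \<le> y \<Longrightarrow> H x \<le> H y"
    and rational_cdf_right: "\<And>x. continuous (at_right x) H"
    and rational_cdf_bot: "(H \<longlongrightarrow> 0) at_bot"
    and rational_cdf_top: "(H \<longlongrightarrow> 1) at_top"
    and rational_cdf_seq: "\<And>q x. (\<And>n. q n \<in> \<rat>) \<Longrightarrow> (\<And>n. x < q n) \<Longrightarrow> q \<longlonglongrightarrow> x \<Longrightarrow> (\<lambda>n. z (q n)) \<longlonglongrightarrow> H x"
proof -
  have z0: "0 \<le> z q" if "q \<in> \<rat>" for q
  proof -
    have "min q 0 - 1 < min q 0" by linarith
    then obtain r where "r \<in> \<rat>" "r < min q 0" using Rats_dense_in_real by blast
    then show ?thesis using mono[of r q] zero[of r] that by auto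
  qed
  have ne: "\<rat> \<inter> {x<..} \<noteq> {}" for x :: real
    using Rats_dense_in_real[of x "x + 1"] by auto
  have bdd: "bdd_below (z ` (\<rat> \<inter> {x<..}))" for x
    by (rule bdd_belowI[of _ 0]) (auto simp: z0)
  have H_le: "H x \<le> z q" if "q \<in> \<rat>" "x < q" for q x
    unfolding H_def using that by (intro cINF_lower bdd) auto
  have H_less: "\<exists>q\<in>\<rat>. x < q \<and> z q < y" if "H x < y" for x y
    using that unfolding H_def cINF_less_iff[OF ne bdd] by auto
  show H_mono: "H x \<le> H y" if "x \<le> y" for x y
    unfolding H_def using that by (intro cINF_superset_mono ne bdd) auto
  show "continuous (at_right x) H" for x
    unfolding continuous_within
  proof (rule order_tendstoI)
    fix y assume "y < H x"
    then have "y < H s" if "x < s" for s using H_mono[of x s] that by simp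
    then show "\<forall>\<^sub>F s in at_right x. y < H s"
      by (auto simp: eventually_at_right_field intro: exI[of _ "x + 1"])
  next
    fix y assume "H x < y"
    then obtain q where q: "q \<in> \<rat>" "x < q" "z q < y" using H_less by blast
    have "H s < y" if "s < q" for s using H_le[OF q(1) that] q(3) by simp
    then show "\<forall>\<^sub>F s in at_right x. H s < y"
      using q(2) by (auto simp: eventually_at_right_field intro: exI[of _ q])
  qed
  have H0: "H x = 0" if x: "x < 0" for x
  proof -
    obtain r where r: "r \<in> \<rat>" "x < r" "r < 0" using Rats_dense_in_real[OF x] by auto
    have "H x \<le> 0" using H_le[OF r(1,2)] zero[OF r(1,3)] by simp
    moreover have "0 \<le> H x" unfolding H_def using ne z0 by (intro cINF_greatest) auto
    ultimately show ?thesis by simp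
  qed
  show "(H \<longlongrightarrow> 0) at_bot"
    by (rule tendsto_eventually) (auto simp: eventually_at_bot_dense H0 intro: exI[of _ 0])
  have H1: "H x = 1" if "1 \<le> x" for x
  proof -
    have "z ` (\<rat> \<inter> {x<..}) = {1}" using ne[of x] one that by (auto simp: image_iff)
    then show ?thesis by (simp add: H_def)
  qed
  show "(H \<longlongrightarrow> 1) at_top"
    by (rule tendsto_eventually) (auto simp: eventually_at_top_linorder H1 intro: exI[of _ 1])
  show "(\<lambda>n. z (q n)) \<longlonglongrightarrow> H x"
    if q: "\<And>n. q n \<in> \<rat>" "\<And>n. x < q n" "q \<longlonglongrightarrow> x" for q x
  proof (rule order_tendstoI)
    fix y assume "y < H x"
    then have "y < z (q n)" for n using H_le[OF q(1,2), of n] by linarith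
    then show "\<forall>\<^sub>F n in sequentially. y < z (q n)" by simp
  next
    fix y assume "H x < y"
    then obtain r where r: "r \<in> \<rat>" "x < r" "z r < y" using H_less by blast
    have "\<forall>\<^sub>F n in sequentially. q n < r" using q(3) r(2) by (rule order_tendstoD)
    then show "\<forall>\<^sub>F n in sequentially. z (q n) < y"
    proof eventually_elim
      case (elim n)
      then show ?case using mono[OF q(1) r(1), of n] r(3) by simp
    qed
  qed
qed

context usual_filtration
begin

lemma projects_set_mono:
  assumes "projects_set B Z" "projects_set B' Z'" "B \<subseteq> B'" "B' \<in> sets (borel \<Otimes>\<^sub>M M)"
  shows "AE \<omega> in M. \<forall>t\<ge>0. Z t \<omega> \<le> Z' t \<omega>"
proof (rule optional_le)
  show opt: "optional_process Z" "optional_process Z'" using assms by (auto simp: projects_set_def)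
  fix T assume T: "stopping T"
  show "integrable M (stopped Z T)" "integrable M (stopped Z' T)"
    by (rule stopped_integrable[OF opt(1) T, where b = 1] stopped_integrable[OF opt(2) T, where b = 1],
        use assms in \<open>simp add: projects_set_def\<close>)+
  show "(\<integral>\<omega>. stopped Z T \<omega> \<partial>M) \<le> (\<integral>\<omega>. stopped Z' T \<omega> \<partial>M)"
  proof -
    have "measure M {\<omega> \<in> space M. T \<omega> < \<infinity> \<and> (enn2real (T \<omega>), \<omega>) \<in> B} \<le>
        measure M {\<omega> \<in> space M. T \<omega> < \<infinity> \<and> (enn2real (T \<omega>), \<omega>) \<in> B'}"
      using assms(3) by (intro finite_measure_mono stopped_event_measurable[OF T assms(4)]) blast
    then show ?thesis using assms(1,2) T by (simp add: projects_set_def)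
  qed
qed

text \<open>
  The probability restricted to \<open>{T < \<infinity>}\<close>; under it, mixing a kernel at \<open>T\<close> is the bind of the
  Giry monad.
\<close>

definition finite_part :: "('w \<Rightarrow> ennreal) \<Rightarrow> 'w measure" where
  "finite_part T = density M (\<lambda>\<omega>. ennreal (indicator {\<omega> \<in> space M. T \<omega> < \<infinity>} \<omega>))"

lemma finite_part_simps[simp]: "sets (finite_part T) = sets M" "space (finite_part T) = space M"
  by (simp_all add: finite_part_def)

lemma emeasure_finite_part:
  assumes T: "stopping T" and A: "A \<in> sets M"
  shows "emeasure (finite_part T) A = emeasure M {\<omega> \<in> A. T \<omega> < \<infinity>}"
proof -
  note I = finite_set_measurable[OF T]
  note stopping_measurable[OF T, measurable] A[measurable]
  have "emeasure (finite_part T) A = (\<integral>\<^sup>+\<omega>. ennreal (indicator {\<omega> \<in> space M. T \<omega> < \<infinity>} \<omega>) * indicator A \<omega> \<partial>M)"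
    unfolding finite_part_def by (intro emeasure_density) measurable
  also have "\<dots> = (\<integral>\<^sup>+\<omega>. indicator ({\<omega> \<in> space M. T \<omega> < \<infinity>} \<inter> A) \<omega> \<partial>M)"
    by (intro nn_integral_cong) (auto simp: indicator_def)
  also have "\<dots> = emeasure M ({\<omega> \<in> space M. T \<omega> < \<infinity>} \<inter> A)"
    using I A by (intro nn_integral_indicator) auto
  also have "{\<omega> \<in> space M. T \<omega> < \<infinity>} \<inter> A = {\<omega> \<in> A. T \<omega> < \<infinity>}"
    using sets.sets_into_space[OF A] by auto
  finally show ?thesis .
qed

lemma finite_measure_finite_part: "stopping T \<Longrightarrow> finite_measure (finite_part T)"
  by (rule finite_measureI) (simp add: emeasure_finite_part emeasure_eq_measure)

lemma integral_finite_part: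
  fixes f :: "'w \<Rightarrow> real"
  assumes T: "stopping T" and f: "f \<in> borel_measurable M"
  shows "(\<integral>\<omega>. f \<omega> \<partial>finite_part T) = (\<integral>\<omega>. f \<omega> * indicator {\<omega>. T \<omega> < \<infinity>} \<omega> \<partial>M)"
proof -
  have "(\<integral>\<omega>. f \<omega> \<partial>finite_part T) = (\<integral>\<omega>. indicator {\<omega> \<in> space M. T \<omega> < \<infinity>} \<omega> *\<^sub>R f \<omega> \<partial>M)"
    unfolding finite_part_def using finite_set_measurable[OF T] f by (intro integral_density) auto
  also have "\<dots> = (\<integral>\<omega>. f \<omega> * indicator {\<omega>. T \<omega> < \<infinity>} \<omega> \<partial>M)"
    by (intro Bochner_Integration.integral_cong refl) (simp add: indicator_def)
  finally show ?thesis .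
qed

lemma nn_integral_finite_part:
  assumes T: "stopping T" and f: "f \<in> borel_measurable M"
  shows "(\<integral>\<^sup>+\<omega>. f \<omega> \<partial>finite_part T) = (\<integral>\<^sup>+\<omega>. indicator {\<omega>. T \<omega> < \<infinity>} \<omega> * f \<omega> \<partial>M)"
proof -
  have "(\<integral>\<^sup>+\<omega>. f \<omega> \<partial>finite_part T) = (\<integral>\<^sup>+\<omega>. ennreal (indicator {\<omega> \<in> space M. T \<omega> < \<infinity>} \<omega>) * f \<omega> \<partial>M)"
    unfolding finite_part_def using finite_set_measurable[OF T] f by (intro nn_integral_density) auto
  also have "\<dots> = (\<integral>\<^sup>+\<omega>. indicator {\<omega>. T \<omega> < \<infinity>} \<omega> * f \<omega> \<partial>M)"
    by (intro nn_integral_cong) (simp add: indicator_def)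
  finally show ?thesis .
qed

lemma rational_sequence_right:
  obtains q :: "nat \<Rightarrow> real" where "\<And>n. q n \<in> \<rat>" "\<And>n. x < q n" "q \<longlonglongrightarrow> x"
proof -
  have "\<forall>n. \<exists>q\<in>\<rat>. x < q \<and> q < x + inverse (real (Suc n))"
    using Rats_dense_in_real[of x] by simp
  then obtain q where q: "\<And>n. q n \<in> \<rat>" "\<And>n. x < q n" "\<And>n. q n < x + inverse (real (Suc n))" by metis
  have "q \<longlonglongrightarrow> x"
  proof (rule tendsto_sandwich[of "\<lambda>_. x" q _ "\<lambda>n. x + inverse (real (Suc n))"])
    show "(\<lambda>n. x + inverse (real (Suc n))) \<longlonglongrightarrow> x"
      using tendsto_add[OF tendsto_const LIMSEQ_inverse_real_of_nat, of x] by simp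
  qed (use q less_imp_le[OF q(2)] less_imp_le[OF q(3)] in auto)
  then show ?thesis using that q by blast
qed

text \<open>
  The projections of \<open>{V \<le> q}\<close> for rational \<open>q\<close> satisfy the rules of a distribution function at all
  times simultaneously, outside one null set; on that null set they are replaced by those of the
  point mass at \<open>0\<close>. Comparing distribution functions identifies the mixture at each stopping time.
\<close>

theorem optional_kernel:
  fixes V :: "real \<times> 'w \<Rightarrow> real"
  assumes V: "V \<in> borel_measurable (borel \<Otimes>\<^sub>M M)" and V01: "\<And>x. 0 \<le> V x" "\<And>x. V x \<le> 1"
  shows "\<exists>\<kappa>. \<kappa> \<in> optional_algebra G \<rightarrow>\<^sub>M prob_algebra borel \<and>
    (\<forall>T. stopping T \<longrightarrow> finite_part T \<bind> (\<lambda>\<omega>. \<kappa> (enn2real (T \<omega>), \<omega>)) =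
      distr (finite_part T) borel (\<lambda>\<omega>. V (enn2real (T \<omega>), \<omega>)))"
proof -
  define B where "B q = {x \<in> space (borel \<Otimes>\<^sub>M M). V x \<le> q}" for q
  have B: "B q \<in> sets (borel \<Otimes>\<^sub>M M)" for q unfolding B_def using V by measurable
  obtain Z where Z: "\<And>q. projects_set (B q) (Z q)" using projects_set_exists[OF B] by metis
  have Z_opt: "optional_process (Z q)" and Z01: "0 \<le> Z q t \<omega>" "Z q t \<omega> \<le> 1"
    and ZE: "stopping T \<Longrightarrow> (\<integral>\<omega>. stopped (Z q) T \<omega> \<partial>M) = measure M {\<omega> \<in> space M. T \<omega> < \<infinity> \<and> (enn2real (T \<omega>), \<omega>) \<in> B q}"
    for q t \<omega> T using Z[of q] by (auto simp: projects_set_def)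
  have ae1: "AE \<omega> in M. q \<le> r \<longrightarrow> (\<forall>t\<ge>0. Z q t \<omega> \<le> Z r t \<omega>)" for q r
  proof (cases "q \<le> r")
    case True
    then have "B q \<subseteq> B r" by (auto simp: B_def)
    then show ?thesis using projects_set_mono[OF Z Z _ B] by simp
  qed simp
  have ae2: "AE \<omega> in M. q < 0 \<longrightarrow> (\<forall>t\<ge>0. Z q t \<omega> \<le> 0)" for q
  proof (cases "q < 0")
    case True
    then have "\<not> V x \<le> q" for x using V01(1)[of x] by linarith
    then have "B q \<subseteq> {}" by (auto simp: B_def)
    then show ?thesis using projects_set_mono[OF Z projects_set_empty] by simp
  qed simp
  have ae3: "AE \<omega> in M. 1 \<le> q \<longrightarrow> (\<forall>t\<ge>0. 1 \<le> Z q t \<omega>)" for q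
  proof (cases "1 \<le> q")
    case True
    then have "UNIV \<times> space M \<subseteq> B q" using V01(2) by (auto simp: B_def space_pair_measure intro: order_trans)
    then show ?thesis using projects_set_mono[OF projects_set_UNIV Z _ B] by simp
  qed simp
  have "AE \<omega> in M. \<forall>q\<in>\<rat>. (q < 0 \<longrightarrow> (\<forall>t\<ge>0. Z q t \<omega> \<le> 0)) \<and> (1 \<le> q \<longrightarrow> (\<forall>t\<ge>0. 1 \<le> Z q t \<omega>)) \<and>
    (\<forall>r\<in>\<rat>. q \<le> r \<longrightarrow> (\<forall>t\<ge>0. Z q t \<omega> \<le> Z r t \<omega>))"
    by (intro AE_ball_countable' AE_conjI ae1 ae2 ae3 countable_rat)
  then obtain N where N: "N \<in> null_sets M"
    "\<And>\<omega>. \<omega> \<in> space M - N \<Longrightarrow> \<forall>q\<in>\<rat>. (q < 0 \<longrightarrow> (\<forall>t\<ge>0. Z q t \<omega> \<le> 0)) \<and> (1 \<le> q \<longrightarrow> (\<forall>t\<ge>0. 1 \<le> Z q t \<omega>)) \<and>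
    (\<forall>r\<in>\<rat>. q \<le> r \<longrightarrow> (\<forall>t\<ge>0. Z q t \<omega> \<le> Z r t \<omega>))"
    by (rule AE_E3) blast
  define Z' where "Z' q t \<omega> = (if \<omega> \<in> N then of_bool (0 \<le> q) else Z q t \<omega>)" for q t \<omega>
  have Z'01: "0 \<le> Z' q t \<omega>" "Z' q t \<omega> \<le> 1" for q t \<omega> using Z01 by (auto simp: Z'_def)
  have Z'_opt: "optional_process (Z' q)" for q
  proof -
    have N0: "N \<in> sets (G 0)" by (rule null_G[OF N(1)]) simp
    have "(\<lambda>x. indicator N (snd x) * of_bool (0 \<le> q) + (1 - indicator N (snd x)) * Z q (fst x) (snd x))
        \<in> borel_measurable (optional_algebra G)"
      using optional_const[OF N0] Z_opt[of q]
      by (intro borel_measurable_add borel_measurable_times borel_measurable_diff borel_measurable_const) (simp_all add: split_beta')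
    also have "(\<lambda>x. indicator N (snd x) * of_bool (0 \<le> q) + (1 - indicator N (snd x)) * Z q (fst x) (snd x)) = case_prod (Z' q)"
      by (auto simp: Z'_def indicator_def fun_eq_iff)
    finally show ?thesis .
  qed
  have Z'E: "(\<integral>\<omega>. stopped (Z' q) T \<omega> \<partial>M) = measure M {\<omega> \<in> space M. T \<omega> < \<infinity> \<and> (enn2real (T \<omega>), \<omega>) \<in> B q}"
    if T: "stopping T" for T q
    unfolding ZE[OF T, symmetric]
  proof (rule integral_cong_AE[OF stopped_measurable[OF Z'_opt T] stopped_measurable[OF Z_opt T]])
    show "AE \<omega> in M. stopped (Z' q) T \<omega> = stopped (Z q) T \<omega>"
      using AE_not_in[OF N(1)] by eventually_elim (simp add: Z'_def)
  qed
  have cdf: "q \<in> \<rat> \<Longrightarrow> r \<in> \<rat> \<Longrightarrow> q \<le> r \<Longrightarrow> Z' q t \<omega> \<le> Z' r t \<omega>"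
    "q \<in> \<rat> \<Longrightarrow> q < 0 \<Longrightarrow> Z' q t \<omega> = 0" "q \<in> \<rat> \<Longrightarrow> 1 \<le> q \<Longrightarrow> Z' q t \<omega> = 1"
    if "0 \<le> t" "\<omega> \<in> space M" for q r t \<omega>
    using N(2)[of \<omega>] that Z01[of q t \<omega>] by (auto simp: Z'_def intro: antisym)
  define H where "H t \<omega> = (\<lambda>x. INF q\<in>\<rat> \<inter> {x<..}. Z' q t \<omega>)" for t \<omega>
  note H_props = rational_cdf_mono rational_cdf_right rational_cdf_bot rational_cdf_top
  have H: "x \<le> y \<Longrightarrow> H t \<omega> x \<le> H t \<omega> y" "continuous (at_right x) (H t \<omega>)" "(H t \<omega> \<longlongrightarrow> 0) at_bot" "(H t \<omega> \<longlongrightarrow> 1) at_top"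
    if "0 \<le> t" "\<omega> \<in> space M" for t \<omega> x y
    unfolding H_def using H_props[of "\<lambda>q. Z' q t \<omega>", OF cdf[OF that]] by blast+
  define \<kappa> where "\<kappa> x = interval_measure (case_prod H x)" for x
  have \<kappa>_Iic: "emeasure (\<kappa> (t, \<omega>)) {..x} = ennreal (H t \<omega> x)" if "0 \<le> t" "\<omega> \<in> space M" for t \<omega> x
    unfolding \<kappa>_def split using H[OF that] by (intro emeasure_interval_measure_Iic)
  have \<kappa>_prob: "prob_space (\<kappa> (t, \<omega>))" if "0 \<le> t" "\<omega> \<in> space M" for t \<omega>
    unfolding \<kappa>_def split using H[OF that]
    by (intro real_distribution.axioms(1) real_distribution_interval_measure)
  have H_opt: "(\<lambda>y. case_prod H y x) \<in> borel_measurable (optional_algebra G)" for x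
  proof -
    have "countable (\<rat> \<inter> {x<..})" by (rule countable_subset[OF _ countable_rat]) auto
    then have "(\<lambda>y. INF q\<in>\<rat> \<inter> {x<..}. case_prod (Z' q) y) \<in> borel_measurable (optional_algebra G)"
      by (intro borel_measurable_cINF_real Z'_opt)
    then show ?thesis by (simp add: H_def split_beta')
  qed
  have \<kappa>: "\<kappa> \<in> optional_algebra G \<rightarrow>\<^sub>M prob_algebra borel"
  proof (rule measurable_prob_algebra_generated[where \<Omega> = UNIV and G = "range (\<lambda>x. {..x})"])
    show "sets (borel :: real measure) = sigma_sets UNIV (range (\<lambda>x. {..x}))"
      by (subst borel_eq_atMost) simp
    show "Int_stable (range (\<lambda>x::real. {..x}))" by (auto simp: Int_stable_def intro!: exI[of _ "min _ _"])
    fix A assume "A \<in> range (\<lambda>x::real. {..x})"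
    then obtain x where A: "A = {..x}" by blast
    have "(\<lambda>y. ennreal (case_prod H y x)) \<in> borel_measurable (optional_algebra G)"
      by (rule measurable_compose[OF H_opt measurable_ennreal])
    then show "(\<lambda>y. emeasure (\<kappa> y) A) \<in> borel_measurable (optional_algebra G)"
      by (rule measurable_cong[THEN iffD1, rotated]) (auto simp: space_optional \<kappa>_Iic A)
  next
    fix y assume "y \<in> space (optional_algebra G)"
    then show "prob_space (\<kappa> y)" by (auto simp: space_optional intro: \<kappa>_prob)
    show "sets (\<kappa> y) = sets borel" by (simp add: \<kappa>_def)
  qed auto
  have "finite_part T \<bind> (\<lambda>\<omega>. \<kappa> (enn2real (T \<omega>), \<omega>)) = distr (finite_part T) borel (\<lambda>\<omega>. V (enn2real (T \<omega>), \<omega>))"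
    (is "?\<nu>1 = ?\<nu>2") if T: "stopping T" for T
  proof -
    let ?D = "finite_part T"
    let ?\<tau> = "\<lambda>\<omega>. enn2real (T \<omega>)"
    note stopping_measurable[OF T, measurable]
    interpret D: finite_measure ?D by (rule finite_measure_finite_part[OF T])
    have \<tau>: "(\<lambda>\<omega>. (?\<tau> \<omega>, \<omega>)) \<in> M \<rightarrow>\<^sub>M borel \<Otimes>\<^sub>M M" by measurable
    have VT: "(\<lambda>\<omega>. V (?\<tau> \<omega>, \<omega>)) \<in> borel_measurable M" by (rule measurable_compose[OF \<tau> V])
    have \<kappa>T: "(\<lambda>\<omega>. \<kappa> (?\<tau> \<omega>, \<omega>)) \<in> M \<rightarrow>\<^sub>M prob_algebra borel"
      by (rule measurable_compose[OF optional_at_stopping[OF T] \<kappa>])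
    have \<kappa>D: "(\<lambda>\<omega>. \<kappa> (?\<tau> \<omega>, \<omega>)) \<in> ?D \<rightarrow>\<^sub>M subprob_algebra borel"
      using measurable_prob_algebraD[OF \<kappa>T] by (simp cong: measurable_cong_sets)
    have VD: "(\<lambda>\<omega>. V (?\<tau> \<omega>, \<omega>)) \<in> borel_measurable ?D" using VT by (simp cong: measurable_cong_sets)
    have ne: "space ?D \<noteq> {}" using not_empty by simp
    have sets1: "sets ?\<nu>1 = sets borel" by (rule sets_bind_measurable[OF \<kappa>D ne])
    have fin1: "finite_borel_measure ?\<nu>1"
    proof (intro finite_borel_measure.intro finite_borel_measure_axioms.intro finite_measureI sets1)
      have "emeasure ?\<nu>1 (space ?\<nu>1) = (\<integral>\<^sup>+\<omega>. emeasure (\<kappa> (?\<tau> \<omega>, \<omega>)) UNIV \<partial>?D)"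
        using sets_eq_imp_space_eq[OF sets1] by (simp add: emeasure_bind[OF ne \<kappa>D])
      also have "\<dots> \<le> (\<integral>\<^sup>+\<omega>. 1 \<partial>?D)"
      proof (rule nn_integral_mono)
        fix \<omega> assume "\<omega> \<in> space ?D"
        then have "prob_space (\<kappa> (?\<tau> \<omega>, \<omega>))" by (intro \<kappa>_prob) auto
        then show "emeasure (\<kappa> (?\<tau> \<omega>, \<omega>)) UNIV \<le> 1" by (rule prob_space.emeasure_le_1)
      qed
      also have "\<dots> < \<infinity>" by (simp add: D.emeasure_eq_measure)
      finally show "emeasure ?\<nu>1 (space ?\<nu>1) \<noteq> \<infinity>" by simp
    qed
    have fin2: "finite_borel_measure ?\<nu>2"
      by (intro finite_borel_measure.intro finite_borel_measure_axioms.intro D.finite_measure_distr VD) simp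
    have "cdf ?\<nu>1 x = cdf ?\<nu>2 x" for x
    proof -
      let ?A = "\<lambda>q. {\<omega> \<in> space M. T \<omega> < \<infinity> \<and> V (?\<tau> \<omega>, \<omega>) \<le> q}"
      have A: "?A q \<in> sets M" for q using VT by measurable
      have inB: "{\<omega> \<in> space M. T \<omega> < \<infinity> \<and> (?\<tau> \<omega>, \<omega>) \<in> B q} = ?A q" for q
        by (auto simp: B_def space_pair_measure)
      have HT: "optional_process (\<lambda>t \<omega>. H t \<omega> x)" using H_opt[of x] by (simp add: split_beta')
      \<comment> \<open>Both distribution functions at \<open>x\<close> are limits along rationals that tend to \<open>x\<close> from the right.\<close>
      obtain q where q: "\<And>n. q n \<in> \<rat>" "\<And>n. x < q n" "q \<longlonglongrightarrow> x" by (rule rational_sequence_right) blast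
      have H_seq: "(\<lambda>n. Z' (q n) t \<omega>) \<longlonglongrightarrow> H t \<omega> x" if "0 \<le> t" "\<omega> \<in> space M" for t \<omega>
        unfolding H_def by (rule rational_cdf_seq[of "\<lambda>q. Z' q t \<omega>", OF cdf[OF that] q])
      have H01: "0 \<le> H t \<omega> x \<and> H t \<omega> x \<le> 1" if "0 \<le> t" "\<omega> \<in> space M" for t \<omega>
        using LIMSEQ_le_const[OF H_seq[OF that]] LIMSEQ_le_const2[OF H_seq[OF that]] Z'01 by blast
      have lim1: "(\<lambda>n. \<integral>\<omega>. stopped (Z' (q n)) T \<omega> \<partial>M) \<longlonglongrightarrow> (\<integral>\<omega>. stopped (\<lambda>t \<omega>. H t \<omega> x) T \<omega> \<partial>M)"
      proof (rule integral_dominated_convergence[where w = "\<lambda>_. 1"])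
        show "AE \<omega> in M. (\<lambda>n. stopped (Z' (q n)) T \<omega>) \<longlonglongrightarrow> stopped (\<lambda>t \<omega>. H t \<omega> x) T \<omega>"
          using AE_space by eventually_elim (intro tendsto_intros H_seq, auto)
        show "AE \<omega> in M. norm (stopped (Z' (q n)) T \<omega>) \<le> 1" for n
          using Z'01 by (auto simp: indicator_def)
      qed (simp_all only: stopped_measurable[OF HT T] stopped_measurable[OF Z'_opt T] integrable_const)
      have lim2: "(\<lambda>n. \<integral>\<omega>. indicator (?A (q n)) \<omega> \<partial>M) \<longlonglongrightarrow> (\<integral>\<omega>. (indicator (?A x) \<omega> :: real) \<partial>M)"
      proof (rule integral_dominated_convergence[where w = "\<lambda>_. 1"])
        show "(indicator (?A x) :: 'w \<Rightarrow> real) \<in> borel_measurable M" using A[of x] by (rule borel_measurable_indicator)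
        show "(indicator (?A (q n)) :: 'w \<Rightarrow> real) \<in> borel_measurable M" for n using A[of "q n"] by (rule borel_measurable_indicator)
        have "(\<lambda>n. indicator (?A (q n)) \<omega> :: real) \<longlonglongrightarrow> indicator (?A x) \<omega>" for \<omega>
        proof (rule tendsto_eventually)
          have "\<forall>\<^sub>F n in sequentially. V (?\<tau> \<omega>, \<omega>) \<le> q n \<longleftrightarrow> V (?\<tau> \<omega>, \<omega>) \<le> x"
          proof (cases "V (?\<tau> \<omega>, \<omega>) \<le> x")
            case True
            then have "V (?\<tau> \<omega>, \<omega>) \<le> q n" for n using q(2)[of n] by simp
            then show ?thesis using True by simp
          next
            case False
            then have "\<forall>\<^sub>F n in sequentially. q n < V (?\<tau> \<omega>, \<omega>)" by (intro order_tendstoD(2)[OF q(3)]) simp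
            then show ?thesis by eventually_elim (use False in auto)
          qed
          then show "\<forall>\<^sub>F n in sequentially. (indicator (?A (q n)) \<omega> :: real) = indicator (?A x) \<omega>"
            by eventually_elim (simp add: indicator_def)
        qed
        then show "AE \<omega> in M. (\<lambda>n. indicator (?A (q n)) \<omega> :: real) \<longlonglongrightarrow> indicator (?A x) \<omega>" by simp
      qed (auto simp: indicator_def)
      have E_n: "(\<integral>\<omega>. stopped (Z' (q n)) T \<omega> \<partial>M) = (\<integral>\<omega>. (indicator (?A (q n)) \<omega> :: real) \<partial>M)" for n
        using Z'E[OF T, of "q n"] A[of "q n"] unfolding inB by simp
      have "(\<integral>\<omega>. stopped (\<lambda>t \<omega>. H t \<omega> x) T \<omega> \<partial>M) = (\<integral>\<omega>. (indicator (?A x) \<omega> :: real) \<partial>M)"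
        by (rule LIMSEQ_unique[OF lim1]) (use lim2 in \<open>unfold E_n\<close>)
      also have "\<dots> = measure M (?A x)" using A[of x] by simp
      finally have E: "(\<integral>\<omega>. stopped (\<lambda>t \<omega>. H t \<omega> x) T \<omega> \<partial>M) = measure M (?A x)" .
      have "emeasure ?\<nu>1 {..x} = (\<integral>\<^sup>+\<omega>. emeasure (\<kappa> (?\<tau> \<omega>, \<omega>)) {..x} \<partial>?D)"
        by (rule emeasure_bind[OF ne \<kappa>D]) simp
      also have "\<dots> = (\<integral>\<^sup>+\<omega>. ennreal (H (?\<tau> \<omega>) \<omega> x) \<partial>?D)"
        by (intro nn_integral_cong) (simp add: \<kappa>_Iic)
      also have "\<dots> = (\<integral>\<^sup>+\<omega>. indicator {\<omega>. T \<omega> < \<infinity>} \<omega> * ennreal (H (?\<tau> \<omega>) \<omega> x) \<partial>M)"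
        using measurable_compose[OF optional_at_stopping[OF T] HT]
        by (intro nn_integral_finite_part[OF T]) simp
      also have "\<dots> = (\<integral>\<^sup>+\<omega>. ennreal (stopped (\<lambda>t \<omega>. H t \<omega> x) T \<omega>) \<partial>M)"
        by (intro nn_integral_cong) (simp add: indicator_def)
      also have "\<dots> = ennreal (\<integral>\<omega>. stopped (\<lambda>t \<omega>. H t \<omega> x) T \<omega> \<partial>M)"
      proof (rule nn_integral_eq_integral)
        show "integrable M (stopped (\<lambda>t \<omega>. H t \<omega> x) T)"
          using H01 by (intro integrable_const_bound[where B = 1] stopped_measurable[OF HT T]) (auto simp: indicator_def)
        show "AE \<omega> in M. 0 \<le> stopped (\<lambda>t \<omega>. H t \<omega> x) T \<omega>" using H01 by (auto simp: indicator_def)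
      qed
      also have "\<dots> = emeasure M (?A x)" unfolding E by (simp add: emeasure_eq_measure)
      also have "?A x = {\<omega> \<in> (\<lambda>\<omega>. V (?\<tau> \<omega>, \<omega>)) -` {..x} \<inter> space M. T \<omega> < \<infinity>}" by auto
      also have "emeasure M \<dots> = emeasure ?D ((\<lambda>\<omega>. V (?\<tau> \<omega>, \<omega>)) -` {..x} \<inter> space M)"
        by (intro emeasure_finite_part[OF T, symmetric] measurable_sets[OF VT]) simp
      also have "\<dots> = emeasure ?\<nu>2 {..x}" by (simp add: emeasure_distr[OF VD])
      finally show ?thesis by (simp add: cdf_def measure_def)
    qed
    then show ?thesis by (intro cdf_unique'[OF fin1 fin2] ext)
  qed
  then show ?thesis using \<kappa> by blast
qed

end

section \<open>A compact metric space as a Borel retract of the real line\<close>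

text \<open>
  A Cantor-type encoding of bits. Since every digit is \<open>0\<close> or \<open>1\<close> in base \<open>3\<close>, the tail is at most
  \<open>1/2\<close> and no carries occur; the bits can be read off by a Borel function.
\<close>

definition ternary :: "(nat \<Rightarrow> bool) \<Rightarrow> real" where
  "ternary b = (\<Sum>k. of_bool (b k) / 3 ^ Suc k)"

lemma ternary_summable: "summable (\<lambda>k. of_bool (b k) / 3 ^ Suc k :: real)"
proof (rule summable_comparison_test')
  show "summable (\<lambda>k. (1 / 3) ^ Suc k :: real)" by (simp add: summable_Suc_iff summable_geometric)
  show "norm (of_bool (b k) / 3 ^ Suc k :: real) \<le> (1 / 3) ^ Suc k" for k
    by (simp add: power_divide)
qed

lemma ternary_bounds: "0 \<le> ternary b" "ternary b \<le> 1 / 2"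
proof -
  show "0 \<le> ternary b" unfolding ternary_def by (intro suminf_nonneg ternary_summable) simp
  have s: "(\<lambda>k. (1 / 3) * (1 / 3) ^ k :: real) sums ((1 / 3) * (1 / (1 - 1 / 3)))"
    by (intro sums_mult geometric_sums) simp
  have "ternary b \<le> (\<Sum>k. (1 / 3) * (1 / 3) ^ k)" unfolding ternary_def
    by (intro suminf_le ternary_summable sums_summable[OF s]) (simp add: power_divide)
  also have "\<dots> = 1 / 2" using sums_unique[OF s] by simp
  finally show "ternary b \<le> 1 / 2" .
qed

lemma ternary_step: "3 * ternary b = of_bool (b 0) + ternary (\<lambda>k. b (Suc k))"
proof -
  have "ternary b = of_bool (b 0) / 3 + (\<Sum>k. of_bool (b (Suc k)) / 3 ^ Suc (Suc k))"
    unfolding ternary_def by (subst suminf_split_head[OF ternary_summable]) simp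
  also have "(\<Sum>k. of_bool (b (Suc k)) / 3 ^ Suc (Suc k)) = (\<Sum>k. (1 / 3) * (of_bool (b (Suc k)) / 3 ^ Suc k :: real))"
    by simp
  also have "\<dots> = (1 / 3) * ternary (\<lambda>k. b (Suc k))"
    unfolding ternary_def by (rule suminf_mult[OF ternary_summable])
  finally show ?thesis by simp
qed

definition ternary_digit :: "nat \<Rightarrow> real \<Rightarrow> bool" where
  "ternary_digit k r \<longleftrightarrow> \<lfloor>3 ^ Suc k * r\<rfloor> mod 3 = 1"

lemma ternary_shift: "\<exists>i::int. 3 ^ k * ternary b = of_int i + ternary (\<lambda>j. b (k + j))"
proof (induction k)
  case 0
  show ?case by (rule exI[of _ 0]) simp
next
  case (Suc k)
  then obtain i :: int where i: "3 ^ k * ternary b = of_int i + ternary (\<lambda>j. b (k + j))" by blast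
  have "3 ^ Suc k * ternary b = 3 * of_int i + 3 * ternary (\<lambda>j. b (k + j))" using i by simp
  also have "\<dots> = of_int (3 * i + of_bool (b k)) + ternary (\<lambda>j. b (Suc k + j))"
    unfolding ternary_step by simp
  finally show ?case by blast
qed

lemma ternary_digit_ternary: "ternary_digit k (ternary b) = b k"
proof -
  obtain i :: int where i: "3 ^ k * ternary b = of_int i + ternary (\<lambda>j. b (k + j))"
    using ternary_shift by blast
  have "3 ^ Suc k * ternary b = 3 * of_int i + 3 * ternary (\<lambda>j. b (k + j))" using i by simp
  also have "\<dots> = of_int (3 * i + of_bool (b k)) + ternary (\<lambda>j. b (Suc k + j))"
    unfolding ternary_step by simp
  finally have "\<lfloor>3 ^ Suc k * ternary b\<rfloor> = 3 * i + of_bool (b k)"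
    using ternary_bounds[of "\<lambda>j. b (Suc k + j)"] by (intro floor_unique) auto
  then show ?thesis unfolding ternary_digit_def by (cases "b k") auto
qed

lemma ternary_digit_measurable[measurable]: "Measurable.pred borel (ternary_digit k)"
  unfolding ternary_digit_def by measurable

lemma compact_dense_sequence:
  assumes "compact (UNIV :: 's::metric_space set)"
  obtains x :: "nat \<Rightarrow> 's::metric_space" where "\<And>y e. 0 < e \<Longrightarrow> \<exists>i. dist (x i) y < e"
proof -
  have "\<forall>n. \<exists>k. finite k \<and> (UNIV :: 's set) \<subseteq> (\<Union>x\<in>k. ball x (inverse (real (Suc n))))"
    using assms unfolding compact_eq_totally_bounded by simp
  then obtain k where k: "\<And>n. finite (k n)" "\<And>n. (UNIV :: 's set) \<subseteq> (\<Union>x\<in>k n. ball x (inverse (real (Suc n))))"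
    by metis
  define D where "D = (\<Union>n. k n)"
  have D: "countable D" unfolding D_def using k(1) by (auto intro: countable_finite)
  have near: "\<exists>d\<in>D. dist d y < e" if "0 < e" for y e
  proof -
    obtain n where n: "inverse (real (Suc n)) < e" using reals_Archimedean[OF \<open>0 < e\<close>] by blast
    have "y \<in> (\<Union>x\<in>k n. ball x (inverse (real (Suc n))))" using k(2) by blast
    then obtain d where "d \<in> k n" "dist d y < inverse (real (Suc n))" by auto
    then show ?thesis using n unfolding D_def by (intro bexI[of _ d]) auto
  qed
  then have ne: "D \<noteq> {}" using zero_less_one by blast
  show ?thesis
  proof (rule that[of "from_nat_into D"])
    fix y and e :: real assume "0 < e"
    then obtain d where "d \<in> D" "dist d y < e" using near by blast
    then show "\<exists>i. dist (from_nat_into D i) y < e" using from_nat_into_surj[OF D] by metis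
  qed
qed

text \<open>
  The bits of \<open>y\<close> record, for each \<open>n\<close> and each point \<open>x i\<close> of a dense sequence, whether \<open>x i\<close> is within
  \<open>(1/2) ^ n\<close> of \<open>y\<close>. Reading from a real number the first such \<open>i\<close> for each \<open>n\<close> gives Borel functions
  with countably many values that converge to \<open>y\<close> if the number encodes \<open>y\<close>. So the Borel map
  \<open>g\<close> is their limit where they form a Cauchy sequence, and constant elsewhere.
\<close>

theorem compact_metric_borel_retract:
  assumes comp: "compact (UNIV :: 's::metric_space set)"
  obtains h :: "'s::metric_space \<Rightarrow> real" and g :: "real \<Rightarrow> 's"
  where "h \<in> borel_measurable borel" "g \<in> borel_measurable borel" "\<And>y. 0 \<le> h y" "\<And>y. h y \<le> 1" "\<And>y. g (h y) = y"
proof -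
  obtain x :: "nat \<Rightarrow> 's" where x: "\<And>y e. 0 < e \<Longrightarrow> \<exists>i. dist (x i) y < e"
    by (rule compact_dense_sequence[OF comp]) blast
  define b where "b y k = (case prod_decode k of (n, i) \<Rightarrow> dist (x i) y < (1 / 2) ^ n)" for y k
  define h where "h y = ternary (b y)" for y
  define I where "I n r = (LEAST i. ternary_digit (prod_encode (n, i)) r)" for n r
  have I_meas[measurable]: "I n \<in> measurable borel (count_space UNIV)" for n
    unfolding I_def[abs_def] by measurable
  define c where "c n r = x (I n r)" for n r
  have close: "dist (c n (h y)) y < (1 / 2) ^ n" for n y
  proof -
    have digit: "ternary_digit (prod_encode (n, i)) (h y) \<longleftrightarrow> dist (x i) y < (1 / 2) ^ n" for i
      by (simp add: h_def ternary_digit_ternary b_def)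
    obtain i where "dist (x i) y < (1 / 2) ^ n" using x[of "(1 / 2) ^ n" y] by auto
    then have "ternary_digit (prod_encode (n, I n (h y))) (h y)"
      unfolding I_def using digit by (intro LeastI) blast
    then show ?thesis using digit by (simp add: c_def)
  qed
  have c_lim: "(\<lambda>n. c n (h y)) \<longlonglongrightarrow> y" for y
  proof (rule metric_LIMSEQ_I)
    fix e :: real assume "0 < e"
    then obtain n0 where n0: "(1 / 2) ^ n0 < e" using real_arch_pow_inv[of e "1/2"] by auto
    have "dist (c n (h y)) y < e" if "n0 \<le> n" for n
    proof -
      have "(1 / 2 :: real) ^ n \<le> (1 / 2) ^ n0" using that by (intro power_decreasing) auto
      then show ?thesis using close[of n y] n0 by linarith
    qed
    then show "\<exists>no. \<forall>n\<ge>no. dist (c n (h y)) y < e" by blast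
  qed
  define good where "good r \<longleftrightarrow> (\<forall>k. \<exists>n0. \<forall>m\<ge>n0. \<forall>n\<ge>n0. dist (c m r) (c n r) < inverse (real (Suc k)))" for r
  have good_Cauchy: "good r \<longleftrightarrow> Cauchy (\<lambda>n. c n r)" for r
  proof
    assume g: "good r"
    show "Cauchy (\<lambda>n. c n r)"
    proof (rule metric_CauchyI)
      fix e :: real assume "0 < e"
      then obtain k where k: "inverse (real (Suc k)) < e" using reals_Archimedean by blast
      obtain n0 where "\<And>m n. n0 \<le> m \<Longrightarrow> n0 \<le> n \<Longrightarrow> dist (c m r) (c n r) < inverse (real (Suc k))"
        using g unfolding good_def by blast
      then show "\<exists>M. \<forall>m\<ge>M. \<forall>n\<ge>M. dist (c m r) (c n r) < e" using k less_trans by blast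
    qed
  next
    assume "Cauchy (\<lambda>n. c n r)"
    then show "good r" unfolding good_def Cauchy_def by simp
  qed
  have good_meas[measurable]: "Measurable.pred borel good"
  proof -
    have [measurable]: "Measurable.pred borel (\<lambda>r. dist (c m r) (c n r) < e)" for m n and e :: real
    proof -
      have "(\<lambda>r. (\<lambda>j r. dist (c m r) (x j) < e) (I n r) r) \<in> measurable borel (count_space UNIV)"
      proof (rule measurable_compose_countable[OF _ I_meas])
        fix j
        show "Measurable.pred borel (\<lambda>r. dist (c m r) (x j) < e)"
          unfolding c_def by (rule measurable_compose[OF I_meas]) simp
      qed
      then show ?thesis by (simp add: c_def)
    qed
    show ?thesis unfolding good_def[abs_def] by measurable
  qed
  define g where "g r = (if good r then lim (\<lambda>n. c n r) else x 0)" for r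
  have "g \<in> borel_measurable borel"
  proof (rule borel_measurable_LIMSEQ_metric)
    fix n
    have "c n \<in> borel_measurable borel" unfolding c_def[abs_def]
      by (rule measurable_compose[OF I_meas]) simp
    then show "(\<lambda>r. if good r then c n r else x 0) \<in> borel_measurable borel" by measurable
  next
    fix r :: real
    show "(\<lambda>n. if good r then c n r else x 0) \<longlonglongrightarrow> g r"
    proof (cases "good r")
      case True
      then have "Cauchy (\<lambda>n. c n r)" using good_Cauchy by blast
      then have "convergent (\<lambda>n. c n r)"
        using compact_imp_complete[OF comp] unfolding complete_def convergent_def by blast
      then show ?thesis using True by (simp add: g_def convergent_LIMSEQ_iff)
    qed (simp add: g_def)
  qed
  moreover have "h \<in> borel_measurable borel"
  proof -
    have "(\<lambda>y. of_bool (b y k) / 3 ^ Suc k :: real) \<in> borel_measurable borel" for k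
    proof -
      obtain n i where k: "prod_decode k = (n, i)" by fastforce
      have "open {y. dist (x i) y < (1 / 2) ^ n}" using open_ball[of "x i" "(1 / 2) ^ n"] by (simp add: ball_def)
      then have [measurable]: "Measurable.pred borel (\<lambda>y. dist (x i) y < (1 / 2) ^ n)"
        by (simp add: pred_def borel_open)
      have "(\<lambda>y. (if dist (x i) y < (1 / 2) ^ n then 1 else 0) / 3 ^ Suc k :: real) \<in> borel_measurable borel"
        by measurable
      then show ?thesis by (simp add: b_def k of_bool_def)
    qed
    then show ?thesis unfolding h_def[abs_def] ternary_def by (rule borel_measurable_suminf)
  qed
  moreover have "0 \<le> h y" "h y \<le> 1" for y
    using ternary_bounds[of "b y"] by (simp_all add: h_def)
  moreover have "g (h y) = y" for y
    using c_lim[of y] good_Cauchy[of "h y"] LIMSEQ_imp_Cauchy[OF c_lim[of y]] by (simp add: g_def limI)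
  ultimately show ?thesis using that by blast
qed

section \<open>The conditional distribution process\<close>

context usual_filtration
begin

lemma ext_filtration_finite: "0 \<le> t \<Longrightarrow> ext_filtration G (ennreal t) = G t"
  by (simp add: ext_filtration_def)

text \<open>
  On an event \<open>A\<close> of the \<open>\<sigma>\<close>-algebra at \<open>T\<close>, postponing \<open>T\<close> to \<open>\<infinity>\<close> off \<open>A\<close> turns the integral over \<open>A\<close> into
  an expectation at a stopping time, so equality of expectations at all stopping times is the
  defining property of the conditional expectation.
\<close>

lemma optional_projectionI:
  assumes Z: "optional_process Z" and b: "\<And>t \<omega>. \<bar>Z t \<omega>\<bar> \<le> b"
    and \<xi>: "\<And>T. stopping T \<Longrightarrow> integrable M (stopped \<xi> T)"
    and E: "\<And>T. stopping T \<Longrightarrow> (\<integral>\<omega>. stopped Z T \<omega> \<partial>M) = (\<integral>\<omega>. stopped \<xi> T \<omega> \<partial>M)"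
  shows "is_optional_projection M G \<xi> Z"
  unfolding is_optional_projection_def
proof (intro conjI allI impI Z)
  fix T assume T: "stopping T"
  interpret F: filtration "space M" "ext_filtration G" by (rule filtration_ext_filtration[OF filt])
  let ?P = "F.pre_sigma T"
  have ext_G: "A \<in> sets (ext_filtration G \<infinity>)" if "0 \<le> t" "A \<in> sets (G t)" for A t
  proof -
    have "sets (ext_filtration G (ennreal t)) \<subseteq> sets (ext_filtration G \<infinity>)" by (rule F.sets_F_mono) simp
    then show ?thesis using that by (auto simp: ext_filtration_finite)
  qed
  have ext_M: "sets (ext_filtration G \<infinity>) \<subseteq> sets M"
  proof -
    have "(\<Union>t\<in>{0..}. sets (G t)) \<subseteq> sets M" using sets_G_M by blast
    then have "sigma_sets (space M) (\<Union>t\<in>{0..}. sets (G t)) \<subseteq> sets M" by (rule sets.sigma_sets_subset)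
    moreover have "(\<Union>t\<in>{0..}. sets (G t)) \<subseteq> Pow (space M)"
      using sets_G_M sets.sets_into_space by blast
    ultimately show ?thesis by (simp add: ext_filtration_def space_G sets_measure_of)
  qed
  have at_most: "{\<omega> \<in> A. T \<omega> \<le> ennreal t} \<in> sets (G t)" if "A \<in> sets ?P" "0 \<le> t" for A t
    using F.sets_pre_sigmaD[OF T that(1), of "ennreal t"] that(2) by (simp add: ext_filtration_finite)
  have P_space: "space ?P = space M" by (rule F.space_pre_sigma)
  have P_M: "A \<in> sets M" if "A \<in> sets ?P" for A
    using F.sets_pre_sigmaD[OF T that, of \<infinity>] ext_M by auto
  interpret P: finite_measure_subalgebra M ?P
    by unfold_locales (use P_space P_M in \<open>auto simp: subalgebra_def\<close>)
  have int: "integrable M (stopped Z T)" by (rule stopped_integrable[OF Z T b])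
  have meas: "stopped Z T \<in> borel_measurable ?P"
  proof (rule borel_measurableI_le)
    fix x
    let ?S = "{\<omega> \<in> space ?P. stopped Z T \<omega> \<le> x}"
    have fin: "{\<omega> \<in> ?S. T \<omega> \<le> ennreal t} \<in> sets (G t)" if t: "0 \<le> t" for t
    proof -
      let ?A = "{y \<in> space (optional_algebra G). case_prod Z y \<le> x}"
      have A: "?A \<in> sets (optional_algebra G)" using Z by measurable
      have "T \<omega> < \<infinity>" if "T \<omega> \<le> ennreal t" for \<omega> using that by (rule le_less_trans) simp
      then have "{\<omega> \<in> ?S. T \<omega> \<le> ennreal t} = {\<omega> \<in> space M. (enn2real (T \<omega>), \<omega>) \<in> ?A \<and> T \<omega> \<le> ennreal t}"
        by (auto simp: P_space space_optional indicator_def)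
      then show ?thesis using optional_at_stopping_adapted[OF T A t] by simp
    qed
    show "?S \<in> sets ?P"
    proof (rule F.sets_pre_sigmaI[OF T])
      fix u
      show "{\<omega> \<in> ?S. T \<omega> \<le> u} \<in> sets (ext_filtration G u)"
      proof (cases "u = \<infinity>")
        case False
        then have u: "u = ennreal (enn2real u)" by (simp add: less_top)
        show ?thesis using fin[of "enn2real u"] ext_filtration_finite[of "enn2real u"] u by simp
      next
        case True
        have fin_T: "T \<omega> < \<infinity> \<longleftrightarrow> (\<exists>n. T \<omega> \<le> ennreal (real n))" for \<omega>
        proof
          assume "T \<omega> < \<infinity>"
          then obtain r where r: "T \<omega> = ennreal r" "0 \<le> r" by (cases "T \<omega>") auto
          obtain n where "r \<le> real n" using real_arch_simple by blast
          then show "\<exists>n. T \<omega> \<le> ennreal (real n)" using r by (auto intro: ennreal_leI)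
        qed (auto intro: le_less_trans)
        have "{\<omega> \<in> ?S. T \<omega> \<le> ennreal (real n)} \<in> sets (ext_filtration G \<infinity>)" for n
          by (rule ext_G[OF _ fin]) simp_all
        then have a: "(\<Union>n. {\<omega> \<in> ?S. T \<omega> \<le> ennreal (real n)}) \<in> sets (ext_filtration G \<infinity>)"
          by (intro sets.countable_UN) blast
        have b: "space M - (\<Union>n. {\<omega> \<in> space M. T \<omega> \<le> ennreal (real n)}) \<in> sets (ext_filtration G \<infinity>)"
        proof (rule sets.Diff)
          show "space M \<in> sets (ext_filtration G \<infinity>)" using ext_G[of 0] space_in_G[of 0] by simp
          have "{\<omega> \<in> space M. T \<omega> \<le> ennreal (real n)} \<in> sets (ext_filtration G \<infinity>)" for n
            by (rule ext_G[OF _ stoppingD[OF T]]) simp_all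
          then show "(\<Union>n. {\<omega> \<in> space M. T \<omega> \<le> ennreal (real n)}) \<in> sets (ext_filtration G \<infinity>)"
            by (intro sets.countable_UN) blast
        qed
        have eq: "?S = (\<Union>n. {\<omega> \<in> ?S. T \<omega> \<le> ennreal (real n)}) \<union>
            (if 0 \<le> x then space M - (\<Union>n. {\<omega> \<in> space M. T \<omega> \<le> ennreal (real n)}) else {})"
        proof -
          have "\<omega> \<in> ?S \<longleftrightarrow> \<omega> \<in> ?S \<and> T \<omega> < \<infinity> \<or> 0 \<le> x \<and> \<omega> \<in> space M \<and> \<not> T \<omega> < \<infinity>" for \<omega>
            by (cases "T \<omega> < \<infinity>") (simp_all add: P_space indicator_def conj_commute)
          then show ?thesis unfolding fin_T by (intro set_eqI) (auto split: if_splits)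
        qed
        have "?S \<in> sets (ext_filtration G \<infinity>)"
          by (rule back_subst[of "\<lambda>S. S \<in> sets (ext_filtration G \<infinity>)", OF _ eq[symmetric]])
            (use a b in \<open>simp split: if_split\<close>)
        then show ?thesis using True by simp
      qed
    qed
  qed
  have "AE \<omega> in M. real_cond_exp M ?P (stopped \<xi> T) \<omega> = stopped Z T \<omega>"
  proof (rule P.real_cond_exp_charact[OF _ \<xi>[OF T] int meas])
    fix A assume A: "A \<in> sets ?P"
    define T' where "T' \<omega> = (if \<omega> \<in> A then T \<omega> else \<infinity>)" for \<omega>
    have A_sub: "A \<subseteq> space M" using P_M[OF A] by (rule sets.sets_into_space)
    have T': "stopping T'" unfolding T'_def
    proof (rule stopping_restrict[OF T])
      fix t :: real assume "0 \<le> t"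
      moreover have "{\<omega> \<in> space M. \<omega> \<in> A \<and> T \<omega> \<le> ennreal t} = {\<omega> \<in> A. T \<omega> \<le> ennreal t}" using A_sub by auto
      ultimately show "{\<omega> \<in> space M. \<omega> \<in> A \<and> T \<omega> \<le> ennreal t} \<in> sets (G t)" using at_most[OF A] by simp
    qed
    have "(\<integral>\<omega>\<in>A. stopped Z' T \<omega> \<partial>M) = (\<integral>\<omega>. stopped Z' T' \<omega> \<partial>M)" for Z'
      unfolding set_lebesgue_integral_def
      by (intro Bochner_Integration.integral_cong refl) (simp add: T'_def indicator_def)
    then show "(\<integral>\<omega>\<in>A. stopped \<xi> T \<omega> \<partial>M) = (\<integral>\<omega>\<in>A. stopped Z T \<omega> \<partial>M)" using E[OF T'] by simp
  qed
  then show "AE \<omega> in M. stopped Z T \<omega> = real_cond_exp M ?P (stopped \<xi> T) \<omega>"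
    by (rule AE_symmetric)
qed

text \<open>
  Two projections agree almost surely at each stopping time, so the section theorem applies to the
  optional set where they differ.
\<close>

lemma optional_projection_unique:
  assumes Z: "is_optional_projection M G \<xi> Z" and Z': "is_optional_projection M G \<xi> Z'"
  shows "AE \<omega> in M. \<forall>t\<ge>0. Z t \<omega> = Z' t \<omega>"
proof -
  define A where "A = {x \<in> space (optional_algebra G). case_prod Z x \<noteq> case_prod Z' x}"
  have opt: "optional_process Z" "optional_process Z'" using Z Z' by (auto simp: is_optional_projection_def)
  have A: "A \<in> sets (optional_algebra G)" unfolding A_def using opt by measurable
  have "AE \<omega> in M. \<forall>t. (t, \<omega>) \<notin> A"
  proof (rule optional_cross_section[OF A])
    fix T assume T: "stopping T"
    let ?c = "real_cond_exp M (filtration.pre_sigma (space M) (ext_filtration G) T) (stopped \<xi> T)"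
    have "AE \<omega> in M. stopped Z T \<omega> = ?c \<omega>" "AE \<omega> in M. stopped Z' T \<omega> = ?c \<omega>"
      using Z Z' T unfolding is_optional_projection_def by blast+
    then show "AE \<omega> in M. T \<omega> < \<infinity> \<longrightarrow> (enn2real (T \<omega>), \<omega>) \<notin> A"
    proof eventually_elim
      case (elim \<omega>)
      then have "stopped Z T \<omega> = stopped Z' T \<omega>" by simp
      then show ?case by (auto simp: A_def)
    qed
  qed
  then show ?thesis using AE_space
  proof eventually_elim
    case (elim \<omega>)
    then show ?case by (auto simp: A_def space_optional)
  qed
qed

text \<open>
  The kernel for \<open>h (X t)\<close> is pushed forward by \<open>g\<close>. Conditional probability at a deterministic time
  \<open>t\<close> is the special case of stopping times that equal \<open>t\<close> on an event of \<open>G t\<close> and \<open>\<infinity>\<close> elsewhere.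
\<close>

theorem conditional_distribution_exists:
  fixes X :: "real \<Rightarrow> 'w \<Rightarrow> 's::metric_space"
  assumes comp: "compact (UNIV :: 's set)"
    and X: "case_prod X \<in> borel_measurable (restrict_space borel {0..} \<Otimes>\<^sub>M M)"
  shows "\<exists>\<pi> :: real \<Rightarrow> 'w \<Rightarrow> 's measure. conditional_distribution_process M G X \<pi> \<and>
    (\<forall>\<phi> :: 's \<Rightarrow> real. \<phi> \<in> borel_measurable borel \<longrightarrow> bounded (range \<phi>) \<longrightarrow>
      is_optional_projection M G (\<lambda>t \<omega>. \<phi> (X t \<omega>)) (\<lambda>t \<omega>. \<integral>x. \<phi> x \<partial>\<pi> t \<omega>))"
proof -
  obtain h :: "'s \<Rightarrow> real" and g :: "real \<Rightarrow> 's" where h: "h \<in> borel_measurable borel"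
    and g: "g \<in> borel_measurable borel" and h01: "\<And>y. 0 \<le> h y" "\<And>y. h y \<le> 1" and gh: "\<And>y. g (h y) = y"
    by (rule compact_metric_borel_retract[OF comp]) blast
  have clamp: "(\<lambda>(t, \<omega>). (max 0 t :: real, \<omega>)) \<in> borel \<Otimes>\<^sub>M M \<rightarrow>\<^sub>M restrict_space borel {0..} \<Otimes>\<^sub>M M"
    unfolding split_beta'
  proof (rule measurable_Pair)
    show "(\<lambda>x. max 0 (fst x) :: real) \<in> borel \<Otimes>\<^sub>M M \<rightarrow>\<^sub>M restrict_space borel {0..}"
      by (rule measurable_restrict_space2) auto
  qed simp
  have X0: "(\<lambda>(t, \<omega>). X (max 0 t) \<omega>) \<in> borel_measurable (borel \<Otimes>\<^sub>M M)"
    using measurable_compose[OF clamp X] by (simp add: split_beta')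
  \<comment> \<open>Freezing the path before time \<open>0\<close> makes the process measurable on the whole line.\<close>
  define V where "V = (\<lambda>(t, \<omega>). h (X (max 0 t) \<omega>))"
  have V: "V \<in> borel_measurable (borel \<Otimes>\<^sub>M M)"
    using measurable_compose[OF X0 h] by (simp add: V_def split_beta')
  have V01: "0 \<le> V x" "V x \<le> 1" for x using h01 by (auto simp: V_def split_beta')
  obtain \<kappa> where \<kappa>: "\<kappa> \<in> optional_algebra G \<rightarrow>\<^sub>M prob_algebra borel"
    and \<kappa>_law: "\<And>T. stopping T \<Longrightarrow> finite_part T \<bind> (\<lambda>\<omega>. \<kappa> (enn2real (T \<omega>), \<omega>)) =
      distr (finite_part T) borel (\<lambda>\<omega>. V (enn2real (T \<omega>), \<omega>))"
    using optional_kernel[OF V V01] by blast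
  \<comment> \<open>Outside the domain of the optional sets any fixed probability measure serves as a default.\<close>
  define \<pi> :: "real \<Rightarrow> 'w \<Rightarrow> 's measure" where
    "\<pi> t \<omega> = (if 0 \<le> t \<and> \<omega> \<in> space M then distr (\<kappa> (t, \<omega>)) borel g else return borel (g 0))" for t \<omega>
  have \<kappa>_space: "sets (\<kappa> (t, \<omega>)) = sets borel" "prob_space (\<kappa> (t, \<omega>))" if "0 \<le> t" "\<omega> \<in> space M" for t \<omega>
    using measurable_space[OF \<kappa>, of "(t, \<omega>)"] that by (auto simp: space_optional space_prob_algebra)
  have \<pi>_opt: "case_prod \<pi> \<in> optional_algebra G \<rightarrow>\<^sub>M prob_algebra borel"
    using measurable_compose[OF \<kappa> measurable_distr_prob_space[OF g]]
    by (rule measurable_cong[THEN iffD1, rotated]) (auto simp: space_optional \<pi>_def)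
  have g\<kappa>: "g \<in> \<kappa> (t, \<omega>) \<rightarrow>\<^sub>M borel" if "0 \<le> t" "\<omega> \<in> space M" for t \<omega>
    using g \<kappa>_space(1)[OF that] by (simp cong: measurable_cong_sets)
  have \<pi>_prob: "prob_space (\<pi> t \<omega>)" "sets (\<pi> t \<omega>) = sets borel" for t \<omega>
    using prob_space.prob_space_distr[OF \<kappa>_space(2) g\<kappa>, of t \<omega>]
    by (auto simp: \<pi>_def prob_space_return)
  have XM: "X t \<in> borel_measurable M" if "0 \<le> t" for t
  proof -
    have "(\<lambda>\<omega>. (t, \<omega>)) \<in> M \<rightarrow>\<^sub>M borel \<Otimes>\<^sub>M M" by measurable
    from measurable_compose[OF this X0] show ?thesis using that by simp
  qed
  have proj: "optional_process (\<lambda>t \<omega>. \<integral>x. \<phi> x \<partial>\<pi> t \<omega>)"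
      "\<And>t \<omega>. \<bar>\<integral>x. \<phi> x \<partial>\<pi> t \<omega>\<bar> \<le> b"
      "\<And>T. stopping T \<Longrightarrow> integrable M (stopped (\<lambda>t \<omega>. \<phi> (X t \<omega>)) T)"
      "\<And>T. stopping T \<Longrightarrow> (\<integral>\<omega>. stopped (\<lambda>t \<omega>. \<integral>x. \<phi> x \<partial>\<pi> t \<omega>) T \<omega> \<partial>M) = (\<integral>\<omega>. stopped (\<lambda>t \<omega>. \<phi> (X t \<omega>)) T \<omega> \<partial>M)"
    if \<phi>: "\<phi> \<in> borel_measurable borel" and b: "\<And>x. \<bar>\<phi> x\<bar> \<le> b" for \<phi> :: "'s \<Rightarrow> real" and b
  proof -
    show opt: "optional_process (\<lambda>t \<omega>. \<integral>x. \<phi> x \<partial>\<pi> t \<omega>)"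
      using measurable_compose[OF measurable_prob_algebraD[OF \<pi>_opt] integral_measurable_subprob_algebra[OF \<phi>]]
      by (simp add: split_beta')
    show "\<bar>\<integral>x. \<phi> x \<partial>\<pi> t \<omega>\<bar> \<le> b" for t \<omega>
    proof -
      interpret P: prob_space "\<pi> t \<omega>" by (rule \<pi>_prob)
      have "integrable (\<pi> t \<omega>) \<phi>"
        using \<phi> b \<pi>_prob(2)[of t \<omega>] by (intro P.integrable_const_bound[where B = b]) (auto cong: measurable_cong_sets)
      then have "\<bar>\<integral>x. \<phi> x \<partial>\<pi> t \<omega>\<bar> \<le> (\<integral>x. \<bar>\<phi> x\<bar> \<partial>\<pi> t \<omega>)" by (intro integral_abs_bound)
      also have "\<dots> \<le> (\<integral>x. b \<partial>\<pi> t \<omega>)"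
        using \<open>integrable (\<pi> t \<omega>) \<phi>\<close> b by (intro integral_mono) auto
      also have "\<dots> = b" by (simp add: P.prob_space)
      finally show ?thesis .
    qed
    fix T assume T: "stopping T"
    let ?\<tau> = "\<lambda>\<omega>. enn2real (T \<omega>)"
    note stopping_measurable[OF T, measurable]
    have \<tau>: "(\<lambda>\<omega>. (?\<tau> \<omega>, \<omega>)) \<in> M \<rightarrow>\<^sub>M borel \<Otimes>\<^sub>M M" by measurable
    have XT: "(\<lambda>\<omega>. X (?\<tau> \<omega>) \<omega>) \<in> borel_measurable M"
      using measurable_compose[OF \<tau> X0] by simp
    have \<phi>X: "(\<lambda>\<omega>. \<phi> (X (?\<tau> \<omega>) \<omega>)) \<in> borel_measurable M" by (rule measurable_compose[OF XT \<phi>])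
    show "integrable M (stopped (\<lambda>t \<omega>. \<phi> (X t \<omega>)) T)"
    proof (rule integrable_const_bound[where B = b])
      have "0 \<le> b" using order_trans[OF abs_ge_zero b] .
      then show "AE \<omega> in M. norm (stopped (\<lambda>t \<omega>. \<phi> (X t \<omega>)) T \<omega>) \<le> b"
        using b by (auto simp: indicator_def)
      have "(\<lambda>\<omega>. \<phi> (X (?\<tau> \<omega>) \<omega>) * (if T \<omega> < \<infinity> then 1 else 0)) \<in> borel_measurable M" using \<phi>X by measurable
      then show "stopped (\<lambda>t \<omega>. \<phi> (X t \<omega>)) T \<in> borel_measurable M" by (simp add: indicator_def[abs_def] of_bool_def)
    qed
    let ?D = "finite_part T"
    have \<phi>g: "(\<lambda>r. \<phi> (g r)) \<in> borel_measurable borel" by (rule measurable_compose[OF g \<phi>])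
    have VT: "(\<lambda>\<omega>. V (?\<tau> \<omega>, \<omega>)) \<in> borel_measurable ?D"
      using measurable_compose[OF \<tau> V] by (simp cong: measurable_cong_sets)
    have \<kappa>D: "(\<lambda>\<omega>. \<kappa> (?\<tau> \<omega>, \<omega>)) \<in> ?D \<rightarrow>\<^sub>M subprob_algebra borel"
      using measurable_prob_algebraD[OF measurable_compose[OF optional_at_stopping[OF T] \<kappa>]]
      by (simp cong: measurable_cong_sets)
    have "(\<integral>\<omega>. stopped (\<lambda>t \<omega>. \<integral>x. \<phi> x \<partial>\<pi> t \<omega>) T \<omega> \<partial>M) = (\<integral>\<omega>. (\<integral>x. \<phi> x \<partial>\<pi> (?\<tau> \<omega>) \<omega>) \<partial>?D)"
      using measurable_compose[OF optional_at_stopping[OF T] opt]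
      by (intro integral_finite_part[OF T, symmetric]) simp
    also have "\<dots> = (\<integral>\<omega>. (\<integral>r. \<phi> (g r) \<partial>\<kappa> (?\<tau> \<omega>, \<omega>)) \<partial>?D)"
    proof (rule Bochner_Integration.integral_cong[OF refl])
      fix \<omega> assume "\<omega> \<in> space ?D"
      then have \<omega>: "\<omega> \<in> space M" by simp
      show "(\<integral>x. \<phi> x \<partial>\<pi> (?\<tau> \<omega>) \<omega>) = (\<integral>r. \<phi> (g r) \<partial>\<kappa> (?\<tau> \<omega>, \<omega>))"
        using \<phi> \<omega> g\<kappa>[OF enn2real_nonneg \<omega>] by (simp add: \<pi>_def integral_distr)
    qed
    also have "\<dots> = (\<integral>r. \<phi> (g r) \<partial>(?D \<bind> (\<lambda>\<omega>. \<kappa> (?\<tau> \<omega>, \<omega>))))"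
    proof (rule integral_bind[symmetric, where K = borel and B' = 1 and B = b])
      show "AE \<omega> in ?D. emeasure (\<kappa> (?\<tau> \<omega>, \<omega>)) (space (\<kappa> (?\<tau> \<omega>, \<omega>))) \<le> ennreal 1"
        using AE_space
      proof eventually_elim
        case (elim \<omega>)
        then have "prob_space (\<kappa> (?\<tau> \<omega>, \<omega>))" by (intro \<kappa>_space) auto
        then show ?case using prob_space.emeasure_le_1 by simp
      qed
    qed (use \<phi>g b \<kappa>D finite_measure_finite_part[OF T] in auto)
    also have "\<dots> = (\<integral>\<omega>. \<phi> (g (V (?\<tau> \<omega>, \<omega>))) \<partial>?D)"
      unfolding \<kappa>_law[OF T] by (rule integral_distr[OF VT \<phi>g])
    also have "\<dots> = (\<integral>\<omega>. \<phi> (X (?\<tau> \<omega>) \<omega>) \<partial>?D)" by (simp add: V_def gh)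
    also have "\<dots> = (\<integral>\<omega>. stopped (\<lambda>t \<omega>. \<phi> (X t \<omega>)) T \<omega> \<partial>M)"
      by (rule integral_finite_part[OF T \<phi>X])
    finally show "(\<integral>\<omega>. stopped (\<lambda>t \<omega>. \<integral>x. \<phi> x \<partial>\<pi> t \<omega>) T \<omega> \<partial>M) = (\<integral>\<omega>. stopped (\<lambda>t \<omega>. \<phi> (X t \<omega>)) T \<omega> \<partial>M)" .
  qed
  have "conditional_distribution_process M G X \<pi>"
    unfolding conditional_distribution_process_def
  proof (intro allI impI conjI ballI)
    fix t :: real assume t: "0 \<le> t"
    show \<pi>t: "\<pi> t \<in> G t \<rightarrow>\<^sub>M prob_algebra borel"
      using measurable_compose[OF optional_section[OF t] \<pi>_opt] by simp
    fix A :: "'s set" assume A: "A \<in> sets borel"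
    interpret P: finite_measure_subalgebra M "G t" by unfold_locales (rule subalg_G[OF t])
    have ind: "(indicator A :: 's \<Rightarrow> real) \<in> borel_measurable borel" using A by measurable
    have ind1: "\<bar>indicator A x :: real\<bar> \<le> 1" for x by (simp add: indicator_def)
    have int\<pi>: "(\<integral>x. indicator A x \<partial>\<pi> s \<omega>) = measure (\<pi> s \<omega>) A" for s \<omega>
      using A \<pi>_prob(2)[of s \<omega>] by simp
    have meas: "(\<lambda>\<omega>. measure (\<pi> t \<omega>) A) \<in> borel_measurable (G t)"
      by (rule measurable_compose[OF \<pi>t measurable_measure_prob_algebra[OF A]])
    have XA: "(indicator {\<omega>. X t \<omega> \<in> A} :: 'w \<Rightarrow> real) \<in> borel_measurable M"
    proof -
      have "(\<lambda>\<omega>. indicator A (X t \<omega>) :: real) \<in> borel_measurable M" by (rule measurable_compose[OF XM[OF t] ind])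
      then show ?thesis by (simp add: indicator_def[abs_def])
    qed
    have "AE \<omega> in M. real_cond_exp M (G t) (indicator {\<omega>. X t \<omega> \<in> A}) \<omega> = measure (\<pi> t \<omega>) A"
    proof (rule P.real_cond_exp_charact[OF _ _ _ meas])
      show "integrable M (indicator {\<omega>. X t \<omega> \<in> A} :: 'w \<Rightarrow> real)"
        by (rule integrable_const_bound[where B = 1, OF _ XA]) (simp add: indicator_def)
      show "integrable M (\<lambda>\<omega>. measure (\<pi> t \<omega>) A)"
        using prob_space.prob_le_1[OF \<pi>_prob(1)]
        by (intro integrable_const_bound[where B = 1, OF _ measurable_G_M[OF t meas]]) simp
      fix C assume C: "C \<in> sets (G t)"
      define T where "T \<omega> = (if \<omega> \<in> C then ennreal t else \<infinity>)" for \<omega>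
      have T: "stopping T"
        unfolding T_def
      proof (rule stopping_restrict)
        show "stopping (\<lambda>_. ennreal t)" by (rule stopping_time_const)
        fix s :: real assume s: "0 \<le> s"
        have C_sub: "C \<subseteq> space M" using sets.sets_into_space[OF C] t by (simp add: space_G)
        show "{\<omega> \<in> space M. \<omega> \<in> C \<and> ennreal t \<le> ennreal s} \<in> sets (G s)"
        proof (cases "t \<le> s")
          case True
          have "{\<omega> \<in> space M. \<omega> \<in> C \<and> ennreal t \<le> ennreal s} = C" using C_sub True s by (auto simp: ennreal_le_iff)
          then show ?thesis using sets_G_mono[OF t True C] by simp
        next
          case False
          then have "\<not> ennreal t \<le> ennreal s" using s by (simp add: ennreal_le_iff)
          then show ?thesis by simp
        qed
      qed
      have "(\<integral>\<omega>\<in>C. indicator {\<omega>. X t \<omega> \<in> A} \<omega> \<partial>M) = (\<integral>\<omega>. stopped (\<lambda>t \<omega>. indicator A (X t \<omega>)) T \<omega> \<partial>M)"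
        unfolding set_lebesgue_integral_def
        using t by (intro Bochner_Integration.integral_cong refl) (simp add: T_def indicator_def)
      also have "\<dots> = (\<integral>\<omega>. stopped (\<lambda>t \<omega>. \<integral>x. indicator A x \<partial>\<pi> t \<omega>) T \<omega> \<partial>M)"
        by (rule proj(4)[OF ind ind1 T, symmetric])
      also have "\<dots> = (\<integral>\<omega>\<in>C. measure (\<pi> t \<omega>) A \<partial>M)"
        unfolding set_lebesgue_integral_def int\<pi>
        using t by (intro Bochner_Integration.integral_cong refl) (simp add: T_def indicator_def)
      finally show "(\<integral>\<omega>\<in>C. indicator {\<omega>. X t \<omega> \<in> A} \<omega> \<partial>M) = (\<integral>\<omega>\<in>C. measure (\<pi> t \<omega>) A \<partial>M)" .
    qed
    then show "AE \<omega> in M. measure (\<pi> t \<omega>) A = real_cond_exp M (G t) (indicator {\<omega>. X t \<omega> \<in> A}) \<omega>"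
      by (rule AE_symmetric)
  qed
  moreover have "is_optional_projection M G (\<lambda>t \<omega>. \<phi> (X t \<omega>)) (\<lambda>t \<omega>. \<integral>x. \<phi> x \<partial>\<pi> t \<omega>)"
    if \<phi>: "\<phi> \<in> borel_measurable borel" "bounded (range \<phi>)" for \<phi> :: "'s \<Rightarrow> real"
  proof -
    obtain b where b: "\<And>x. \<bar>\<phi> x\<bar> \<le> b" using \<phi>(2) by (auto simp: bounded_iff)
    show ?thesis by (rule optional_projectionI[OF proj(1,2,3,4)[OF \<phi>(1) b]])
  qed
  ultimately show ?thesis by blast
qed

end

lemma usual_filtration_obs:
  assumes "prob_space M" and Y: "\<And>t. t \<ge> 0 \<Longrightarrow> Y t \<in> M \<rightarrow>\<^sub>M E"
    and rc: "right_continuous (obs_filtration M E Y)"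
  shows "usual_filtration M (obs_filtration M E Y)"
proof -
  interpret prob_space M by fact
  let ?gen = "\<lambda>t. {Y s -` B \<inter> space M | s B. s \<in> {0..t} \<and> B \<in> sets E} \<union> null_sets M"
  have gen_M: "?gen t \<subseteq> sets M" for t
  proof
    fix A assume "A \<in> ?gen t"
    then consider s B where "A = Y s -` B \<inter> space M" "0 \<le> s" "B \<in> sets E" | "A \<in> null_sets M" by auto
    then show "A \<in> sets M" by cases (auto intro: measurable_sets[OF Y])
  qed
  then have gen_Pow: "?gen t \<subseteq> Pow (space M)" for t using sets.space_closed[of M] by (rule order_trans)
  have sets_obs: "sets (obs_filtration M E Y t) = sigma_sets (space M) (?gen t)" for t
    unfolding obs_filtration_def by (rule sets_measure_of[OF gen_Pow])
  have space_obs: "space (obs_filtration M E Y t) = space M" for t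
    unfolding obs_filtration_def by (rule space_measure_of[OF gen_Pow])
  show ?thesis
  proof
    show "right_continuous (obs_filtration M E Y)" by fact
    show "null_sets M \<subseteq> sets (obs_filtration M E Y 0)"
      unfolding sets_obs by (auto intro: sigma_sets.Basic)
    show "filtration_on M (obs_filtration M E Y)"
      unfolding filtration_on_def subalgebra_def space_obs sets_obs
    proof (intro conjI allI impI refl)
      show "sigma_sets (space M) (?gen t) \<subseteq> sets M" for t
        by (rule sets.sigma_sets_subset[OF gen_M])
      fix s t :: real assume "0 \<le> s" "s \<le> t"
      then have "?gen s \<subseteq> ?gen t" by fastforce
      then show "sigma_sets (space M) (?gen s) \<subseteq> sigma_sets (space M) (?gen t)" by (rule sigma_sets_mono')
    qed
  qed
qed

theorem theorem1:
  fixes M :: "'w measure"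
    and F :: "real \<Rightarrow> 'w measure"
    and X :: "real \<Rightarrow> 'w \<Rightarrow> 's::metric_space"
    and E :: "'y measure"
    and Y :: "real \<Rightarrow> 'w \<Rightarrow> 'y"
  assumes "prob_space M"
    and "filtration_on M F"
    and "right_continuous F"
    and "sets M = sigma_sets (space M) (\<Union>t\<in>{0..}. sets (F t))"
    and "null_sets M \<subseteq> sets (F 0)"
    and "compact (UNIV :: 's set)"
    and "\<And>t. t \<ge> 0 \<Longrightarrow> X t \<in> borel_measurable (F t)"
    and "case_prod X \<in> borel_measurable (restrict_space borel {0..} \<Otimes>\<^sub>M M)"
    and "\<And>t. t \<ge> 0 \<Longrightarrow> Y t \<in> M \<rightarrow>\<^sub>M E"
    and "right_continuous (obs_filtration M E Y)"
  shows "\<exists>\<pi> :: real \<Rightarrow> 'w \<Rightarrow> 's measure.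
     conditional_distribution_process M (obs_filtration M E Y) X \<pi> \<and>
     (\<forall>\<phi> :: 's \<Rightarrow> real. \<phi> \<in> borel_measurable borel \<longrightarrow> bounded (range \<phi>) \<longrightarrow>
        (\<exists>Z. is_optional_projection M (obs_filtration M E Y) (\<lambda>t \<omega>. \<phi> (X t \<omega>)) Z) \<and>
        (\<forall>Z. is_optional_projection M (obs_filtration M E Y) (\<lambda>t \<omega>. \<phi> (X t \<omega>)) Z \<longrightarrow>
           (AE \<omega> in M. \<forall>t\<ge>0. (\<integral>x. \<phi> x \<partial>\<pi> t \<omega>) = Z t \<omega>)))"
proof -
  interpret usual_filtration M "obs_filtration M E Y"
    using assms(1,9,10) by (rule usual_filtration_obs)
  obtain \<pi> :: "real \<Rightarrow> 'w \<Rightarrow> 's measure" where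
    \<pi>: "conditional_distribution_process M (obs_filtration M E Y) X \<pi>"
    and proj: "\<And>\<phi> :: 's \<Rightarrow> real. \<phi> \<in> borel_measurable borel \<Longrightarrow> bounded (range \<phi>) \<Longrightarrow>
      is_optional_projection M (obs_filtration M E Y) (\<lambda>t \<omega>. \<phi> (X t \<omega>)) (\<lambda>t \<omega>. \<integral>x. \<phi> x \<partial>\<pi> t \<omega>)"
    using conditional_distribution_exists[OF assms(6,8)] by blast
  show ?thesis
    using \<pi> proj optional_projection_unique[OF proj] by (intro exI[of _ \<pi>] conjI allI impI exI) auto
qed

end
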